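(* Let $r,r'\in\mathbb{Z}_2$ and $\alpha,\eta\in\mathbb{P}^1(k)$. If $\alpha\neq\eta$, then $M_s(r,\alpha)\otimes M_t(r',\eta)\cong stP(r+r')$ as $D_4$-modules for all integers $s,t\geq 1$.
   Context: Let $k$ be an algebraically closed field with $\mathrm{char}(k)\neq 2$. All modules are finite-dimensional left modules; $\otimes=\otimes_k$; $\mathbb{Z}_2=\mathbb{Z}/2\mathbb{Z}$; $nM$ denotes the direct sum of $n$ copies of $M$; $\mathbb{P}^1(k)$ is identified with $k\cup\{\infty\}$; $l(M)$ is the length of $M$. $D_4$ is the $k$-algebra generated by $a,b,c,d$ subject to $ba=-ab$, $db=-bd$, $ca=-ac$, $dc=-cd$, $bc=cb$, $a^2=0$, $b^2=1$, $c^2=1$, $d^2=0$, $da+ad=1-bc$. It is a $16$-dimensional Hopf algebra (isomorphic to the Drinfeld double of Sweedler's 4-dimensional Hopf algebra) with comultiplication $\Delta(a)=a\otimes b+1\otimes a$, $\Delta(b)=b\otimes b$, $\Delta(c)=c\otimes c$, $\Delta(d)=d\otimes c+1\otimes d$, counit $\varepsilon(a)=\varepsilon(d)=0$, $\varepsilon(b)=\varepsilon(c)=1$, antipode $S(a)=-ab$, $S(b)=b$, $S(c)=c$, $S(d)=-dc$. Tensor products of $D_4$-modules are $D_4$-modules via $\Delta$. For $r\in\mathbb{Z}_2$, $V(r)$ is the one-dimensional simple module on which $a,d$ act as $0$ and $b,c$ act as $(-1)^r$, and $P(r)$ is the projective cover of $V(r)$. For $r\in\mathbb{Z}_2$, $\eta\in\mathbb{P}^1(k)$,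 $M_1(r,\eta)$ is the module with basis $v_1,v_2$ where $b,c$ act on $v_1$ as $(-1)^{r+1}$ and on $v_2$ as $(-1)^r$, $av_2=dv_2=0$, and $av_1=v_2$, $dv_1=-\eta v_2$ if $\eta\in k$, while $av_1=0$, $dv_1=v_2$ if $\eta=\infty$. An indecomposable module $M$ of Loewy length $2$ is of $(s,t)$-type if $l(M/\mathrm{soc}(M))=s$ and $l(\mathrm{soc}(M))=t$. For $s\geq1$, $M_s(r,\eta)$ denotes the (known to be unique up to isomorphism) indecomposable module of $(s,s)$-type containing a submodule isomorphic to $M_1(r,\eta)$. *)

theory Defs
  imports
    "Jordan_Normal_Form.Matrix_Kernel"
    "HOL-Computational_Algebra.Polynomial"
    "HOL-Library.Z2"
begin

text \<open>
  A finite-dimensional left module over \<open>D\<^sub>4\<close> is given on a coordinate space \<open>k\<^sup>n\<close>, that is, on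
  \<^term>\<open>carrier_vec n\<close>, by the matrices through which the four generators act by left
  multiplication. As \<open>D\<^sub>4\<close> is presented by generators and relations, such matrices define a module
  structure precisely if they satisfy the defining relations. Every finite-dimensional module is
  isomorphic to one of this form.
\<close>

datatype gen = Ga | Gb | Gc | Gd

record 'k d4mod =
  mdim :: nat
  act :: "gen \<Rightarrow> 'k mat"

abbreviation space :: "'k d4mod \<Rightarrow> 'k vec set" where
  "space M \<equiv> carrier_vec (mdim M)"

definition d4_module :: "'k::field d4mod \<Rightarrow> bool" where
  "d4_module M \<longleftrightarrow>
     (let n = mdim M; A = act M Ga; B = act M Gb; C = act M Gc; D = act M Gd in
       (\<forall>g. act M g \<in> carrier_mat n n) \<and>
       B * A = - (A * B) \<and> D * B = - (B * D) \<and>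
       C * A = - (A * C) \<and> D * C = - (C * D) \<and>
       B * C = C * B \<and>
       A * A = 0\<^sub>m n n \<and> B * B = 1\<^sub>m n \<and> C * C = 1\<^sub>m n \<and> D * D = 0\<^sub>m n n \<and>
       D * A + A * D = 1\<^sub>m n - B * C)"


subsection \<open>Homomorphisms, submodules, quotients\<close>

definition d4_hom :: "'k::field d4mod \<Rightarrow> 'k d4mod \<Rightarrow> 'k mat set" where
  "d4_hom M N = {T \<in> carrier_mat (mdim N) (mdim M). \<forall>g. T * act M g = act N g * T}"

definition surj_hom :: "'k::field d4mod \<Rightarrow> 'k d4mod \<Rightarrow> 'k mat \<Rightarrow> bool" where
  "surj_hom M N T \<longleftrightarrow> T \<in> d4_hom M N \<and> (\<lambda>v. T *\<^sub>v v) ` space M = space N"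

definition isomorphic :: "'k::field d4mod \<Rightarrow> 'k d4mod \<Rightarrow> bool" (infix \<open>\<simeq>\<close> 50) where
  "M \<simeq> N \<longleftrightarrow> (\<exists>T \<in> d4_hom M N. bij_betw (\<lambda>v. T *\<^sub>v v) (space M) (space N))"

definition d4_submodule :: "'k::field d4mod \<Rightarrow> 'k vec set \<Rightarrow> bool" where
  "d4_submodule M U \<longleftrightarrow>
     U \<subseteq> space M \<and> 0\<^sub>v (mdim M) \<in> U \<and>
     (\<forall>u\<in>U. \<forall>w\<in>U. u + w \<in> U) \<and>
     (\<forall>c. \<forall>u\<in>U. c \<cdot>\<^sub>v u \<in> U) \<and>
     (\<forall>g. \<forall>u\<in>U. act M g *\<^sub>v u \<in> U)"

abbreviation zero_sub :: "'k::field d4mod \<Rightarrow> 'k vec set" where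
  "zero_sub M \<equiv> {0\<^sub>v (mdim M)}"

definition sub_sum :: "'k::field vec set \<Rightarrow> 'k vec set \<Rightarrow> 'k vec set" where
  "sub_sum U W = {u + w | u w. u \<in> U \<and> w \<in> W}"

text \<open>
  Submodules and quotients do not come with coordinates, so they are referred to up to isomorphism:
  \<open>represents_sub M U S\<close> says that the module \<open>S\<close> is isomorphic to the submodule \<open>U\<close> of \<open>M\<close>,
  and \<open>represents_quot M U Q\<close> that \<open>Q\<close> is isomorphic to \<open>M/U\<close>.
\<close>

definition represents_sub :: "'k::field d4mod \<Rightarrow> 'k vec set \<Rightarrow> 'k d4mod \<Rightarrow> bool" where
  "represents_sub M U S \<longleftrightarrow>
     d4_submodule M U \<and> d4_module S \<and> (\<exists>T \<in> d4_hom S M. bij_betw (\<lambda>v. T *\<^sub>v v) (space S) U)"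

definition represents_quot :: "'k::field d4mod \<Rightarrow> 'k vec set \<Rightarrow> 'k d4mod \<Rightarrow> bool" where
  "represents_quot M U Q \<longleftrightarrow>
     d4_submodule M U \<and> d4_module Q \<and> (\<exists>T. surj_hom M Q T \<and> mat_kernel T = U)"


subsection \<open>Indecomposability, length, socle, Loewy length\<close>

definition indecomposable :: "'k::field d4mod \<Rightarrow> bool" where
  "indecomposable M \<longleftrightarrow>
     mdim M \<noteq> 0 \<and>
     (\<forall>U W. d4_submodule M U \<and> d4_submodule M W \<and> U \<inter> W = zero_sub M \<and> sub_sum U W = space M
        \<longrightarrow> U = zero_sub M \<or> W = zero_sub M)"

definition composition_series :: "'k::field d4mod \<Rightarrow> 'k vec set list \<Rightarrow> bool" where
  "composition_series M Us \<longleftrightarrow>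
     Us \<noteq> [] \<and> hd Us = zero_sub M \<and> last Us = space M \<and>
     (\<forall>U \<in> set Us. d4_submodule M U) \<and>
     (\<forall>i. Suc i < length Us \<longrightarrow>
        Us ! i \<subset> Us ! Suc i \<and>
        (\<forall>W. d4_submodule M W \<and> Us ! i \<subseteq> W \<and> W \<subseteq> Us ! Suc i \<longrightarrow> W = Us ! i \<or> W = Us ! Suc i))"

text \<open>The length is a relation here; its uniqueness is the Jordan-Hoelder theorem.\<close>

definition has_length :: "'k::field d4mod \<Rightarrow> nat \<Rightarrow> bool" where
  "has_length M n \<longleftrightarrow> (\<exists>Us. composition_series M Us \<and> length Us = Suc n)"

definition simple_sub :: "'k::field d4mod \<Rightarrow> 'k vec set \<Rightarrow> bool" where
  "simple_sub M S \<longleftrightarrow>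
     d4_submodule M S \<and> S \<noteq> zero_sub M \<and>
     (\<forall>U. d4_submodule M U \<and> U \<subseteq> S \<longrightarrow> U = zero_sub M \<or> U = S)"

text \<open>The sum of all simple submodules, that is, the least submodule containing them.\<close>

definition soc :: "'k::field d4mod \<Rightarrow> 'k vec set" where
  "soc M = \<Inter> {W. d4_submodule M W \<and> (\<forall>S. simple_sub M S \<longrightarrow> S \<subseteq> W)}"

text \<open>
  The Loewy length is the length of the socle series, whose successive terms are the preimages of
  the socles of \<open>M\<close>, \<open>M/soc(M)\<close>, and so on.
\<close>

inductive loewy_length :: "'k::field d4mod \<Rightarrow> nat \<Rightarrow> bool" where
  zero: "mdim M = 0 \<Longrightarrow> loewy_length M 0"
| step: "mdim M \<noteq> 0 \<Longrightarrow> represents_quot M (soc M) Q \<Longrightarrow> loewy_length Q n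
          \<Longrightarrow> loewy_length M (Suc n)"

definition has_type :: "'k::field d4mod \<Rightarrow> nat \<Rightarrow> nat \<Rightarrow> bool" where
  "has_type M s t \<longleftrightarrow>
     d4_module M \<and> indecomposable M \<and> loewy_length M 2 \<and>
     (\<exists>Q. represents_quot M (soc M) Q \<and> has_length Q s) \<and>
     (\<exists>S. represents_sub M (soc M) S \<and> has_length S t)"


subsection \<open>Projective covers\<close>

text \<open>Projectivity is meant in the category of finite-dimensional modules.\<close>

definition projective :: "'k::field d4mod \<Rightarrow> bool" where
  "projective P \<longleftrightarrow>
     d4_module P \<and>
     (\<forall>X Y G F. d4_module X \<and> d4_module Y \<and> surj_hom X Y G \<and> F \<in> d4_hom P Y
        \<longrightarrow> (\<exists>H \<in> d4_hom P X. G * H = F))"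

definition projective_cover :: "'k::field d4mod \<Rightarrow> 'k d4mod \<Rightarrow> bool" where
  "projective_cover P M \<longleftrightarrow>
     projective P \<and>
     (\<exists>T. surj_hom P M T \<and>
        (\<forall>U. d4_submodule P U \<and> sub_sum U (mat_kernel T) = space P \<longrightarrow> U = space P))"


subsection \<open>Direct sums and tensor products\<close>

definition copies :: "nat \<Rightarrow> 'k::field d4mod \<Rightarrow> 'k d4mod" where
  "copies n M = \<lparr>mdim = n * mdim M, act = (\<lambda>g. diag_block_mat (replicate n (act M g)))\<rparr>"

text \<open>
  The Kronecker product is the matrix of the tensor product of two endomorphisms; the basis vector
  \<open>e\<^sub>i \<otimes> e\<^sub>j\<close> of \<open>k\<^sup>m \<otimes> k\<^sup>n\<close> has index \<open>i * n + j\<close>.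
\<close>

definition kron :: "'k::field mat \<Rightarrow> 'k mat \<Rightarrow> 'k mat" where
  "kron A B = mat (dim_row A * dim_row B) (dim_col A * dim_col B)
     (\<lambda>(i, j). A $$ (i div dim_row B, j div dim_col B) * B $$ (i mod dim_row B, j mod dim_col B))"

text \<open>The generators act on the tensor product through the comultiplication:
  \<open>a \<mapsto> a \<otimes> b + 1 \<otimes> a\<close>, \<open>b \<mapsto> b \<otimes> b\<close>, \<open>c \<mapsto> c \<otimes> c\<close>, \<open>d \<mapsto> d \<otimes> c + 1 \<otimes> d\<close>.\<close>

definition tensor :: "'k::field d4mod \<Rightarrow> 'k d4mod \<Rightarrow> 'k d4mod" where
  "tensor M N =
     \<lparr>mdim = mdim M * mdim N,
      act = (\<lambda>g. case g of
          Ga \<Rightarrow> kron (act M Ga) (act N Gb) + kron (1\<^sub>m (mdim M)) (act N Ga)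
        | Gb \<Rightarrow> kron (act M Gb) (act N Gb)
        | Gc \<Rightarrow> kron (act M Gc) (act N Gc)
        | Gd \<Rightarrow> kron (act M Gd) (act N Gc) + kron (1\<^sub>m (mdim M)) (act N Gd))\<rparr>"


subsection \<open>The modules \<open>V(r)\<close> and \<open>M\<^sub>s(r,\<eta>)\<close>\<close>

text \<open>The integers modulo 2 are the type \<^typ>\<open>bit\<close>; \<open>parity_sign r\<close> is \<open>(-1)\<^sup>r\<close>.\<close>

definition parity_sign :: "bit \<Rightarrow> 'k::field" where
  "parity_sign r = (if r = 0 then 1 else - 1)"

datatype 'k proj_line = Fin 'k | Infty

definition V_mod :: "bit \<Rightarrow> 'k::field d4mod" where
  "V_mod r =
     \<lparr>mdim = 1,
      act = (\<lambda>g. if g = Gb \<or> g = Gc then parity_sign r \<cdot>\<^sub>m 1\<^sub>m 1 else 0\<^sub>m 1 1)\<rparr>"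

text \<open>The columns of the matrices are the images of \<open>v\<^sub>1\<close>, \<open>v\<^sub>2\<close>.\<close>

definition M1 :: "bit \<Rightarrow> 'k::field proj_line \<Rightarrow> 'k d4mod" where
  "M1 r \<eta> =
     \<lparr>mdim = 2,
      act = (\<lambda>g. case g of
          Ga \<Rightarrow> mat_of_rows_list 2 [[0, 0], [(case \<eta> of Fin x \<Rightarrow> 1 | Infty \<Rightarrow> 0), 0]]
        | Gb \<Rightarrow> mat_of_rows_list 2 [[parity_sign (r + 1), 0], [0, parity_sign r]]
        | Gc \<Rightarrow> mat_of_rows_list 2 [[parity_sign (r + 1), 0], [0, parity_sign r]]
        | Gd \<Rightarrow> mat_of_rows_list 2 [[0, 0], [(case \<eta> of Fin x \<Rightarrow> - x | Infty \<Rightarrow> 1), 0]])\<rparr>"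

text \<open>\<open>is_Ms s r \<eta> M\<close>: the module \<open>M\<close> is (a representative of the isomorphism class) \<open>M\<^sub>s(r,\<eta>)\<close>.\<close>

definition is_Ms :: "nat \<Rightarrow> bit \<Rightarrow> 'k::field proj_line \<Rightarrow> 'k d4mod \<Rightarrow> bool" where
  "is_Ms s r \<eta> M \<longleftrightarrow> has_type M s s \<and> (\<exists>U. represents_sub M U (M1 r \<eta>))"

end

theory Submission
  imports Defs "Jordan_Normal_Form.Char_Poly"
begin

text \<open>
  Since \<open>bc\<close> is central, indecomposability forces \<open>b = c\<close> on \<open>M\<^sub>s(r,\<alpha>)\<close>; the Loewy length makes all
  products of \<open>a\<close> and \<open>d\<close> vanish, and \<open>M\<^sub>s(r,\<alpha>)\<close> is a pair of maps \<open>a, d : V \<rightarrow> W\<close> from one eigenspace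
  of \<open>b\<close> to the other, both of dimension \<open>s\<close>. This pencil is indecomposable with a singular member
  \<open>E\<^sub>\<alpha>\<close>, hence regular: a singular pencil would split off a minimal polynomial kernel vector. Fitting's
  lemma then shows that \<open>E\<^sub>\<alpha>\<close> is nilpotent relative to any other member. On the tensor product \<open>ad\<close>
  maps \<open>V \<otimes> V'\<close> to \<open>W \<otimes> W'\<close> by a multiple of \<open>a \<otimes> d - d \<otimes> a\<close>, which is a multiple of
  \<open>E\<^sub>\<alpha> \<otimes> E\<^sub>\<eta> - E\<^sub>\<eta> \<otimes> E\<^sub>\<alpha>\<close> and therefore injective. So a basis of \<open>V \<otimes> V'\<close> freely generates
  the tensor product over the exterior algebra on \<open>a, d\<close>, that is, each basis vector generates a copy
  of \<open>P(r + r')\<close>.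
\<close>

subsection \<open>Matrices and subspaces\<close>

text \<open>The modules are given only by indecomposability, lengths and one submodule, so no
  matrices of \<open>a\<close> and \<open>d\<close> are available. The two maps represent the
  Kronecker quiver, but its classification is replaced by two facts: an indecomposable square pencil
  has a nonsingular member, and a singular member is nilpotent relative to it. For the first, a
  kernel vector of least degree \<open>d\<close> spans a piece with \<open>d + 1\<close> dimensions
  in the source and \<open>d\<close> in the target, which cannot be all of a square pencil. The
  difficulty is to find a complement of this piece: minimality of \<open>d\<close> is dualized into
  linear functionals, and these provide the retractions. Passing from vanishing determinants to a
  polynomial kernel vector takes infinitely many scalars, and algebraic closedness supplies them.
  The condition \<alpha> \<noteq> \<eta> makes the singular members for \<alpha> and for \<eta> a
  basis of the pencil, so the alternating expression in \<open>a\<close> and \<open>d\<close> can be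
  rewritten in them. The projective cover is given just as abstractly; it is compared with an
  explicit four-dimensional module.\<close>

definition subsp :: "nat \<Rightarrow> 'a::field vec set \<Rightarrow> bool" where
  "subsp n U \<longleftrightarrow> U \<subseteq> carrier_vec n \<and> 0\<^sub>v n \<in> U \<and> (\<forall>u\<in>U. \<forall>w\<in>U. u + w \<in> U) \<and>
     (\<forall>c. \<forall>u\<in>U. c \<cdot>\<^sub>v u \<in> U)"

text \<open>Bases are carried as matrices: \<open>inj_mat\<close> is the independence of the
  columns, \<open>rng\<close> is their span, and the number of columns plays the part of the
  dimension. All dimension counts compare numbers of columns.\<close>

definition inj_mat :: "'a::field mat \<Rightarrow> bool" where
  "inj_mat Q \<longleftrightarrow> (\<forall>x\<in>carrier_vec (dim_col Q). Q *\<^sub>v x = 0\<^sub>v (dim_row Q) \<longrightarrow> x = 0\<^sub>v (dim_col Q))"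

definition rng :: "'a::field mat \<Rightarrow> 'a vec set" where
  "rng Q = (\<lambda>x. Q *\<^sub>v x) ` carrier_vec (dim_col Q)"

lemma mult_zero_vec [simp]: "A \<in> carrier_mat n m \<Longrightarrow> A *\<^sub>v 0\<^sub>v m = (0\<^sub>v n :: 'a::field vec)"
  by (intro eq_vecI) auto

lemma zero_smult_vec [simp]: "u \<in> carrier_vec n \<Longrightarrow> 0 \<cdot>\<^sub>v u = (0\<^sub>v n :: 'a::field vec)"
  by (intro eq_vecI) auto

lemma smult_zero_vec_right [simp]: "c \<cdot>\<^sub>v 0\<^sub>v n = (0\<^sub>v n :: 'a::field vec)"
  by (intro eq_vecI) auto

lemma zero_mat_mult_vec: "v \<in> carrier_vec m \<Longrightarrow> 0\<^sub>m n m *\<^sub>v v = (0\<^sub>v n :: 'a::field vec)"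
  by (intro eq_vecI) auto

lemma smult_mat_mult_vec:
  fixes A :: "'a::field mat"
  assumes "A \<in> carrier_mat n m" "x \<in> carrier_vec m"
  shows "(c \<cdot>\<^sub>m A) *\<^sub>v x = c \<cdot>\<^sub>v (A *\<^sub>v x)"
  using assms by (intro eq_vecI) auto

lemma vec_diff_add: "x \<in> carrier_vec n \<Longrightarrow> u \<in> carrier_vec n \<Longrightarrow> x = u + (x - u)" for x :: "'a::field vec"
  by (intro eq_vecI) auto

lemma inj_matD:
  "inj_mat Q \<Longrightarrow> Q \<in> carrier_mat n d \<Longrightarrow> x \<in> carrier_vec d \<Longrightarrow> Q *\<^sub>v x = 0\<^sub>v n \<Longrightarrow> x = 0\<^sub>v d"
  unfolding inj_mat_def by auto

lemma inj_matI:
  "Q \<in> carrier_mat n d \<Longrightarrow> (\<And>x. x \<in> carrier_vec d \<Longrightarrow> Q *\<^sub>v x = 0\<^sub>v n \<Longrightarrow> x = 0\<^sub>v d) \<Longrightarrow> inj_mat Q"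
  unfolding inj_mat_def by auto

lemma minus_eq_zero_vecD:
  assumes "u \<in> carrier_vec n" "v \<in> carrier_vec n" "u - v = (0\<^sub>v n :: 'a::field vec)"
  shows "u = v"
proof (rule eq_vecI)
  fix i assume "i < dim_vec v"
  then have i: "i < n" using assms(2) by simp
  have "(u - v) $ i = 0" using assms(3) i by simp
  then show "u $ i = v $ i" using assms(1,2) i by simp
qed (use assms in auto)

lemma inj_mat_eqD:
  assumes "inj_mat Q" "Q \<in> carrier_mat n d" "x \<in> carrier_vec d" "y \<in> carrier_vec d"
    "Q *\<^sub>v x = Q *\<^sub>v y"
  shows "x = y"
proof -
  have "Q *\<^sub>v (x - y) = Q *\<^sub>v y - Q *\<^sub>v y"
    using mult_minus_distrib_mat_vec[OF assms(2,3,4)] assms(5) by simp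
  also have "\<dots> = 0\<^sub>v n" using assms(2) by (intro eq_vecI) auto
  finally have "Q *\<^sub>v (x - y) = 0\<^sub>v n" .
  then have "x - y = 0\<^sub>v d"
    using inj_matD[OF assms(1,2)] minus_carrier_vec[OF assms(3,4)] by blast
  then show ?thesis by (rule minus_eq_zero_vecD[OF assms(3,4)])
qed

lemma left_inverse_imp_inj_mat:
  assumes "Q \<in> carrier_mat n d" "L \<in> carrier_mat d n" "L * Q = 1\<^sub>m d"
  shows "inj_mat Q"
proof (rule inj_matI[OF assms(1)])
  fix x assume x: "x \<in> carrier_vec d" "Q *\<^sub>v x = 0\<^sub>v n"
  have "x = L *\<^sub>v (Q *\<^sub>v x)" using assms x by (subst assoc_mult_mat_vec[symmetric]) auto
  then show "x = 0\<^sub>v d" using x assms by simp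
qed

lemma rngI: "Q \<in> carrier_mat n d \<Longrightarrow> x \<in> carrier_vec d \<Longrightarrow> Q *\<^sub>v x \<in> rng Q"
  unfolding rng_def by auto

lemma rngE:
  assumes "v \<in> rng Q" "Q \<in> carrier_mat n d"
  obtains x where "x \<in> carrier_vec d" "v = Q *\<^sub>v x"
  using assms unfolding rng_def by auto

lemma subsp_rng: "Q \<in> carrier_mat n d \<Longrightarrow> subsp n (rng Q)"
  unfolding subsp_def
proof (intro conjI ballI allI)
  assume Q: "Q \<in> carrier_mat n d"
  show "rng Q \<subseteq> carrier_vec n" using Q by (auto simp: rng_def)
  show "0\<^sub>v n \<in> rng Q" using rngI[OF Q, of "0\<^sub>v d"] Q by auto
  fix u assume "u \<in> rng Q"
  then obtain x where x: "x \<in> carrier_vec d" "u = Q *\<^sub>v x" using Q by (rule rngE)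
  show "c \<cdot>\<^sub>v u \<in> rng Q" for c
    using rngI[OF Q, of "c \<cdot>\<^sub>v x"] x Q by (simp add: mult_mat_vec[of _ n d])
  fix w assume "w \<in> rng Q"
  then obtain y where y: "y \<in> carrier_vec d" "w = Q *\<^sub>v y" using Q by (rule rngE)
  show "u + w \<in> rng Q"
    using rngI[OF Q, of "x + y"] x y Q by (simp add: mult_add_distrib_mat_vec[of _ n d])
qed

text \<open>More columns than rows force a dependency: padded with zero rows to a square matrix,
  \<open>Q\<close> becomes singular, and a kernel vector of the padded matrix is one of
  \<open>Q\<close>.\<close>

lemma inj_mat_le:
  fixes Q :: "'a::field mat"
  assumes Q: "Q \<in> carrier_mat n d" and inj: "inj_mat Q"
  shows "d \<le> n"
proof (rule ccontr)
  assume "\<not> d \<le> n"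
  then have nd: "n < d" by simp
  define S where "S = mat d d (\<lambda>(i, j). if i < n then Q $$ (i, j) else 0)"
  have S: "S \<in> carrier_mat d d" by (simp add: S_def)
  have "row S n = 0\<^sub>v d" using nd by (intro eq_vecI) (auto simp: S_def)
  \<comment> \<open>Row \<open>n\<close> of \<open>S\<close> is zero, so the transpose kills the
    unit vector with index \<open>n\<close>; this index is legitimate because
    \<open>n < d\<close>.\<close>
  have "det S = 0"
  proof -
    have "det (S\<^sup>T) = 0"
    proof (subst det_0_iff_vec_prod_zero_field[of _ d], simp add: S, intro exI conjI)
      show "unit_vec d n \<in> carrier_vec d" "unit_vec d n \<noteq> (0\<^sub>v d :: 'a vec)" using nd by auto
      show "S\<^sup>T *\<^sub>v unit_vec d n = 0\<^sub>v d"
        using nd S by (intro eq_vecI) (auto simp: S_def)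
    qed
    then show ?thesis using det_transpose[OF S] by simp
  qed
  then obtain v where v: "v \<in> carrier_vec d" "v \<noteq> 0\<^sub>v d" "S *\<^sub>v v = 0\<^sub>v d"
    using det_0_iff_vec_prod_zero_field[OF S] by auto
  have "Q *\<^sub>v v = 0\<^sub>v n"
  proof (rule eq_vecI)
    fix i assume "i < dim_vec (0\<^sub>v n :: 'a vec)"
    then have i: "i < n" by simp
    have "row Q i = row S i" using Q i nd by (intro eq_vecI) (auto simp: S_def)
    moreover have "(S *\<^sub>v v) $ i = 0" using v i nd by simp
    ultimately show "(Q *\<^sub>v v) $ i = 0\<^sub>v n $ i" using Q i nd S by auto
  qed (use Q in auto)
  then show False using inj_matD[OF inj Q] v by blast
qed

lemma inj_mat_square:
  fixes Q :: "'a::field mat"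
  assumes Q: "Q \<in> carrier_mat n n" and inj: "inj_mat Q"
  obtains R where "R \<in> carrier_mat n n" "R * Q = 1\<^sub>m n" "Q * R = 1\<^sub>m n"
proof -
  have "det Q \<noteq> 0"
    using det_0_iff_vec_prod_zero_field[OF Q] inj_matD[OF inj Q] by blast
  from det_non_zero_imp_unit[OF Q this, of undefined]
  show ?thesis using that by (auto simp: Units_def ring_mat_def)
qed

definition snoc_col :: "'a::field mat \<Rightarrow> 'a vec \<Rightarrow> 'a mat" where
  "snoc_col Q u = mat (dim_row Q) (Suc (dim_col Q)) (\<lambda>(i, j). if j < dim_col Q then Q $$ (i, j) else u $ i)"

lemma snoc_col_carrier [simp]: "Q \<in> carrier_mat n d \<Longrightarrow> snoc_col Q u \<in> carrier_mat n (Suc d)"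
  by (auto simp: snoc_col_def)

lemma snoc_col_mult_vec:
  assumes "Q \<in> carrier_mat n d" "u \<in> carrier_vec n" "x \<in> carrier_vec (Suc d)"
  shows "snoc_col Q u *\<^sub>v x = Q *\<^sub>v vec d (($) x) + x $ d \<cdot>\<^sub>v u"
  using assms
  by (intro eq_vecI)
    (auto simp: snoc_col_def scalar_prod_def atLeast0LessThan mult.commute intro!: sum.cong)

text \<open>A dependency with nonzero coefficient at \<open>u\<close> could be solved for
  \<open>u\<close>, placing it in the span. So that coefficient is zero, and the dependency is one
  among the columns of \<open>Q\<close>.\<close>

lemma snoc_col_inj:
  assumes Q: "Q \<in> carrier_mat n d" and u: "u \<in> carrier_vec n" and inj: "inj_mat Q" and nu: "u \<notin> rng Q"
  shows "inj_mat (snoc_col Q u)"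
proof (rule inj_matI[OF snoc_col_carrier[OF Q]])
  fix x assume x: "x \<in> carrier_vec (Suc d)" and "snoc_col Q u *\<^sub>v x = 0\<^sub>v n"
  then have e: "Q *\<^sub>v vec d (($) x) + x $ d \<cdot>\<^sub>v u = 0\<^sub>v n" using Q u by (simp add: snoc_col_mult_vec)
  have "x $ d = 0"
  proof (rule ccontr)
    assume nz: "x $ d \<noteq> 0"
    define y where "y = (- inverse (x $ d)) \<cdot>\<^sub>v vec d (($) x)"
    have "u = Q *\<^sub>v y"
    proof (rule eq_vecI)
      fix i assume "i < dim_vec (Q *\<^sub>v y)"
      then have i: "i < n" using Q by simp
      have "(Q *\<^sub>v vec d (($) x)) $ i + x $ d * u $ i = 0"
        using arg_cong[OF e, of "\<lambda>w. w $ i"] i Q u by auto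
      moreover have "(Q *\<^sub>v y) $ i = (- inverse (x $ d)) * (Q *\<^sub>v vec d (($) x)) $ i"
        using Q i unfolding y_def by (subst mult_mat_vec[of _ n d]) auto
      ultimately show "u $ i = (Q *\<^sub>v y) $ i" using nz by (simp add: field_simps add_eq_0_iff)
    qed (use Q u in auto)
    then show False using nu rngI[OF Q, of y] by (simp add: y_def)
  qed
  then have "Q *\<^sub>v vec d (($) x) = 0\<^sub>v n" using e Q u by simp
  then have "vec d (($) x) = 0\<^sub>v d" using inj_matD[OF inj Q] by simp
  then have "x $ j = 0" if "j < d" for j using that by (metis index_vec index_zero_vec(1))
  then show "x = 0\<^sub>v (Suc d)" using x \<open>x $ d = 0\<close> by (intro eq_vecI) (auto simp: less_Suc_eq)
qed

section \<open>Bases, functionals and complements of subspaces\<close>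

lemma subsp_closed:
  assumes "subsp n U"
  shows "u \<in> U \<Longrightarrow> w \<in> U \<Longrightarrow> u + w \<in> U" "u \<in> U \<Longrightarrow> c \<cdot>\<^sub>v u \<in> U" "0\<^sub>v n \<in> U" "u \<in> U \<Longrightarrow> u \<in> carrier_vec n"
    "u \<in> U \<Longrightarrow> w \<in> U \<Longrightarrow> u - w \<in> U"
proof -
  show a: "u \<in> U \<Longrightarrow> w \<in> U \<Longrightarrow> u + w \<in> U" "u \<in> U \<Longrightarrow> c \<cdot>\<^sub>v u \<in> U" "0\<^sub>v n \<in> U" "u \<in> U \<Longrightarrow> u \<in> carrier_vec n"
    for u w c using assms unfolding subsp_def by auto
  assume "u \<in> U" "w \<in> U"
  moreover have "u - w = u + (-1) \<cdot>\<^sub>v w" using calculation a(4) by (intro eq_vecI) auto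
  ultimately show "u - w \<in> U" using a by simp
qed

lemma subsp_image:
  fixes X :: "'a::field mat"
  assumes X: "X \<in> carrier_mat n m" and S: "subsp m S"
  shows "subsp n ((\<lambda>x. X *\<^sub>v x) ` S)"
  unfolding subsp_def
proof (intro conjI ballI allI)
  show "(*\<^sub>v) X ` S \<subseteq> carrier_vec n" using mult_mat_vec_carrier[OF X] subsp_closed(4)[OF S] by blast
  show "0\<^sub>v n \<in> (*\<^sub>v) X ` S" using subsp_closed(3)[OF S] mult_zero_vec[OF X] by (metis image_eqI)
  fix u assume "u \<in> (*\<^sub>v) X ` S"
  then obtain x where x: "x \<in> S" "u = X *\<^sub>v x" by auto
  show "c \<cdot>\<^sub>v u \<in> (*\<^sub>v) X ` S" for c
    using x subsp_closed(2)[OF S x(1), of c] mult_mat_vec[OF X subsp_closed(4)[OF S x(1)], of c] by (metis image_eqI)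
  fix w assume "w \<in> (*\<^sub>v) X ` S"
  then obtain y where y: "y \<in> S" "w = X *\<^sub>v y" by auto
  show "u + w \<in> (*\<^sub>v) X ` S"
    using x y subsp_closed(1)[OF S x(1) y(1)]
      mult_add_distrib_mat_vec[OF X subsp_closed(4)[OF S x(1)] subsp_closed(4)[OF S y(1)]] by (metis image_eqI)
qed

lemma subsp_Int: "subsp n U \<Longrightarrow> subsp n W \<Longrightarrow> subsp n (U \<inter> W)"
  by (auto simp: subsp_def)

lemma snoc_col_rng:
  assumes U: "subsp n U" and Q: "Q \<in> carrier_mat n d" "rng Q \<subseteq> U" and u: "u \<in> U"
  shows "rng (snoc_col Q u) \<subseteq> U"
proof
  fix v assume "v \<in> rng (snoc_col Q u)"
  then obtain x where x: "x \<in> carrier_vec (Suc d)" "v = snoc_col Q u *\<^sub>v x"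
    using snoc_col_carrier[OF Q(1)] by (rule rngE)
  have "Q *\<^sub>v vec d (($) x) \<in> U" using rngI[OF Q(1), of "vec d (($) x)"] Q(2) by auto
  then show "v \<in> U"
    unfolding x(2) snoc_col_mult_vec[OF Q(1) subsp_closed(4)[OF U u] x(1)]
    by (intro subsp_closed[OF U] u)
qed

text \<open>As long as the span is smaller than \<open>U\<close>, a vector outside it is appended;
  \<open>inj_mat_le\<close> bounds the number of columns by \<open>n\<close>, so
  \<open>n - d\<close> decreases. Keeping the old columns in front is what later yields left
  inverses and complements.\<close>

lemma basis_extend:
  assumes "subsp n U" "Q \<in> carrier_mat n d" "inj_mat Q" "rng Q \<subseteq> U"
  shows "\<exists>d' Q'. Q' \<in> carrier_mat n d' \<and> inj_mat Q' \<and> rng Q' = U \<and> d \<le> d' \<and> (\<forall>j<d. col Q' j = col Q j)"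
  using assms(2-)
proof (induction "n - d" arbitrary: d Q rule: less_induct)
  case less
  show ?case
  proof (cases "rng Q = U")
    case True then show ?thesis using less.prems by blast
  next
    case False
    then obtain u where u: "u \<in> U" "u \<notin> rng Q" using less.prems by auto
    then have un: "u \<in> carrier_vec n" using subsp_closed[OF assms(1)] by auto
    let ?R = "snoc_col Q u"
    have R: "?R \<in> carrier_mat n (Suc d)" "inj_mat ?R" "rng ?R \<subseteq> U"
      using snoc_col_inj[OF less.prems(1) un less.prems(2) u(2)] snoc_col_rng[OF assms(1) less.prems(1,3) u(1)]
        less.prems by auto
    have "n - Suc d < n - d" using inj_mat_le[OF R(1,2)] by simp
    from less.hyps[OF this R] obtain d' Q' where
      Q': "Q' \<in> carrier_mat n d'" "inj_mat Q'" "rng Q' = U" "Suc d \<le> d'" "\<forall>j<Suc d. col Q' j = col ?R j" by blast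
    moreover have "col ?R j = col Q j" if "j < d" for j
      using that less.prems(1) by (intro eq_vecI) (auto simp: snoc_col_def)
    ultimately show ?thesis by (intro exI[of _ d'] exI[of _ Q']) auto
  qed
qed

lemma basis_exists:
  assumes "subsp n U"
  obtains d Q where "Q \<in> carrier_mat n d" "inj_mat Q" "rng Q = U"
proof -
  \<comment> \<open>The empty basis, a matrix without columns, starts the extension.\<close>
  define Z :: "'a mat" where "Z = mat n 0 (\<lambda>_. 0)"
  have Z: "Z \<in> carrier_mat n 0" by (simp add: Z_def)
  have "inj_mat Z" by (rule inj_matI[OF Z]) auto
  moreover have "rng Z \<subseteq> U"
  proof
    fix v assume "v \<in> rng Z"
    then have "v = 0\<^sub>v n" unfolding rng_def Z_def by (auto intro!: eq_vecI simp: scalar_prod_def)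
    then show "v \<in> U" using subsp_closed[OF assms] by simp
  qed
  ultimately show ?thesis using basis_extend[OF assms Z] that by blast
qed

lemma subsp_carrier [simp]: "subsp n (carrier_vec n)"
  by (auto simp: subsp_def)

lemma rng_subset_carrier: "Q \<in> carrier_mat n d \<Longrightarrow> rng Q \<subseteq> carrier_vec n"
  by (auto simp: rng_def)

text \<open>Independence gives \<open>d \<le> n\<close>. Conversely, solving for every unit vector
  produces a right inverse of \<open>Q\<close>; its own columns are then independent, which gives
  \<open>n \<le> d\<close>.\<close>

lemma rng_carrier_square:
  assumes Q: "Q \<in> carrier_mat n d" and "inj_mat Q" "rng Q = carrier_vec n"
  shows "d = n"
proof -
  have "d \<le> n" using assms inj_mat_le by blast
  moreover have "\<exists>R. R \<in> carrier_mat d n \<and> Q * R = 1\<^sub>m n"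
  proof -
    have "\<forall>j<n. \<exists>x. x \<in> carrier_vec d \<and> unit_vec n j = Q *\<^sub>v x"
      using assms(3) rngE[OF _ Q] by (metis unit_vec_carrier)
    then obtain f where f: "\<And>j. j < n \<Longrightarrow> f j \<in> carrier_vec d \<and> unit_vec n j = Q *\<^sub>v f j" by metis
    define R where "R = mat d n (\<lambda>(i, j). f j $ i)"
    have "col R j = f j" if "j < n" for j using f[OF that] that by (intro eq_vecI) (auto simp: R_def)
    moreover have "col (Q * R) j = Q *\<^sub>v col R j" if "j < n" for j
      using that Q by (intro col_mult2) (auto simp: R_def)
    ultimately have "col (Q * R) j = unit_vec n j" if "j < n" for j using that f by simp
    then have "Q * R = 1\<^sub>m n" using Q by (intro mat_col_eqI) (auto simp: R_def)
    then show ?thesis by (intro exI[of _ R]) (auto simp: R_def)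
  qed
  then have "n \<le> d" using left_inverse_imp_inj_mat[of _ d n Q] inj_mat_le Q by metis
  ultimately show ?thesis by simp
qed

lemma mult_mat_unit_vec:
  fixes A :: "'a::field mat"
  assumes "A \<in> carrier_mat n m" "j < m"
  shows "A *\<^sub>v unit_vec m j = col A j"
  using assms by (intro eq_vecI) auto

lemma mat_eq_by_vec:
  assumes "A \<in> carrier_mat n m" "B \<in> carrier_mat n m"
    "\<And>x. x \<in> carrier_vec m \<Longrightarrow> A *\<^sub>v x = B *\<^sub>v (x :: 'a::field vec)"
  shows "A = B"
proof (rule mat_col_eqI)
  fix j assume "j < dim_col B"
  then have j: "j < m" using assms by simp
  show "col A j = col B j"
    using assms(3)[of "unit_vec m j"] mult_mat_unit_vec[OF assms(1) j] mult_mat_unit_vec[OF assms(2) j] by simp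
qed (use assms in auto)

text \<open>The columns of \<open>Q\<close> are completed to a basis of the whole space; the first
  \<open>d\<close> rows of the inverse of that square matrix form \<open>L\<close>.\<close>

lemma left_inverse_exists:
  assumes Q: "Q \<in> carrier_mat n d" and inj: "inj_mat Q"
  obtains L where "L \<in> carrier_mat d n" "L * Q = 1\<^sub>m d"
proof -
  obtain d' Q' where Q': "Q' \<in> carrier_mat n d'" "inj_mat Q'" "rng Q' = carrier_vec n" "d \<le> d'"
      "\<forall>j<d. col Q' j = col Q j"
    using basis_extend[OF subsp_carrier Q inj rng_subset_carrier[OF Q]] by blast
  then have [simp]: "d' = n" using rng_carrier_square by blast
  obtain R where R: "R \<in> carrier_mat n n" "R * Q' = 1\<^sub>m n" using inj_mat_square Q' by (metis \<open>d' = n\<close>)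
  define L where "L = mat d n (\<lambda>(i, j). R $$ (i, j))"
  have "L * Q = 1\<^sub>m d"
  proof (rule eq_matI)
    fix i j assume ij: "i < dim_row (1\<^sub>m d :: 'a mat)" "j < dim_col (1\<^sub>m d :: 'a mat)"
    then have "i < d" "j < d" by auto
    have "row L i = row R i" using ij R Q'(4) by (intro eq_vecI) (auto simp: L_def)
    then have "(L * Q) $$ (i, j) = row R i \<bullet> col Q' j" using ij Q Q'(4,5) by (simp add: L_def)
    also have "\<dots> = (R * Q') $$ (i, j)" using ij R(1) Q'(1,4) by simp
    also have "\<dots> = 1\<^sub>m d $$ (i, j)" using ij Q'(4) by (subst R(2)) simp
    finally show "(L * Q) $$ (i, j) = 1\<^sub>m d $$ (i, j)" .
  qed (use Q in \<open>auto simp: L_def\<close>)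
  then show ?thesis using that[of L] by (simp add: L_def)
qed

text \<open>A basis of \<open>U\<close> followed by \<open>u\<close> has independent columns, and
  the last row of a left inverse reads off the coefficient of \<open>u\<close>.\<close>

lemma separating_functional:
  assumes U: "subsp n U" and u: "u \<in> carrier_vec n" "u \<notin> U"
  obtains y where "y \<in> carrier_vec n" "\<And>x. x \<in> U \<Longrightarrow> y \<bullet> x = 0" "y \<bullet> u = 1"
proof -
  obtain d Q where Q: "Q \<in> carrier_mat n d" "inj_mat Q" "rng Q = U"

    by (rule basis_exists[OF U])
  let ?R = "snoc_col Q u"
  have R: "?R \<in> carrier_mat n (Suc d)" "inj_mat ?R" using snoc_col_inj[OF Q(1) u(1) Q(2)] Q u by auto
  obtain L where L: "L \<in> carrier_mat (Suc d) n" "L * ?R = 1\<^sub>m (Suc d)" using left_inverse_exists[OF R] .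
  have key: "row L d \<bullet> (?R *\<^sub>v x) = x $ d" if x: "x \<in> carrier_vec (Suc d)" for x
  proof -
    have "row L d \<bullet> (?R *\<^sub>v x) = (L *\<^sub>v (?R *\<^sub>v x)) $ d" using L by simp
    also have "L *\<^sub>v (?R *\<^sub>v x) = x" using L R x by (subst assoc_mult_mat_vec[symmetric]) auto
    finally show ?thesis .
  qed
  show ?thesis
  proof (rule that[of "row L d"])
    show "row L d \<in> carrier_vec n" using L by auto
    have "?R *\<^sub>v unit_vec (Suc d) d = u"
    proof -
      have "vec d (($) (unit_vec (Suc d) d)) = (0\<^sub>v d :: 'a vec)" by (intro eq_vecI) auto
      then show ?thesis using Q u by (simp add: snoc_col_mult_vec[OF Q(1) u(1)])
    qed
    then show "row L d \<bullet> u = 1" using key[of "unit_vec (Suc d) d"] by simp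
    fix x :: "'a vec" assume "x \<in> U"
    then have "x \<in> rng Q" using Q by simp
    then obtain z where z: "z \<in> carrier_vec d" "x = Q *\<^sub>v z" using Q(1) by (rule rngE)
    let ?z = "vec (Suc d) (\<lambda>j. if j < d then z $ j else 0)"
    have "vec d (($) ?z) = z" using z by (intro eq_vecI) auto
    then have "?R *\<^sub>v ?z = x" using z Q u by (simp add: snoc_col_mult_vec[OF Q(1) u(1)])
    then show "row L d \<bullet> (x) = 0" using key[of ?z] by simp
  qed
qed

text \<open>Each column of \<open>X\<close> is expressed through the columns of \<open>W\<close>.
  This is how a map into a subspace receives its matrix in coordinates of that subspace.\<close>

lemma factor_through:
  assumes X: "X \<in> carrier_mat n m" and W: "W \<in> carrier_mat n d"
    and "\<And>x. x \<in> carrier_vec m \<Longrightarrow> X *\<^sub>v x \<in> rng W"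
  obtains Y where "Y \<in> carrier_mat d m" "X = W * Y"
proof -
  have "\<forall>j<m. \<exists>x. x \<in> carrier_vec d \<and> X *\<^sub>v unit_vec m j = W *\<^sub>v x"
    using assms(3) rngE[OF _ W] by (metis unit_vec_carrier)
  then obtain f where f: "\<And>j. j < m \<Longrightarrow> f j \<in> carrier_vec d \<and> X *\<^sub>v unit_vec m j = W *\<^sub>v f j" by metis
  define R where "R = mat d m (\<lambda>(i, j). f j $ i)"
  have "X = W * R"
  proof (rule mat_col_eqI)
    fix j assume "j < dim_col (W * R)"
    then have j: "j < m" by (simp add: R_def)
    have "col R j = f j" using f[OF j] j by (intro eq_vecI) (auto simp: R_def)
    moreover have "col X j = X *\<^sub>v unit_vec m j" using mult_mat_unit_vec[OF X j] by simp
    moreover have "col (W * R) j = W *\<^sub>v col R j" using j W by (intro col_mult2) (auto simp: R_def)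
    ultimately show "col X j = col (W * R) j" using f[OF j] by simp
  qed (use X W in \<open>auto simp: R_def\<close>)
  then show ?thesis using that[of R] by (simp add: R_def)
qed

text \<open>A basis of \<open>S\<close> is prolonged to a basis of \<open>U\<close>, and
  \<open>C\<close> is the span of the added columns.\<close>

lemma complement_exists:
  assumes S: "subsp n S" and U: "subsp n U" and SU: "S \<subseteq> U"
  obtains C where "subsp n C" "C \<subseteq> U" "S \<inter> C = {0\<^sub>v n}" "\<And>u. u \<in> U \<Longrightarrow> \<exists>s\<in>S. \<exists>c\<in>C. u = s + c"
proof -
  obtain d Q where Q: "Q \<in> carrier_mat n d" "inj_mat Q" "rng Q = S" by (rule basis_exists[OF S])
  obtain d' Q' where Q': "Q' \<in> carrier_mat n d'" "inj_mat Q'" "rng Q' = U" "d \<le> d'" "\<forall>j<d. col Q' j = col Q j"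
    using basis_extend[OF U Q(1,2)] Q SU by blast
  \<comment> \<open>\<open>D\<close> erases the first \<open>d\<close> coordinates, so the range of
    \<open>Q' * D\<close> is the span of the added columns.\<close>
  define D :: "'a mat" where "D = mat d' d' (\<lambda>(i, j). if i = j \<and> d \<le> i then 1 else 0)"
  have D: "D \<in> carrier_mat d' d'" by (simp add: D_def)
  have Dx: "(D *\<^sub>v x) $ i = (if d \<le> i then x $ i else 0)" if "x \<in> carrier_vec d'" "i < d'" for x i
  proof -
    have "(D *\<^sub>v x) $ i = (\<Sum>j\<in>{0..<d'}. if i = j then (if d \<le> i then x $ i else 0) else 0)"
    proof -
      have "(D *\<^sub>v x) $ i = (\<Sum>j\<in>{0..<d'}. D $$ (i, j) * x $ j)"
        using that D by (simp add: scalar_prod_def)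
      also have "\<dots> = (\<Sum>j\<in>{0..<d'}. if i = j then (if d \<le> i then x $ i else 0) else 0)"
        by (rule sum.cong) (use that in \<open>auto simp: D_def\<close>)
      finally show ?thesis .
    qed
    then show ?thesis using that by simp
  qed
  have first: "Q' *\<^sub>v x = Q *\<^sub>v vec d (($) x)" if "x \<in> carrier_vec d'" "\<And>i. d \<le> i \<Longrightarrow> i < d' \<Longrightarrow> x $ i = 0" for x
  proof (rule eq_vecI)
    fix i assume "i < dim_vec (Q *\<^sub>v vec d (($) x))"
    then have i: "i < n" using Q by simp
    have "(\<Sum>j\<in>{0..<d'}. Q' $$ (i, j) * x $ j) = (\<Sum>j\<in>{0..<d}. Q' $$ (i, j) * x $ j)"
      using Q'(4) that by (intro sum.mono_neutral_right) auto
    also have "\<dots> = (\<Sum>j\<in>{0..<d}. Q $$ (i, j) * x $ j)"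
    proof (rule sum.cong[OF refl])
      fix j assume j: "j \<in> {0..<d}"
      then have "col Q' j $ i = col Q j $ i" using Q'(5) by simp
      then show "Q' $$ (i, j) * x $ j = Q $$ (i, j) * x $ j" using i j Q Q'(1,4) by simp
    qed
    finally show "(Q' *\<^sub>v x) $ i = (Q *\<^sub>v vec d (($) x)) $ i"
      using i Q Q' that by (simp add: scalar_prod_def)
  qed (use Q Q' in auto)
  define C where "C = rng (Q' * D)"
  have QD: "Q' * D \<in> carrier_mat n d'" using Q' D by simp
  have QDx: "(Q' * D) *\<^sub>v x = Q' *\<^sub>v (D *\<^sub>v x)" if "x \<in> carrier_vec d'" for x using Q' D that by simp
  show ?thesis
  proof (rule that[of C])
    show sC: "subsp n C" unfolding C_def by (rule subsp_rng[OF QD])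
    show "C \<subseteq> U"
    proof
      fix v assume "v \<in> C"
      then obtain x where "x \<in> carrier_vec d'" "v = (Q' * D) *\<^sub>v x" unfolding C_def using QD by (rule rngE)
      then show "v \<in> U" using rngI[OF Q'(1), of "D *\<^sub>v x"] Q'(3) D QDx by auto
    qed
    show "S \<inter> C = {0\<^sub>v n}"
    proof (intro equalityI subsetI)
      fix v assume v: "v \<in> S \<inter> C"
      then obtain x where x: "x \<in> carrier_vec d'" "v = (Q' * D) *\<^sub>v x" unfolding C_def using QD rngE by blast
      obtain y where y: "y \<in> carrier_vec d" "v = Q *\<^sub>v y" using v Q rngE by blast
      let ?y = "vec d' (\<lambda>j. if j < d then y $ j else 0)"
      have "vec d (($) ?y) = y" using y Q' by (intro eq_vecI) auto
      then have "Q' *\<^sub>v ?y = Q' *\<^sub>v (D *\<^sub>v x)" using first[of ?y] y x QDx by auto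
      then have e: "?y = D *\<^sub>v x" using inj_mat_eqD[OF Q'(2,1)] D x by auto
      have "y $ i = 0" if "i < d" for i
      proof -
        have "?y $ i = 0" using that Q'(4) x by (subst e, subst Dx) auto
        then show ?thesis using that Q'(4) by simp
      qed
      then have "y = 0\<^sub>v d" using y by (intro eq_vecI) auto
      then show "v \<in> {0\<^sub>v n}" using y Q by simp
    qed (use subsp_closed[OF S] subsp_closed[OF sC] in auto)
    fix u assume "u \<in> U"
    then obtain x where x: "x \<in> carrier_vec d'" "u = Q' *\<^sub>v x" using Q' rngE by blast
    have "u = Q' *\<^sub>v (x - D *\<^sub>v x) + Q' *\<^sub>v (D *\<^sub>v x)"
      using x Q' D by (subst mult_add_distrib_mat_vec[symmetric, of _ n d']) (auto intro!: arg_cong[of _ _ "\<lambda>x. Q' *\<^sub>v x"] eq_vecI)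
    moreover have "Q' *\<^sub>v (x - D *\<^sub>v x) \<in> S"
    proof -
      have "Q' *\<^sub>v (x - D *\<^sub>v x) = Q *\<^sub>v vec d (($) (x - D *\<^sub>v x))"
        by (rule first) (use x D Dx in auto)
      then show ?thesis using rngI[OF Q(1), of "vec d (($) (x - D *\<^sub>v x))"] Q(3) by auto
    qed
    moreover have "Q' *\<^sub>v (D *\<^sub>v x) \<in> C" using rngI[OF QD x(1)] QDx[OF x(1)] by (simp add: C_def)
    ultimately show "\<exists>s\<in>S. \<exists>c\<in>C. u = s + c" by blast
  qed
qed

subsection \<open>Indecomposable matrix pencils\<close>

definition direct_sum :: "nat \<Rightarrow> 'a::field vec set \<Rightarrow> 'a vec set \<Rightarrow> bool" where
  "direct_sum n U W \<longleftrightarrow> subsp n U \<and> subsp n W \<and> U \<inter> W = {0\<^sub>v n} \<and>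
     (\<forall>x\<in>carrier_vec n. \<exists>u\<in>U. \<exists>w\<in>W. x = u + w)"

text \<open>The pair is a representation of the Kronecker quiver with \<open>n\<close>-dimensional
  spaces at both vertices, and the condition says that it has no nontrivial direct summand. Source
  and target are split independently although they are the same coordinate space.\<close>

definition indecomposable_pencil :: "nat \<Rightarrow> 'a::field mat \<Rightarrow> 'a mat \<Rightarrow> bool" where
  "indecomposable_pencil n E F \<longleftrightarrow>
     (\<forall>V V' W W'. direct_sum n V V' \<and> direct_sum n W W' \<and>
        (\<forall>x\<in>V. E *\<^sub>v x \<in> W \<and> F *\<^sub>v x \<in> W) \<and> (\<forall>x\<in>V'. E *\<^sub>v x \<in> W' \<and> F *\<^sub>v x \<in> W') \<longrightarrow>
        V = {0\<^sub>v n} \<and> W = {0\<^sub>v n} \<or> V' = {0\<^sub>v n} \<and> W' = {0\<^sub>v n})"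

lemma subsp_mat_kernel: "A \<in> carrier_mat m n \<Longrightarrow> subsp n (mat_kernel A)"
  unfolding subsp_def mat_kernel_def
  by (auto simp: mult_add_distrib_mat_vec[of _ m n] mult_mat_vec[of _ m n])

lemma direct_sum_retract:
  assumes V: "V \<in> carrier_mat n a" and H: "H \<in> carrier_mat a n" and HV: "H * V = 1\<^sub>m a"
  shows "direct_sum n (rng V) (mat_kernel H)"
proof -
  have HVx: "H *\<^sub>v (V *\<^sub>v x) = x" if "x \<in> carrier_vec a" for x
    using that by (simp add: assoc_mult_mat_vec[OF H V, symmetric] HV)
  have "rng V \<inter> mat_kernel H \<subseteq> {0\<^sub>v n}"
  proof
    fix v assume v: "v \<in> rng V \<inter> mat_kernel H"
    then obtain x where x: "x \<in> carrier_vec a" "v = V *\<^sub>v x" using rngE[OF _ V] by blast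
    then have "x = 0\<^sub>v a" using v HVx[OF x(1)] H by (simp add: mat_kernel_def)
    then show "v \<in> {0\<^sub>v n}" using x V by simp
  qed
  moreover have "\<exists>u\<in>rng V. \<exists>w\<in>mat_kernel H. x = u + w" if x: "x \<in> carrier_vec n" for x
  proof (intro bexI)
    have Hx: "H *\<^sub>v x \<in> carrier_vec a" using H x by simp
    then have VHx: "V *\<^sub>v (H *\<^sub>v x) \<in> carrier_vec n" using V by simp
    show "x = V *\<^sub>v (H *\<^sub>v x) + (x - V *\<^sub>v (H *\<^sub>v x))" by (rule vec_diff_add[OF x VHx])
    show "V *\<^sub>v (H *\<^sub>v x) \<in> rng V" by (rule rngI[OF V Hx])
    have "H *\<^sub>v (x - V *\<^sub>v (H *\<^sub>v x)) = H *\<^sub>v x - H *\<^sub>v x"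
      using mult_minus_distrib_mat_vec[OF H x VHx] HVx[OF Hx] by simp
    also have "\<dots> = 0\<^sub>v a" using Hx by simp
    finally show "x - V *\<^sub>v (H *\<^sub>v x) \<in> mat_kernel H" using x VHx H by (simp add: mat_kernel_def)
  qed
  ultimately show ?thesis
    unfolding direct_sum_def
    using subsp_rng[OF V] subsp_mat_kernel[OF H] subsp_closed(3)[of n] by blast
qed

text \<open>\<open>V\<close> and \<open>W\<close> describe a subrepresentation with dimensions
  \<open>a\<close> and \<open>b\<close>, and the kernels of the retractions \<open>H\<close> and
  \<open>G\<close> form a complement of it. Since \<open>0 < a\<close>, it is the complement that
  vanishes, so \<open>a\<close> and \<open>b\<close> both equal \<open>n\<close>. It is applied to a
  piece with unequal dimensions, where it gives a contradiction.\<close>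

lemma indecomposable_pencil_retract:
  assumes ind: "indecomposable_pencil n E F"
    and V: "V \<in> carrier_mat n a" and H: "H \<in> carrier_mat a n" "H * V = 1\<^sub>m a"
    and W: "W \<in> carrier_mat n b" and G: "G \<in> carrier_mat b n" "G * W = 1\<^sub>m b"
    and sub: "\<And>x. x \<in> carrier_vec a \<Longrightarrow> E *\<^sub>v (V *\<^sub>v x) \<in> rng W \<and> F *\<^sub>v (V *\<^sub>v x) \<in> rng W"
    and ker: "\<And>x. x \<in> mat_kernel H \<Longrightarrow> E *\<^sub>v x \<in> mat_kernel G \<and> F *\<^sub>v x \<in> mat_kernel G"
    and a: "0 < a"
  shows "a = b"
proof -
  have "\<forall>x\<in>rng V. E *\<^sub>v x \<in> rng W \<and> F *\<^sub>v x \<in> rng W"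
    using sub rngE[OF _ V] by metis
  then have "rng V = {0\<^sub>v n} \<and> rng W = {0\<^sub>v n} \<or> mat_kernel H = {0\<^sub>v n} \<and> mat_kernel G = {0\<^sub>v n}"
    using ind direct_sum_retract[OF V H] direct_sum_retract[OF W G] ker
    unfolding indecomposable_pencil_def by blast
  moreover have "rng V \<noteq> {0\<^sub>v n}"
  proof
    assume "rng V = {0\<^sub>v n}"
    then have "V *\<^sub>v unit_vec a 0 = 0\<^sub>v n" using rngI[OF V unit_vec_carrier] by auto
    then have "unit_vec a 0 = (0\<^sub>v a :: 'a vec)"
      using inj_matD[OF left_inverse_imp_inj_mat[OF V H] V unit_vec_carrier] by simp
    then show False using a by simp
  qed
  ultimately have k: "mat_kernel H = {0\<^sub>v n}" "mat_kernel G = {0\<^sub>v n}" by auto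
  have "inj_mat H" "inj_mat G" using k H G by (auto simp: inj_mat_def mat_kernel_def)
  then have "n \<le> a" "n \<le> b" using inj_mat_le H G by blast+
  moreover have "a \<le> n" "b \<le> n"
    using inj_mat_le[OF V left_inverse_imp_inj_mat[OF V H]] inj_mat_le[OF W left_inverse_imp_inj_mat[OF W G]] .
  ultimately show ?thesis by simp
qed

section \<open>Polynomial kernel vectors of a singular pencil\<close>

lemma infinite_UNIV_alg_closed: "infinite (UNIV :: 'a::alg_closed_field set)"
proof
  assume fin: "finite (UNIV :: 'a set)"
  define p :: "'a poly" where "p = (\<Prod>a\<in>UNIV. [:- a, 1:])"
  have "degree p = card (UNIV :: 'a set)" unfolding p_def by (subst degree_prod_sum_eq) auto
  moreover have "card (UNIV :: 'a set) > 0" using fin by (simp add: card_gt_0_iff)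
  \<comment> \<open>\<open>p\<close> vanishes at every element of the field, so \<open>p + 1\<close>
    takes only the value 1 and has no root, although its degree is positive.\<close>
  ultimately have "degree (p + 1) > 0" by (simp add: degree_add_eq_left)
  then obtain x where "poly (p + 1) x = 0" using alg_closed_imp_poly_has_root by blast
  moreover have "poly p x = 0" unfolding p_def using fin by (auto simp: poly_prod)
  ultimately show False by simp
qed

text \<open>The coefficient sequence of a polynomial vector in the kernel of \<open>E + x F\<close>.\<close>

definition kernel_chain :: "nat \<Rightarrow> 'a::field mat \<Rightarrow> 'a mat \<Rightarrow> nat \<Rightarrow> (nat \<Rightarrow> 'a vec) \<Rightarrow> bool" where
  "kernel_chain n E F e v \<longleftrightarrow>
     (\<forall>i. v i \<in> carrier_vec n) \<and> E *\<^sub>v v 0 = 0\<^sub>v n \<and> (\<forall>i<e. E *\<^sub>v v (Suc i) + F *\<^sub>v v i = 0\<^sub>v n) \<and>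
     F *\<^sub>v v e = 0\<^sub>v n \<and> (\<exists>i\<le>e. v i \<noteq> 0\<^sub>v n)"

text \<open>The determinant of \<open>E + x F\<close>, computed over the polynomial ring, has
  infinitely many roots and hence is zero. So there is a nonzero kernel vector with polynomial
  entries, and its coefficients form the chain.\<close>

lemma singular_pencil_kernel_chain:
  fixes E F :: "'a::field mat"
  assumes inf: "infinite (UNIV :: 'a set)"
    and E: "E \<in> carrier_mat n n" and F: "F \<in> carrier_mat n n"
    and sing: "\<And>x. det (E + x \<cdot>\<^sub>m F) = 0"
  shows "\<exists>e v. kernel_chain n E F e v"
proof -
  define A where "A = mat n n (\<lambda>(i, j). [:E $$ (i, j), F $$ (i, j):])"
  have A: "A \<in> carrier_mat n n" by (simp add: A_def)
  have "poly (det A) x = 0" for x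
  proof -
    have "poly (det A) x = det (E + x \<cdot>\<^sub>m F)"
      by (rule poly_det_cong[of _ n]) (use E F in \<open>auto simp: A_def\<close>)
    then show ?thesis using sing by simp
  qed
  then have "{x. poly (det A) x = 0} = UNIV" by auto
  then have "det A = 0" using poly_roots_finite[of "det A"] inf by metis
  \<comment> \<open>The criterion is the one for integral domains, so the kernel vector has
    polynomial entries rather than rational functions.\<close>
  then obtain w where w: "w \<in> carrier_vec n" "w \<noteq> 0\<^sub>v n" "A *\<^sub>v w = 0\<^sub>v n"
    using det_0_iff_vec_prod_zero[OF A] by auto
  \<comment> \<open>The sum of all degrees is a crude common bound; every coefficient with index
    \<open>Suc e\<close> is zero.\<close>
  define e where "e = (\<Sum>k<n. degree (w $ k))"
  define v where "v i = vec n (\<lambda>k. coeff (w $ k) i)" for i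
  have deg: "degree (w $ k) \<le> e" if "k < n" for k
    unfolding e_def using that by (intro member_le_sum) auto
  \<comment> \<open>Coefficient \<open>i\<close> in row \<open>r\<close> of the equation
    \<open>A w = 0\<close>; the factor \<open>x\<close> in front of \<open>F\<close> shifts its
    index by one.\<close>
  have comp: "(\<Sum>k\<in>{0..<n}. E $$ (r, k) * coeff (w $ k) i + F $$ (r, k) * (if i = 0 then 0 else coeff (w $ k) (i - 1))) = 0"
    if r: "r < n" for r i
  proof -
    have "(A *\<^sub>v w) $ r = 0" using w(3) r by simp
    then have "(\<Sum>k\<in>{0..<n}. A $$ (r, k) * w $ k) = 0" using r w(1) A by (simp add: scalar_prod_def)
    then have "coeff (\<Sum>k\<in>{0..<n}. A $$ (r, k) * w $ k) i = 0" by simp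
    then have "(\<Sum>k\<in>{0..<n}. coeff (A $$ (r, k) * w $ k) i) = 0" by (simp add: coeff_sum)
    moreover have "(\<Sum>k\<in>{0..<n}. coeff (A $$ (r, k) * w $ k) i) =
       (\<Sum>k\<in>{0..<n}. E $$ (r, k) * coeff (w $ k) i + F $$ (r, k) * (if i = 0 then 0 else coeff (w $ k) (i - 1)))"
      by (rule sum.cong) (use r in \<open>auto simp: A_def coeff_pCons split: nat.splits\<close>)
    ultimately show ?thesis by simp
  qed
  have vE: "(E *\<^sub>v v i) $ r = (\<Sum>k\<in>{0..<n}. E $$ (r, k) * coeff (w $ k) i)"
    and vF: "(F *\<^sub>v v i) $ r = (\<Sum>k\<in>{0..<n}. F $$ (r, k) * coeff (w $ k) i)" if "r < n" for i r
    using that E F by (simp_all add: v_def scalar_prod_def)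
  have "kernel_chain n E F e v"
    unfolding kernel_chain_def
  proof (intro conjI allI impI)
    show "v i \<in> carrier_vec n" for i by (simp add: v_def)
    show "E *\<^sub>v v 0 = 0\<^sub>v n"
    proof (rule eq_vecI)
      fix r assume "r < dim_vec (0\<^sub>v n :: 'a vec)"
      then show "(E *\<^sub>v v 0) $ r = 0\<^sub>v n $ r" using comp[of r 0] vE[of r 0] by simp
    qed (use E in auto)
    show "E *\<^sub>v v (Suc i) + F *\<^sub>v v i = 0\<^sub>v n" for i
    proof (rule eq_vecI)
      fix r assume "r < dim_vec (0\<^sub>v n :: 'a vec)"
      then show "(E *\<^sub>v v (Suc i) + F *\<^sub>v v i) $ r = 0\<^sub>v n $ r"
        using comp[of r "Suc i"] vE[of r "Suc i"] vF[of r i] E F by (simp add: sum.distrib)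
    qed (use E F in auto)
    show "F *\<^sub>v v e = 0\<^sub>v n"
    proof (rule eq_vecI)
      fix r assume "r < dim_vec (0\<^sub>v n :: 'a vec)"
      then have r: "r < n" by simp
      have "coeff (w $ k) (Suc e) = 0" if "k < n" for k
        using deg[OF that] by (intro coeff_eq_0) simp
      then show "(F *\<^sub>v v e) $ r = 0\<^sub>v n $ r"
        using comp[OF r, of "Suc e"] vF[OF r, of e] r by simp
    qed (use F in auto)
    \<comment> \<open>An entry other than the zero polynomial has a nonzero leading coefficient, so
      one of the vectors of the chain is nonzero.\<close>
    obtain k where k: "k < n" "w $ k \<noteq> 0"
      using w(1,2) by (metis carrier_vecD eq_vecI index_zero_vec)
    then have "v (degree (w $ k)) $ k \<noteq> 0" by (simp add: v_def)
    then have "v (degree (w $ k)) \<noteq> 0\<^sub>v n" using k(1) by auto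
    then show "\<exists>i\<le>e. v i \<noteq> 0\<^sub>v n" using deg[OF k(1)] by blast
  qed
  then show ?thesis by blast
qed

text \<open>A kernel polynomial with zero constant term is divisible by \<open>x\<close>, and the
  quotient is a kernel vector with a smaller degree bound.\<close>

lemma kernel_chain_minimal_head:
  assumes ch: "kernel_chain n E F e v" and E: "E \<in> carrier_mat n n" and F: "F \<in> carrier_mat n n"
    and min: "\<forall>e' v'. kernel_chain n E F e' v' \<longrightarrow> e \<le> e'"
  shows "v 0 \<noteq> 0\<^sub>v n"
proof
  assume v0: "v 0 = 0\<^sub>v n"
  from ch have vc: "v i \<in> carrier_vec n" for i by (simp add: kernel_chain_def)
  from ch have rec: "E *\<^sub>v v (Suc i) + F *\<^sub>v v i = 0\<^sub>v n" if "i < e" for i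
    using that by (simp add: kernel_chain_def)
  from ch obtain i where i: "i \<le> e" "v i \<noteq> 0\<^sub>v n" by (auto simp: kernel_chain_def)
  with v0 obtain i' where i': "i = Suc i'" by (cases i) auto
  with i obtain e' where e': "e = Suc e'" by (cases e) auto
  have "E *\<^sub>v v (Suc 0) = 0\<^sub>v n" using rec[of 0] e' v0 E F vc[of "Suc 0"] by simp
  then have "kernel_chain n E F e' (\<lambda>i. v (Suc i))"
    using ch i i' e' unfolding kernel_chain_def by auto
  then show False using min e' by fastforce
qed

text \<open>Polynomial vectors with \<open>e\<close> coefficients of size \<open>n\<close> are
  flattened into one coordinate space, where separating functionals are available.\<close>

definition block_vec :: "nat \<Rightarrow> nat \<Rightarrow> (nat \<Rightarrow> 'a vec) \<Rightarrow> 'a vec" where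
  "block_vec e n w = vec (e * n) (\<lambda>j. w (j div n) $ (j mod n))"

lemma block_vec_carrier [simp]: "block_vec e n w \<in> carrier_vec (e * n)"
  by (simp add: block_vec_def)

lemma scalar_prod_block_vec:
  fixes y :: "'a::field vec"
  assumes "\<And>i. i < e \<Longrightarrow> w i \<in> carrier_vec n"
  shows "y \<bullet> block_vec e n w = (\<Sum>i<e. vec n (\<lambda>k. y $ (i * n + k)) \<bullet> w i)"
proof -
  have "y \<bullet> block_vec e n w = (\<Sum>j<e * n. y $ j * w (j div n) $ (j mod n))"
    by (simp add: block_vec_def scalar_prod_def atLeast0LessThan)
  also have "\<dots> = (\<Sum>i<e. \<Sum>j=i * n..<i * n + n. y $ j * w (j div n) $ (j mod n))"
    by (rule sum.nat_group[symmetric])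
  also have "\<dots> = (\<Sum>i<e. vec n (\<lambda>k. y $ (i * n + k)) \<bullet> w i)"
  proof (rule sum.cong[OF refl])
    fix i assume "i \<in> {..<e}"
    then have wi: "w i \<in> carrier_vec n" using assms by simp
    have "(\<Sum>j=i * n..<i * n + n. y $ j * w (j div n) $ (j mod n)) =
        (\<Sum>k=0..<n. y $ (k + i * n) * w ((k + i * n) div n) $ ((k + i * n) mod n))"
      using sum.shift_bounds_nat_ivl[of "\<lambda>j. y $ j * w (j div n) $ (j mod n)" 0 "i * n" n]
      by (simp add: add.commute)
    also have "\<dots> = vec n (\<lambda>k. y $ (i * n + k)) \<bullet> w i"
      unfolding scalar_prod_def using wi by (intro sum.cong) (auto simp: add.commute)
    finally show "(\<Sum>j=i * n..<i * n + n. y $ j * w (j div n) $ (j mod n)) =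
      vec n (\<lambda>k. y $ (i * n + k)) \<bullet> w i" .
  qed
  finally show ?thesis .
qed

lemma block_vec_eqD:
  assumes "block_vec e n w = block_vec e n w'" "i < e" "w i \<in> carrier_vec n" "w' i \<in> carrier_vec n"
  shows "w i = w' i"
proof (rule eq_vecI)
  fix k assume "k < dim_vec (w' i)"
  then have k: "k < n" using assms(4) by simp
  have "i * n + k < e * n"
  proof -
    have "i * n + k < Suc i * n" using k by simp
    also have "\<dots> \<le> e * n" using assms(2) by (intro mult_le_mono1) simp
    finally show ?thesis .
  qed
  then show "w i $ k = w' i $ k"
    using arg_cong[OF assms(1), of "\<lambda>v. v $ (i * n + k)"] k by (simp add: block_vec_def)
qed (use assms in simp)

lemma block_vec_add:
  assumes "\<And>i. i < e \<Longrightarrow> w i \<in> carrier_vec n" "\<And>i. i < e \<Longrightarrow> w' i \<in> carrier_vec n"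
  shows "block_vec e n w + block_vec e n w' = block_vec e n (\<lambda>i. w i + w' i)"
proof (rule eq_vecI)
  fix j assume "j < dim_vec (block_vec e n (\<lambda>i. w i + w' i))"
  then have j: "j < e * n" by (simp add: block_vec_def)
  then have "n > 0" by (cases n) auto
  then have "j div n < e" "j mod n < n" using j by (auto simp: less_mult_imp_div_less)
  then show "(block_vec e n w + block_vec e n w') $ j = block_vec e n (\<lambda>i. w i + w' i) $ j"
    using j assms[of "j div n"] by (simp add: block_vec_def)
qed (simp_all add: block_vec_def)

lemma block_vec_smult:
  assumes "\<And>i. i < e \<Longrightarrow> w i \<in> carrier_vec n"
  shows "c \<cdot>\<^sub>v block_vec e n w = block_vec e n (\<lambda>i. c \<cdot>\<^sub>v w i)"
proof (rule eq_vecI)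
  fix j assume "j < dim_vec (block_vec e n (\<lambda>i. c \<cdot>\<^sub>v w i))"
  then have j: "j < e * n" by (simp add: block_vec_def)
  then have "n > 0" by (cases n) auto
  then have "j div n < e" "j mod n < n" using j by (auto simp: less_mult_imp_div_less)
  then show "(c \<cdot>\<^sub>v block_vec e n w) $ j = block_vec e n (\<lambda>i. c \<cdot>\<^sub>v w i) $ j"
    using j assms[of "j div n"] by (simp add: block_vec_def)
qed (simp_all add: block_vec_def)

lemma block_vec_zero: "block_vec e n (\<lambda>i. 0\<^sub>v n) = 0\<^sub>v (e * n)"
proof (rule eq_vecI)
  fix j assume "j < dim_vec (0\<^sub>v (e * n))"
  then have j: "j < e * n" by simp
  then have "n > 0" by (cases n) auto
  then show "block_vec e n (\<lambda>i. 0\<^sub>v n) $ j = 0\<^sub>v (e * n) $ j" using j by (simp add: block_vec_def)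
qed (simp add: block_vec_def)

text \<open>Minimality of the chain says exactly that \<open>E v\<^sub>1\<close>, placed in degree \<open>0\<close>, is not of the form
  \<open>(E + x F) p\<close> with a polynomial vector \<open>p\<close> of degree at most \<open>e - 2\<close>: otherwise \<open>v\<^sub>0 + x p\<close> is
  a shorter kernel vector. A functional separating it from these products is the required \<open>g\<close>.\<close>

lemma minimal_chain_functionals:
  fixes E F :: "'a::field mat"
  assumes ch: "kernel_chain n E F e v" and E: "E \<in> carrier_mat n n" and F: "F \<in> carrier_mat n n"
    and min: "\<forall>e' v'. kernel_chain n E F e' v' \<longrightarrow> e \<le> e'" and e: "0 < e"
  obtains g where "\<And>i. g i \<in> carrier_vec n"
    "\<And>i x. Suc i < e \<Longrightarrow> x \<in> carrier_vec n \<Longrightarrow> g i \<bullet> (E *\<^sub>v x) + g (Suc i) \<bullet> (F *\<^sub>v x) = 0"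
    "g 0 \<bullet> (E *\<^sub>v v 1) = 1"
proof -
  from ch have vc: "v i \<in> carrier_vec n" for i by (simp add: kernel_chain_def)
  have Ex [simp]: "E *\<^sub>v x \<in> carrier_vec n" and Fx [simp]: "F *\<^sub>v x \<in> carrier_vec n" if "x \<in> carrier_vec n" for x
    using that E F by auto
  \<comment> \<open>Coefficient sequences of degree at most \<open>e - 2\<close>: the entries vanish
    from index \<open>e - 1\<close> on.\<close>
  define X where "X = {x. (\<forall>i. x i \<in> carrier_vec n) \<and> (\<forall>i\<ge>e - 1. x i = (0\<^sub>v n :: 'a vec))}"
  \<comment> \<open>\<Phi> multiplies a polynomial vector by \<open>E + x F\<close>. On
    \<open>X\<close> the product has degree at most \<open>e - 1\<close>, so \<open>e\<close> blocks
    record it completely.\<close>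
  define \<Phi> where "\<Phi> x = (\<lambda>i. E *\<^sub>v x i + (if i = 0 then 0\<^sub>v n else F *\<^sub>v x (i - 1)))" for x :: "nat \<Rightarrow> 'a vec"
  have \<Phi>c: "\<Phi> x i \<in> carrier_vec n" if "x \<in> X" for x i using that by (auto simp: \<Phi>_def X_def)
  define U where "U = (\<lambda>x. block_vec e n (\<Phi> x)) ` X"
  have U: "subsp (e * n) U"
    unfolding subsp_def
  proof (intro conjI ballI allI)
    show "U \<subseteq> carrier_vec (e * n)" by (auto simp: U_def)
    have "(\<lambda>i. 0\<^sub>v n) \<in> X" by (simp add: X_def)
    moreover have "\<Phi> (\<lambda>i. 0\<^sub>v n) = (\<lambda>i. 0\<^sub>v n)" using E F by (auto simp: \<Phi>_def)
    ultimately show "0\<^sub>v (e * n) \<in> U" unfolding U_def using block_vec_zero by (metis image_eqI)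
    fix u assume "u \<in> U"
    then obtain x where x: "x \<in> X" "u = block_vec e n (\<Phi> x)" by (auto simp: U_def)
    then have xc: "x i \<in> carrier_vec n" for i by (simp add: X_def)
    {
      fix c
      have "(\<lambda>i. c \<cdot>\<^sub>v x i) \<in> X" using x by (auto simp: X_def)
      moreover have "c \<cdot>\<^sub>v \<Phi> x i = \<Phi> (\<lambda>i. c \<cdot>\<^sub>v x i) i" for i
        using E F xc unfolding \<Phi>_def
        by (cases i) (simp_all add: smult_add_distrib_vec[of _ n] mult_mat_vec[of _ n n])
      ultimately show "c \<cdot>\<^sub>v u \<in> U"
        unfolding U_def x(2) using block_vec_smult[of e "\<Phi> x" n c] \<Phi>c[OF x(1)] by auto
    }
    fix w assume "w \<in> U"
    then obtain y where y: "y \<in> X" "w = block_vec e n (\<Phi> y)" by (auto simp: U_def)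
    then have yc: "y i \<in> carrier_vec n" for i by (simp add: X_def)
    have "(\<lambda>i. x i + y i) \<in> X" using x y by (auto simp: X_def)
    moreover have "\<Phi> x i + \<Phi> y i = \<Phi> (\<lambda>i. x i + y i) i" for i
    proof (cases i)
      case 0
      then show ?thesis using E F xc yc unfolding \<Phi>_def by (simp add: mult_add_distrib_mat_vec[of _ n n])
    next
      case (Suc j)
      have sw: "(a + b) + (c + d) = (a + c) + (b + d)"
        if "a \<in> carrier_vec n" "b \<in> carrier_vec n" "c \<in> carrier_vec n" "d \<in> carrier_vec n" for a b c d :: "'a vec"
        using that by (intro eq_vecI) auto
      have \<Phi>i: "\<Phi> z i = E *\<^sub>v z i + F *\<^sub>v z j" for z by (simp add: \<Phi>_def Suc)
      show ?thesis
        unfolding \<Phi>i mult_add_distrib_mat_vec[OF E xc yc] mult_add_distrib_mat_vec[OF F xc yc]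
        by (intro sw Ex Fx xc yc)
    qed
    ultimately show "u + w \<in> U"
      unfolding U_def x(2) y(2) using block_vec_add[of e "\<Phi> x" n "\<Phi> y"] \<Phi>c[OF x(1)] \<Phi>c[OF y(1)] by auto
  qed
  define u where "u = block_vec e n (\<lambda>i. if i = 0 then E *\<^sub>v v 1 else 0\<^sub>v n)"
  have "u \<notin> U"
  proof
    assume "u \<in> U"
    then obtain x where x: "x \<in> X" "u = block_vec e n (\<Phi> x)" by (auto simp: U_def)
    then have xc: "x i \<in> carrier_vec n" for i by (simp add: X_def)
    have eq: "(if i = 0 then E *\<^sub>v v 1 else 0\<^sub>v n) = \<Phi> x i" if "i < e" for i
      using x(2) unfolding u_def by (rule block_vec_eqD) (use that vc \<Phi>c[OF x(1)] in auto)
    \<comment> \<open>The coefficients of the constant \<open>v 0\<close> plus the variable times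
      the polynomial with coefficient sequence \<open>x\<close>.\<close>
    define v' where "v' i = (case i of 0 \<Rightarrow> v 0 | Suc j \<Rightarrow> x j)" for i
    have v'c: "v' i \<in> carrier_vec n" for i by (cases i) (auto simp: v'_def vc xc)
    have rec: "E *\<^sub>v v' (Suc i) + F *\<^sub>v v' i = 0\<^sub>v n" if i: "i < e" for i
    proof (cases i)
      case 0
      have "E *\<^sub>v x 0 = E *\<^sub>v v 1" using eq[of 0] e xc[of 0] by (simp add: \<Phi>_def)
      moreover have "E *\<^sub>v v 1 + F *\<^sub>v v 0 = 0\<^sub>v n" using ch e by (simp add: kernel_chain_def)
      ultimately show ?thesis by (simp add: v'_def 0)
    next
      case (Suc j)
      then show ?thesis using eq[OF i] by (simp add: v'_def \<Phi>_def)
    qed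
    \<comment> \<open>Entry \<open>e - 1\<close> of \<open>x\<close> is coefficient \<open>e\<close>
      of \<open>v'\<close>; as it vanishes, \<open>v'\<close> is a chain that already ends at
      \<open>e - 1\<close>.\<close>
    have "x (e - 1) = 0\<^sub>v n" using x(1) by (simp add: X_def)
    then have "v' e = 0\<^sub>v n" using e by (cases e) (simp_all add: v'_def)
    then have "F *\<^sub>v v' (e - 1) = 0\<^sub>v n" using rec[of "e - 1"] e E v'c[of "e - 1"] by simp
    moreover have "v' 0 \<noteq> 0\<^sub>v n"
      using kernel_chain_minimal_head[OF ch E F min] by (simp add: v'_def)
    moreover have "E *\<^sub>v v' 0 = 0\<^sub>v n" using ch by (simp add: v'_def kernel_chain_def)
    ultimately have "kernel_chain n E F (e - 1) v'"
      unfolding kernel_chain_def using v'c rec by auto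
    then show False using min e by fastforce
  qed
  moreover have "u \<in> carrier_vec (e * n)" by (simp add: u_def)
  ultimately obtain y where y: "y \<in> carrier_vec (e * n)" "\<And>x. x \<in> U \<Longrightarrow> y \<bullet> x = 0" "y \<bullet> u = 1"
    using separating_functional[OF U] by blast
  define g where "g i = vec n (\<lambda>k. y $ (i * n + k))" for i
  have gc: "g i \<in> carrier_vec n" for i by (simp add: g_def)
  show ?thesis
  proof (rule that[of g])
    show "g i \<in> carrier_vec n" for i by (rule gc)
    have "y \<bullet> u = (\<Sum>i<e. g i \<bullet> (if i = 0 then E *\<^sub>v v 1 else 0\<^sub>v n))"
      unfolding u_def g_def by (rule scalar_prod_block_vec) (simp add: vc)
    also have "\<dots> = (\<Sum>i\<in>{0}. g i \<bullet> (if i = 0 then E *\<^sub>v v 1 else 0\<^sub>v n))"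
      using e gc by (intro sum.mono_neutral_right) auto
    finally show "g 0 \<bullet> (E *\<^sub>v v 1) = 1" using y(3) by simp
    fix i and x :: "'a vec" assume i: "Suc i < e" and x: "x \<in> carrier_vec n"
    \<comment> \<open>Testing the functional on \<Phi> of a monomial with coefficient
      \<open>x\<close> in degree \<open>i\<close> isolates the blocks \<open>i\<close> and
      \<open>Suc i\<close>.\<close>
    define z where "z j = (if j = i then x else 0\<^sub>v n)" for j
    have z: "z \<in> X" using i x by (auto simp: z_def X_def)
    have "0 = y \<bullet> block_vec e n (\<Phi> z)" using y(2) z by (simp add: U_def)
    also have "\<dots> = (\<Sum>j<e. g j \<bullet> \<Phi> z j)"
      unfolding g_def by (rule scalar_prod_block_vec) (use \<Phi>c[OF z] in simp)
    also have "\<dots> = (\<Sum>j\<in>{i, Suc i}. g j \<bullet> \<Phi> z j)"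
    proof (rule sum.mono_neutral_right)
      show "\<forall>j\<in>{..<e} - {i, Suc i}. g j \<bullet> \<Phi> z j = 0"
      proof
        fix j assume "j \<in> {..<e} - {i, Suc i}"
        then have "\<Phi> z j = 0\<^sub>v n" using E F by (auto simp: \<Phi>_def z_def)
        then show "g j \<bullet> \<Phi> z j = 0" using gc by simp
      qed
    qed (use i in auto)
    also have "\<dots> = g i \<bullet> \<Phi> z i + g (Suc i) \<bullet> \<Phi> z (Suc i)" by simp
    also have "\<Phi> z i = E *\<^sub>v x" using E F x by (cases i) (auto simp: \<Phi>_def z_def)
    also have "\<Phi> z (Suc i) = F *\<^sub>v x" using E F x by (simp add: \<Phi>_def z_def)
    finally show "g i \<bullet> (E *\<^sub>v x) + g (Suc i) \<bullet> (F *\<^sub>v x) = 0" by simp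
  qed
qed

text \<open>A chain of least degree \<open>d\<close> gives a subrepresentation spanned by the
  \<open>d + 1\<close> vectors \<open>v j\<close> in the source and the \<open>d\<close> vectors
  \<open>E (v (Suc j))\<close> in the target. The functionals \<open>g\<close> supply retractions
  whose kernels are respected by both maps, so \<open>indecomposable_pencil_retract\<close> would
  force \<open>Suc d = d\<close>.\<close>

lemma indecomposable_pencil_no_chain:
  fixes E F :: "'a::field mat"
  assumes ind: "indecomposable_pencil n E F" and E: "E \<in> carrier_mat n n" and F: "F \<in> carrier_mat n n"
  shows "\<not> kernel_chain n E F e v"
proof
  assume "kernel_chain n E F e v"
  define P where "P e \<longleftrightarrow> (\<exists>v. kernel_chain n E F e v)" for e
  have "P e" using \<open>kernel_chain n E F e v\<close> by (auto simp: P_def)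
  define d where "d = (LEAST e. P e)"
  have "P d" unfolding d_def by (rule LeastI[of P, OF \<open>P e\<close>])
  then obtain v where ch: "kernel_chain n E F d v" by (auto simp: P_def)
  have min: "\<forall>e' v'. kernel_chain n E F e' v' \<longrightarrow> d \<le> e'"
    unfolding d_def by (auto simp: P_def intro!: Least_le)
  from ch have vc: "v i \<in> carrier_vec n" for i by (simp add: kernel_chain_def)
  from ch have Ev0: "E *\<^sub>v v 0 = 0\<^sub>v n" and Fvd: "F *\<^sub>v v d = 0\<^sub>v n"
    and rec: "\<And>i. i < d \<Longrightarrow> E *\<^sub>v v (Suc i) + F *\<^sub>v v i = 0\<^sub>v n"
    by (auto simp: kernel_chain_def)
  have v0: "v 0 \<noteq> 0\<^sub>v n" by (rule kernel_chain_minimal_head[OF ch E F min])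
  have Ec: "E *\<^sub>v v i \<in> carrier_vec n" and Fc: "F *\<^sub>v v i \<in> carrier_vec n" for i using E F vc by auto
  have Fv: "F *\<^sub>v v i = - (E *\<^sub>v v (Suc i))" if "i < d" for i
  proof (rule eq_vecI)
    fix k assume "k < dim_vec (- (E *\<^sub>v v (Suc i)))"
    then have k: "k < n" using E by simp
    have "(E *\<^sub>v v (Suc i)) $ k + (F *\<^sub>v v i) $ k = 0"
      using arg_cong[OF rec[OF that], of "\<lambda>w. w $ k"] k E F by (simp del: index_mult_mat_vec)
    then show "(F *\<^sub>v v i) $ k = (- (E *\<^sub>v v (Suc i))) $ k"
      using k E by (simp del: index_mult_mat_vec add: eq_neg_iff_add_eq_0 add.commute)
  qed (use E F in simp)
  define V where "V = mat n (Suc d) (\<lambda>(k, j). v j $ k)"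
  define W where "W = mat n d (\<lambda>(k, j). (E *\<^sub>v v (Suc j)) $ k)"
  have V: "V \<in> carrier_mat n (Suc d)" and W: "W \<in> carrier_mat n d" by (simp_all add: V_def W_def)
  have colV: "col V j = v j" if "j < Suc d" for j
    using that vc[of j] by (intro eq_vecI) (auto simp: V_def)
  have colW: "col W j = E *\<^sub>v v (Suc j)" if "j < d" for j
    using that E by (intro eq_vecI) (auto simp: W_def simp del: index_mult_mat_vec)
  \<comment> \<open>In these bases \<open>E\<close> lowers the index by one and \<open>F\<close> is
    minus a truncation, because \<open>F (v j)\<close> equals
    \<open>- E (v (Suc j))\<close>.\<close>
  define LE :: "'a mat" where "LE = mat d (Suc d) (\<lambda>(i, j). if j = Suc i then 1 else 0)"
  define LF :: "'a mat" where "LF = mat d (Suc d) (\<lambda>(i, j). if j = i then - 1 else 0)"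
  have LE: "LE \<in> carrier_mat d (Suc d)" and LF: "LF \<in> carrier_mat d (Suc d)" by (simp_all add: LE_def LF_def)
  have EV: "E * V = W * LE"
  proof (rule mat_col_eqI)
    fix j assume "j < dim_col (W * LE)"
    then have j: "j < Suc d" using LE by simp
    have 1: "col (E * V) j = E *\<^sub>v v j" using col_mult2[OF E V j] colV[OF j] by simp
    have 2: "col (W * LE) j = W *\<^sub>v col LE j" by (rule col_mult2[OF W LE j])
    show "col (E * V) j = col (W * LE) j"
    proof (cases j)
      case 0
      have "col LE j = 0\<^sub>v d" using j 0 by (intro eq_vecI) (auto simp: LE_def)
      then show ?thesis using 1 2 0 Ev0 W by simp
    next
      case (Suc i)
      have "col LE j = unit_vec d i" using j Suc by (intro eq_vecI) (auto simp: LE_def)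
      then show ?thesis using 1 2 mult_mat_unit_vec[OF W, of i] colW[of i] j Suc by simp
    qed
  qed (use E V W LE in auto)
  have FV: "F * V = W * LF"
  proof (rule mat_col_eqI)
    fix j assume "j < dim_col (W * LF)"
    then have j: "j < Suc d" using LF by simp
    have 1: "col (F * V) j = F *\<^sub>v v j" using col_mult2[OF F V j] colV[OF j] by simp
    have 2: "col (W * LF) j = W *\<^sub>v col LF j" by (rule col_mult2[OF W LF j])
    show "col (F * V) j = col (W * LF) j"
    proof (cases "j = d")
      case True
      have "col LF j = 0\<^sub>v d" using True by (intro eq_vecI) (auto simp: LF_def)
      then show ?thesis using 1 2 True Fvd W by simp
    next
      case False
      then have jd: "j < d" using j by simp
      have "col LF j = (- 1) \<cdot>\<^sub>v unit_vec d j" using jd by (intro eq_vecI) (auto simp: LF_def)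
      then have "W *\<^sub>v col LF j = (- 1) \<cdot>\<^sub>v col W j"
        using mult_mat_vec[OF W, of "unit_vec d j" "- 1"] mult_mat_unit_vec[OF W jd] by simp
      also have "\<dots> = - (E *\<^sub>v v (Suc j))" using colW[OF jd] Ec[of "Suc j"] by (intro eq_vecI) auto
      finally show ?thesis using 1 2 Fv[OF jd] by simp
    qed
  qed (use F V W LF in auto)
  have sub: "E *\<^sub>v (V *\<^sub>v x) \<in> rng W \<and> F *\<^sub>v (V *\<^sub>v x) \<in> rng W" if x: "x \<in> carrier_vec (Suc d)" for x
  proof -
    have "E *\<^sub>v (V *\<^sub>v x) = W *\<^sub>v (LE *\<^sub>v x)"
      using assoc_mult_mat_vec[OF E V x] assoc_mult_mat_vec[OF W LE x] EV by simp
    moreover have "F *\<^sub>v (V *\<^sub>v x) = W *\<^sub>v (LF *\<^sub>v x)"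
      using assoc_mult_mat_vec[OF F V x] assoc_mult_mat_vec[OF W LF x] FV by simp
    moreover have "W *\<^sub>v (LE *\<^sub>v x) \<in> rng W" "W *\<^sub>v (LF *\<^sub>v x) \<in> rng W"
      using LE LF x by (auto intro!: rngI[OF W])
    ultimately show ?thesis by simp
  qed
  show False
  \<comment> \<open>For \<open>d = 0\<close> the vector \<open>v 0\<close> is killed by both maps
    and \<open>W\<close> has no columns; the functionals are available only for
    \<open>0 < d\<close>.\<close>
  proof (cases "d = 0")
    case True
    have "inj_mat V"
    proof (rule inj_matI[OF V])
      fix x assume x: "x \<in> carrier_vec (Suc d)" "V *\<^sub>v x = 0\<^sub>v n"
      obtain k where k: "k < n" "v 0 $ k \<noteq> 0"
        using v0 vc[of 0] by (metis carrier_vecD eq_vecI index_zero_vec)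
      have "(V *\<^sub>v x) $ k = 0" using x k by simp
      then have "v 0 $ k * x $ 0 = 0" using k x(1) True by (simp add: V_def scalar_prod_def)
      then show "x = 0\<^sub>v (Suc d)" using k x(1) True by (intro eq_vecI) auto
    qed
    then obtain H where H: "H \<in> carrier_mat (Suc d) n" "H * V = 1\<^sub>m (Suc d)" using left_inverse_exists[OF V] by blast
    define G :: "'a mat" where "G = mat d n (\<lambda>_. 0)"
    have G: "G \<in> carrier_mat d n" "G * W = 1\<^sub>m d"
      using True W by (auto simp: G_def intro!: eq_matI)
    have "Suc d = d"
    proof (rule indecomposable_pencil_retract[OF ind V H W G sub])
      show "E *\<^sub>v x \<in> mat_kernel G \<and> F *\<^sub>v x \<in> mat_kernel G" if "x \<in> mat_kernel H" for x
        using that H(1) E F True unfolding mat_kernel_def by (auto simp: G_def)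
    qed auto
    then show False by simp
  next
    case False
    then have d: "0 < d" by simp
    obtain g where gc: "\<And>i. g i \<in> carrier_vec n"
      and g: "\<And>i x. Suc i < d \<Longrightarrow> x \<in> carrier_vec n \<Longrightarrow> g i \<bullet> (E *\<^sub>v x) + g (Suc i) \<bullet> (F *\<^sub>v x) = 0"
      and g0: "g 0 \<bullet> (E *\<^sub>v v 1) = 1"
      using minimal_chain_functionals[OF ch E F min d] by blast
    \<comment> \<open>The pairing of the functionals with the basis of the target. The relations for
      \<open>g\<close> make it constant along diagonals, with zeros below the top of the first
      column and above the bottom of the last one. As \<open>g0\<close> puts 1 in the corner, it is
      the identity matrix.\<close>
    define c where "c i j = g i \<bullet> (E *\<^sub>v v (Suc j))" for i j
    have gF: "g i \<bullet> (F *\<^sub>v v j) = - c i j" if "j < d" for i j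
      using Fv[OF that] gc[of i] E by (simp add: c_def)
    have step: "c (Suc i) (Suc j) = c i j" if "Suc i < d" "Suc j < d" for i j
      using g[OF that(1) vc[of "Suc j"]] gF[OF that(2), of "Suc i"] by (simp add: c_def)
    have last: "c i (d - 1) = 0" if "Suc i < d" for i
      using g[OF that vc[of d]] Fvd gc[of "Suc i"] d by (simp add: c_def)
    have first: "c (Suc i) 0 = 0" if "Suc i < d" for i
      using g[OF that vc[of 0]] gF[OF d, of "Suc i"] Ev0 gc[of i] by simp
    have low: "c i j = (if i = j then 1 else 0)" if "j \<le> i" "i < d" for i j
      using that
    proof (induction j arbitrary: i)
      case 0
      then show ?case using g0 first[of "i - 1"] by (cases i) (auto simp: c_def)
    next
      case (Suc j)
      then show ?case using step[of "i - 1" j] by (cases i) auto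
    qed
    \<comment> \<open>The zeros of the last column are carried up and to the left along the
      diagonals; \<open>m\<close> counts the columns from the right.\<close>
    have up: "c i (d - 1 - m) = 0" if "i < d - 1 - m" for i m
      using that
    proof (induction m arbitrary: i)
      case 0
      then show ?case using last[of i] by simp
    next
      case (Suc m)
      then have "c (Suc i) (Suc (d - 1 - Suc m)) = c i (d - 1 - Suc m)" by (intro step) auto
      moreover have "Suc (d - 1 - Suc m) = d - 1 - m" using Suc.prems by simp
      moreover have "c (Suc i) (d - 1 - m) = 0" using Suc by simp
      ultimately show ?case by simp
    qed
    have c: "c i j = (if i = j then 1 else 0)" if "i < d" "j < d" for i j
      using low[of j i] up[of i "d - 1 - j"] that by (cases "j \<le> i") auto
    define G where "G = mat d n (\<lambda>(i, k). g i $ k)"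
    have G: "G \<in> carrier_mat d n" by (simp add: G_def)
    have Gx: "(G *\<^sub>v x) $ i = g i \<bullet> x" if "i < d" for x i
    proof -
      have "row G i = g i" using that gc[of i] by (intro eq_vecI) (auto simp: G_def)
      then show ?thesis using that G by simp
    qed
    \<comment> \<open>The rows are \<open>g i\<close> after \<open>E\<close>, preceded by minus
      \<open>g 0\<close> after \<open>F\<close>. The sign undoes the one in
      \<open>F (v j) = - E (v (Suc j))\<close>, so that row 0 is dual to \<open>v 0\<close>.\<close>
    define H where "H = mat (Suc d) n (\<lambda>(i, k). if i = 0 then - (G * F) $$ (0, k) else (G * E) $$ (i - 1, k))"
    have H: "H \<in> carrier_mat (Suc d) n" by (simp add: H_def)
    have HS: "(H *\<^sub>v x) $ Suc i = g i \<bullet> (E *\<^sub>v x)" if "i < d" "x \<in> carrier_vec n" for i x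
    proof -
      have "row H (Suc i) = row (G * E) i"
        using that G E by (intro eq_vecI) (auto simp: H_def)
      then have "(H *\<^sub>v x) $ Suc i = ((G * E) *\<^sub>v x) $ i" using that H G E by (simp del: row_mult assoc_mult_mat_vec)
      then show ?thesis using Gx[OF that(1)] assoc_mult_mat_vec[OF G E that(2)] by simp
    qed
    have H0: "(H *\<^sub>v x) $ 0 = - (g 0 \<bullet> (F *\<^sub>v x))" if "x \<in> carrier_vec n" for x
    proof -
      have "row H 0 = - row (G * F) 0"
        using G F d by (intro eq_vecI) (auto simp: H_def)
      then have "(H *\<^sub>v x) $ 0 = - (((G * F) *\<^sub>v x) $ 0)" using that H G F d by (simp del: row_mult assoc_mult_mat_vec)
      then show ?thesis using Gx[OF d] assoc_mult_mat_vec[OF G F that] by simp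
    qed
    have HV: "H * V = 1\<^sub>m (Suc d)"
    proof (rule mat_col_eqI)
      fix j assume "j < dim_col (1\<^sub>m (Suc d) :: 'a mat)"
      then have j: "j < Suc d" by simp
      have "col (H * V) j = H *\<^sub>v v j" using col_mult2[OF H V j] colV[OF j] by simp
      also have "\<dots> = unit_vec (Suc d) j"
      proof (rule eq_vecI)
        fix i assume "i < dim_vec (unit_vec (Suc d) j :: 'a vec)"
        then have i: "i < Suc d" by simp
        show "(H *\<^sub>v v j) $ i = unit_vec (Suc d) j $ i"
        proof (cases i)
          case 0
          show ?thesis
          proof (cases "j = d")
            case True
            then show ?thesis using H0[OF vc] Fvd gc[of 0] 0 d j by simp
          next
            case False
            then have "j < d" using j by simp
            then show ?thesis using H0[OF vc, of j] gF[of j 0] c[of 0 j] 0 j d by simp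
          qed
        next
          case (Suc i')
          then have i': "i' < d" using i by simp
          show ?thesis
          proof (cases j)
            case 0
            then show ?thesis using HS[OF i' vc, of j] Ev0 gc[of i'] Suc i by simp
          next
            case (Suc j')
            then show ?thesis using HS[OF i' vc, of j] c[of i' j'] \<open>i = Suc i'\<close> i' j by (simp add: c_def)
          qed
        qed
      qed (use H in simp)
      also have "\<dots> = col (1\<^sub>m (Suc d)) j" using j by simp
      finally show "col (H * V) j = col (1\<^sub>m (Suc d)) j" .
    qed (use H V in auto)
    have GW: "G * W = 1\<^sub>m d"
    proof (rule eq_matI)
      fix i j assume "i < dim_row (1\<^sub>m d :: 'a mat)" "j < dim_col (1\<^sub>m d :: 'a mat)"
      then have ij: "i < d" "j < d" by auto
      have "(G * W) $$ (i, j) = (G *\<^sub>v col W j) $ i" using G W ij by simp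
      also have "\<dots> = c i j" using Gx[OF ij(1)] colW[OF ij(2)] by (simp add: c_def)
      finally show "(G * W) $$ (i, j) = 1\<^sub>m d $$ (i, j)" using c[OF ij] ij by simp
    qed (use G W in auto)
    have "Suc d = d"
    proof (rule indecomposable_pencil_retract[OF ind V H HV W G GW sub])
      fix x assume "x \<in> mat_kernel H"
      then have x: "x \<in> carrier_vec n" "H *\<^sub>v x = 0\<^sub>v (Suc d)" using H by (auto simp: mat_kernel_def)
      have gE: "g i \<bullet> (E *\<^sub>v x) = 0" if "i < d" for i
        using HS[OF that x(1)] x(2) that by simp
      \<comment> \<open>Only \<open>g 0\<close> after \<open>F\<close> is built into
        \<open>H\<close>; the relation linking \<open>g i'\<close> to \<open>g (Suc i')\<close>
        supplies the remaining ones from the vanishing on \<open>E x\<close>.\<close>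
      have gF': "g i \<bullet> (F *\<^sub>v x) = 0" if "i < d" for i
      proof (cases i)
        case 0
        then show ?thesis using H0[OF x(1)] x(2) by simp
      next
        case (Suc i')
        then show ?thesis using g[of i' x] gE[of i'] that x(1) by simp
      qed
      have "G *\<^sub>v (E *\<^sub>v x) = 0\<^sub>v d" "G *\<^sub>v (F *\<^sub>v x) = 0\<^sub>v d"
        using Gx gE gF' G by (intro eq_vecI; auto simp del: index_mult_mat_vec)+
      then show "E *\<^sub>v x \<in> mat_kernel G \<and> F *\<^sub>v x \<in> mat_kernel G"
        using G E F x(1) by (simp add: mat_kernel_def)
    qed auto
    then show False by simp
  qed
qed

section \<open>Fitting's decomposition and the normal form of a pencil\<close>

lemma pow_mat_add:
  fixes T :: "'a::field mat"
  assumes T: "T \<in> carrier_mat n n"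
  shows "T ^\<^sub>m (i + j) = T ^\<^sub>m i * T ^\<^sub>m j"
proof (induction j)
  case 0
  then show ?case using T by simp
next
  case (Suc j)
  then show ?case using T assoc_mult_mat[of "T ^\<^sub>m i" n n "T ^\<^sub>m j" n T n] by simp
qed

lemma pow_mat_commute:
  fixes T :: "'a::field mat"
  assumes T: "T \<in> carrier_mat n n"
  shows "T ^\<^sub>m i * T = T * T ^\<^sub>m i"
  using pow_mat_add[OF T, of 1 i] T by (simp add: add.commute)

lemma rng_mult_subset:
  assumes "A \<in> carrier_mat n m" "B \<in> carrier_mat m l"
  shows "rng (A * B) \<subseteq> rng A"
  using assms by (auto simp: rng_def)

text \<open>A power of \<open>T\<close> whose range has the least possible dimension.\<close>

lemma stable_power_exists:
  fixes T :: "'a::field mat"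
  assumes T: "T \<in> carrier_mat n n"
  obtains k where "0 < k" "rng (T ^\<^sub>m k) = rng (T ^\<^sub>m k * T ^\<^sub>m k)"
proof -
  have Tk: "T ^\<^sub>m k \<in> carrier_mat n n" for k using T by simp
  define P where "P d \<longleftrightarrow> (\<exists>k Q. 0 < k \<and> Q \<in> carrier_mat n d \<and> inj_mat Q \<and> rng Q = rng (T ^\<^sub>m k))" for d
  obtain d1 Q1 where "Q1 \<in> carrier_mat n d1" "inj_mat Q1" "rng Q1 = rng (T ^\<^sub>m 1)"
    by (rule basis_exists[OF subsp_rng[OF Tk]])
  then have ex: "\<exists>d. P d" unfolding P_def by (metis less_one)
  define d where "d = (LEAST d. P d)"
  have "P d" unfolding d_def using ex by (rule LeastI_ex)
  then obtain k Q where k: "0 < k"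
    and Q: "Q \<in> carrier_mat n d" "inj_mat Q" "rng Q = rng (T ^\<^sub>m k)" by (auto simp: P_def)
  obtain e R where R: "R \<in> carrier_mat n e" "inj_mat R" "rng R = rng (T ^\<^sub>m (k + k))"
    using basis_exists[OF subsp_rng[OF Tk[of "k + k"]]] by metis
  have "P e" using R add_pos_pos[OF k k] unfolding P_def by blast
  then have "d \<le> e" unfolding d_def by (rule Least_le)
  have sub: "rng R \<subseteq> rng Q" using R(3) Q(3) pow_mat_add[OF T] rng_mult_subset[OF Tk Tk] by metis
  then have "R *\<^sub>v x \<in> rng Q" if "x \<in> carrier_vec e" for x using rngI[OF R(1) that] by blast
  \<comment> \<open>\<open>Y\<close> expresses a basis of the range of the doubled power in a basis
    of the range of \<open>T ^\<^sub>m k\<close>. Minimality of \<open>d\<close> makes it square,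
    hence invertible, and the two ranges agree.\<close>
  then obtain Y where Y: "Y \<in> carrier_mat d e" "R = Q * Y" using factor_through[OF R(1) Q(1)] by metis
  have "inj_mat Y"
  proof (rule inj_matI[OF Y(1)])
    fix x assume x: "x \<in> carrier_vec e" "Y *\<^sub>v x = 0\<^sub>v d"
    then have "R *\<^sub>v x = 0\<^sub>v n" using Y Q by simp
    then show "x = 0\<^sub>v e" using inj_matD[OF R(2,1)] x by blast
  qed
  then have "e \<le> d" using inj_mat_le[OF Y(1)] by simp
  with \<open>d \<le> e\<close> have "e = d" by simp
  with Y \<open>inj_mat Y\<close> obtain Z where Z: "Z \<in> carrier_mat d d" "Y * Z = 1\<^sub>m d"
    using inj_mat_square[of Y d] by metis
  have "rng Q \<subseteq> rng R"
  proof
    fix v assume "v \<in> rng Q"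
    then obtain x where x: "x \<in> carrier_vec d" "v = Q *\<^sub>v x" using Q(1) by (rule rngE)
    have Zx: "Z *\<^sub>v x \<in> carrier_vec d" using Z x by simp
    have "Y *\<^sub>v (Z *\<^sub>v x) = x" using assoc_mult_mat_vec[of Y d d Z d x] Y Z x \<open>e = d\<close> by simp
    then have "v = R *\<^sub>v (Z *\<^sub>v x)"
      using assoc_mult_mat_vec[of Q n d Y d "Z *\<^sub>v x"] Q Y Zx x \<open>e = d\<close> by simp
    then show "v \<in> rng R" using rngI[OF R(1)] Zx \<open>e = d\<close> by simp
  qed
  then have "rng (T ^\<^sub>m k) = rng (T ^\<^sub>m k * T ^\<^sub>m k)"
    using sub R(3) Q(3) pow_mat_add[OF T, of k k] by auto
  with k show ?thesis by (rule that)
qed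

text \<open>\<open>P\<close> maps its range onto itself, hence injectively, so the range meets the
  kernel trivially. Moreover \<open>P x\<close> has a preimage inside the range, and the difference
  between \<open>x\<close> and this preimage lies in the kernel.\<close>

lemma direct_sum_stable:
  fixes P :: "'a::field mat"
  assumes P: "P \<in> carrier_mat n n" and st: "rng P = rng (P * P)"
  shows "direct_sum n (mat_kernel P) (rng P)"
proof -
  obtain d Q where Q: "Q \<in> carrier_mat n d" "inj_mat Q" "rng Q = rng P"
    by (rule basis_exists[OF subsp_rng[OF P]])
  have Qx: "Q *\<^sub>v x \<in> carrier_vec n" if "x \<in> carrier_vec d" for x using Q that by simp
  have PQ: "P * Q \<in> carrier_mat n d" using P Q by simp
  have "(P * Q) *\<^sub>v x \<in> rng Q" if "x \<in> carrier_vec d" for x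
    using assoc_mult_mat_vec[OF P Q(1) that] rngI[OF P Qx[OF that]] Q(3) by simp
  \<comment> \<open>\<open>R\<close> is the matrix of \<open>P\<close> restricted to its own
    range.\<close>
  then obtain R where R: "R \<in> carrier_mat d d" "P * Q = Q * R" using factor_through[OF PQ Q(1)] by metis
  have PQx: "P *\<^sub>v (Q *\<^sub>v x) = Q *\<^sub>v (R *\<^sub>v x)" if "x \<in> carrier_vec d" for x
    using assoc_mult_mat_vec[OF P Q(1) that] assoc_mult_mat_vec[OF Q(1) R(1) that] R(2) by simp
  have surj: "\<exists>y\<in>carrier_vec d. z = R *\<^sub>v y" if z: "z \<in> carrier_vec d" for z
  proof -
    have "Q *\<^sub>v z \<in> rng (P * P)" using rngI[OF Q(1) z] Q(3) st by simp
    then obtain x where x: "x \<in> carrier_vec n" "Q *\<^sub>v z = (P * P) *\<^sub>v x" using rngE[of _ "P * P" n n] P by auto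
    have "P *\<^sub>v x \<in> rng Q" using rngI[OF P x(1)] Q(3) by simp
    then obtain y where y: "y \<in> carrier_vec d" "P *\<^sub>v x = Q *\<^sub>v y" using Q(1) by (rule rngE)
    have "Q *\<^sub>v z = Q *\<^sub>v (R *\<^sub>v y)" using x y PQx[OF y(1)] assoc_mult_mat_vec[OF P P x(1)] by simp
    then have "z = R *\<^sub>v y" using inj_mat_eqD[OF Q(2,1) z] R y by simp
    then show ?thesis using y by blast
  qed
  have injR: "inj_mat R"
  proof -
    have "1\<^sub>m d *\<^sub>v x \<in> rng R" if "x \<in> carrier_vec d" for x
      using surj[OF that] rngI[OF R(1)] that by auto
    then obtain S where S: "S \<in> carrier_mat d d" "1\<^sub>m d = R * S"
      using factor_through[OF one_carrier_mat R(1)] by metis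
    then have "S * R = 1\<^sub>m d" using mat_mult_left_right_inverse[OF R(1) S(1)] by simp
    then show ?thesis using left_inverse_imp_inj_mat[OF R(1) S(1)] by simp
  qed
  have "mat_kernel P \<inter> rng P \<subseteq> {0\<^sub>v n}"
  proof
    fix v assume v: "v \<in> mat_kernel P \<inter> rng P"
    then obtain x where x: "x \<in> carrier_vec d" "v = Q *\<^sub>v x" using Q rngE by blast
    have "Q *\<^sub>v (R *\<^sub>v x) = 0\<^sub>v n" using v x PQx[OF x(1)] P by (simp add: mat_kernel_def)
    then have "R *\<^sub>v x = 0\<^sub>v d" using inj_matD[OF Q(2,1)] R x by simp
    then have "x = 0\<^sub>v d" using inj_matD[OF injR R(1)] x by simp
    then show "v \<in> {0\<^sub>v n}" using x Q by simp
  qed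
  moreover have "\<exists>u\<in>mat_kernel P. \<exists>w\<in>rng P. x = u + w" if x: "x \<in> carrier_vec n" for x
  proof -
    have "P *\<^sub>v x \<in> rng Q" using rngI[OF P x] Q(3) by simp
    then obtain z where z: "z \<in> carrier_vec d" "P *\<^sub>v x = Q *\<^sub>v z" using Q(1) by (rule rngE)
    obtain y where y: "y \<in> carrier_vec d" "z = R *\<^sub>v y" using surj[OF z(1)] by blast
    have "P *\<^sub>v (x - Q *\<^sub>v y) = P *\<^sub>v x - P *\<^sub>v x"
      using mult_minus_distrib_mat_vec[OF P x Qx[OF y(1)]] PQx[OF y(1)] z y by simp
    also have "\<dots> = 0\<^sub>v n" using P by (intro eq_vecI) auto
    finally have "x - Q *\<^sub>v y \<in> mat_kernel P" using P x Qx[OF y(1)] by (simp add: mat_kernel_def)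
    moreover have "Q *\<^sub>v y \<in> rng P" using rngI[OF Q(1) y(1)] Q(3) by simp
    moreover have "x = (x - Q *\<^sub>v y) + Q *\<^sub>v y" using x Q(1) by (intro eq_vecI) auto
    ultimately show ?thesis by blast
  qed
  ultimately show ?thesis
    unfolding direct_sum_def
    using subsp_rng[OF P] subsp_mat_kernel[OF P] subsp_closed(3)[of n] by blast
qed

lemma direct_sum_image:
  assumes X: "X \<in> carrier_mat n n" and Y: "Y \<in> carrier_mat n n" and XY: "X * Y = 1\<^sub>m n" "Y * X = 1\<^sub>m n"
    and UW: "direct_sum n U W"
  shows "direct_sum n ((\<lambda>x. X *\<^sub>v x) ` U) ((\<lambda>x. X *\<^sub>v x) ` W)"
proof -
  have U: "subsp n U" and W: "subsp n W" and int: "U \<inter> W = {0\<^sub>v n}"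
    and sum: "\<And>x. x \<in> carrier_vec n \<Longrightarrow> \<exists>u\<in>U. \<exists>w\<in>W. x = u + w"
    using UW by (auto simp: direct_sum_def)
  have YX: "Y *\<^sub>v (X *\<^sub>v x) = x" if "x \<in> carrier_vec n" for x
    using assoc_mult_mat_vec[OF Y X that] XY that by simp
  have XYx: "X *\<^sub>v (Y *\<^sub>v x) = x" if "x \<in> carrier_vec n" for x
    using assoc_mult_mat_vec[OF X Y that] XY that by simp
  have "(*\<^sub>v) X ` U \<inter> (*\<^sub>v) X ` W \<subseteq> {0\<^sub>v n}"
  proof
    fix v assume "v \<in> (*\<^sub>v) X ` U \<inter> (*\<^sub>v) X ` W"
    then obtain x y where xy: "x \<in> U" "y \<in> W" "v = X *\<^sub>v x" "v = X *\<^sub>v y" by auto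
    then have "x = y" using YX subsp_closed(4)[OF U] subsp_closed(4)[OF W] by metis
    then have "x = 0\<^sub>v n" using xy int by auto
    then show "v \<in> {0\<^sub>v n}" using xy X by simp
  qed
  moreover have "\<exists>u\<in>(*\<^sub>v) X ` U. \<exists>w\<in>(*\<^sub>v) X ` W. x = u + w" if x: "x \<in> carrier_vec n" for x
  proof -
    have "Y *\<^sub>v x \<in> carrier_vec n" using Y x by simp
    then obtain u w where uw: "u \<in> U" "w \<in> W" "Y *\<^sub>v x = u + w" using sum by blast
    then have "x = X *\<^sub>v u + X *\<^sub>v w"
      using XYx[OF x] mult_add_distrib_mat_vec[OF X subsp_closed(4)[OF U uw(1)] subsp_closed(4)[OF W uw(2)]] by simp
    then show ?thesis using uw by blast
  qed
  ultimately show ?thesis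
    unfolding direct_sum_def using subsp_image[OF X U] subsp_image[OF X W] subsp_closed(3)[of n] by blast
qed

text \<open>Some member \<open>X = E + \<mu> F\<close> is invertible. Relative to \<open>X\<close>
  the pencil is described by one operator \<open>T\<close>, as \<open>E = X T\<close> and
  \<open>\<mu> F = X (1 - T)\<close>. Fitting's decomposition of \<open>T\<close> splits the pencil,
  and the kernel vector \<open>v\<close> decides that the nilpotent part is everything.\<close>

lemma indecomposable_pencil_normal_form:
  fixes E F :: "'a::field mat"
  assumes inf: "infinite (UNIV :: 'a set)"
    and ind: "indecomposable_pencil n E F"
    and E: "E \<in> carrier_mat n n" and F: "F \<in> carrier_mat n n"
    and v: "v \<in> carrier_vec n" "v \<noteq> 0\<^sub>v n" "E *\<^sub>v v = 0\<^sub>v n"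
  obtains X Y T c p where "X \<in> carrier_mat n n" "Y \<in> carrier_mat n n" "T \<in> carrier_mat n n"
    "X * Y = 1\<^sub>m n" "Y * X = 1\<^sub>m n" "E = X * T" "F = c \<cdot>\<^sub>m (X * (1\<^sub>m n - T))" "c \<noteq> 0" "T ^\<^sub>m p = 0\<^sub>m n n"
proof -
  obtain \<mu> where \<mu>: "det (E + \<mu> \<cdot>\<^sub>m F) \<noteq> 0"
    using singular_pencil_kernel_chain[OF inf E F] indecomposable_pencil_no_chain[OF ind E F] by blast
  define X where "X = E + \<mu> \<cdot>\<^sub>m F"
  have X: "X \<in> carrier_mat n n" using E F by (simp add: X_def)
  have "inj_mat X"
    using \<mu> det_0_iff_vec_prod_zero_field[OF X] by (intro inj_matI[OF X]) (auto simp: X_def)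
  then obtain Y where Y: "Y \<in> carrier_mat n n" "Y * X = 1\<^sub>m n" "X * Y = 1\<^sub>m n"
    using inj_mat_square[OF X] by metis
  define T where "T = Y * E"
  have T: "T \<in> carrier_mat n n" using Y E by (simp add: T_def)
  have XT: "X * T = E" unfolding T_def using assoc_mult_mat[OF X Y(1) E] Y E by simp
  \<comment> \<open>\<open>E\<close> kills \<open>v\<close>, so the invertible member cannot be
    \<open>E\<close> itself.\<close>
  have \<mu>0: "\<mu> \<noteq> 0"
  proof
    assume "\<mu> = 0"
    then have "X = E" using E F by (intro eq_matI) (auto simp: X_def)
    then show False using \<open>inj_mat X\<close> inj_matD[OF _ E v(1,3)] v(2) by simp
  qed
  define c where "c = inverse \<mu>"
  have FX: "F = c \<cdot>\<^sub>m (X * (1\<^sub>m n - T))"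
  proof -
    have "X * (1\<^sub>m n - T) = X - E" using mult_minus_distrib_mat[OF X one_carrier_mat T] X XT by simp
    also have "\<dots> = \<mu> \<cdot>\<^sub>m F" using E F by (intro eq_matI) (auto simp: X_def)
    finally show ?thesis using \<mu>0 F by (intro eq_matI) (auto simp: c_def)
  qed
  obtain k where "0 < k" and k: "rng (T ^\<^sub>m k) = rng (T ^\<^sub>m k * T ^\<^sub>m k)" using stable_power_exists[OF T] .
  define P where "P = T ^\<^sub>m k"
  have P: "P \<in> carrier_mat n n" using T by (simp add: P_def)
  have PT: "P * T = T * P" using pow_mat_commute[OF T] by (simp add: P_def)
  have PTx: "P *\<^sub>v (T *\<^sub>v x) = T *\<^sub>v (P *\<^sub>v x)" if "x \<in> carrier_vec n" for x
    using assoc_mult_mat_vec[OF P T that] assoc_mult_mat_vec[OF T P that] PT by simp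
  have ds: "direct_sum n (mat_kernel P) (rng P)" using direct_sum_stable[OF P] k by (simp add: P_def)
  have Ex: "E *\<^sub>v x = X *\<^sub>v (T *\<^sub>v x)" if "x \<in> carrier_vec n" for x
    using assoc_mult_mat_vec[OF X T that] XT by simp
  have Fx: "F *\<^sub>v x = X *\<^sub>v (c \<cdot>\<^sub>v (x - T *\<^sub>v x))" if x: "x \<in> carrier_vec n" for x
  proof -
    have Tx: "T *\<^sub>v x \<in> carrier_vec n" using T x by simp
    have 1: "(1\<^sub>m n - T) *\<^sub>v x = x - T *\<^sub>v x"
      using minus_mult_distrib_mat_vec[OF one_carrier_mat T x] x by simp
    have "(X * (1\<^sub>m n - T)) *\<^sub>v x = X *\<^sub>v (x - T *\<^sub>v x)"
      using assoc_mult_mat_vec[OF X minus_carrier_mat[OF T] x, of "1\<^sub>m n"] 1 by simp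
    then have "F *\<^sub>v x = c \<cdot>\<^sub>v (X *\<^sub>v (x - T *\<^sub>v x))"
      unfolding FX using smult_mat_mult_vec[OF mult_carrier_mat[OF X minus_carrier_mat[OF T]] x, of c "1\<^sub>m n"] by simp
    also have "\<dots> = X *\<^sub>v (c \<cdot>\<^sub>v (x - T *\<^sub>v x))" using mult_mat_vec[OF X, of "x - T *\<^sub>v x" c] x Tx by simp
    finally show ?thesis .
  qed
  \<comment> \<open>A \<open>T\<close>-stable subspace \<open>S\<close> of the source goes with
    \<open>X S\<close> in the target, since both maps are \<open>X\<close> after a polynomial in
    \<open>T\<close>.\<close>
  have inv: "\<forall>x\<in>S. E *\<^sub>v x \<in> (*\<^sub>v) X ` S \<and> F *\<^sub>v x \<in> (*\<^sub>v) X ` S"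
    if S: "subsp n S" and TS: "\<And>x. x \<in> S \<Longrightarrow> T *\<^sub>v x \<in> S" for S
  proof (intro ballI conjI)
    fix x assume x: "x \<in> S"
    then have xc: "x \<in> carrier_vec n" using subsp_closed(4)[OF S] by simp
    show "E *\<^sub>v x \<in> (*\<^sub>v) X ` S" using Ex[OF xc] TS[OF x] by simp
    have "c \<cdot>\<^sub>v (x - T *\<^sub>v x) \<in> S" using subsp_closed(2,5)[OF S] x TS[OF x] by blast
    then show "F *\<^sub>v x \<in> (*\<^sub>v) X ` S" using Fx[OF xc] by simp
  qed
  have TK: "T *\<^sub>v x \<in> mat_kernel P" if "x \<in> mat_kernel P" for x
    using that PTx[of x] P T by (auto simp: mat_kernel_def)
  have TR: "T *\<^sub>v x \<in> rng P" if x: "x \<in> rng P" for x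
  proof -
    obtain y where y: "y \<in> carrier_vec n" "x = P *\<^sub>v y" using x P by (rule rngE)
    then show ?thesis using PTx[OF y(1)] rngI[OF P, of "T *\<^sub>v y"] T by simp
  qed
  have alt: "mat_kernel P = {0\<^sub>v n} \<or> rng P = {0\<^sub>v n}"
    using ind ds direct_sum_image[OF X Y(1,3,2) ds]
      inv[OF subsp_mat_kernel[OF P] TK] inv[OF subsp_rng[OF P] TR]
    unfolding indecomposable_pencil_def by blast
  have "P = 0\<^sub>m n n"
  proof -
    \<comment> \<open>As \<open>k\<close> is positive, \<open>P\<close> has a factor
      \<open>T\<close> on the right and kills \<open>v\<close>. Its kernel is therefore nonzero, and
      the range is the summand that vanishes.\<close>
    obtain k' where k': "k = Suc k'" using \<open>0 < k\<close> gr0_implies_Suc by blast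
    have "T *\<^sub>v v = 0\<^sub>v n" using assoc_mult_mat_vec[OF Y(1) E v(1)] v(3) Y by (simp add: T_def)
    then have "P *\<^sub>v v = 0\<^sub>v n"
      using assoc_mult_mat_vec[of "T ^\<^sub>m k'" n n T n v] T v(1) k' by (simp add: P_def)
    then have "v \<in> mat_kernel P" using v P by (simp add: mat_kernel_def)
    then have R0: "rng P = {0\<^sub>v n}" using alt v(2) by blast
    show ?thesis
      by (rule mat_eq_by_vec[OF P zero_carrier_mat]) (use rngI[OF P] R0 in auto)
  qed
  then show ?thesis using that[OF X Y(1) T Y(3,2) XT[symmetric] FX, of k] \<mu>0 by (simp add: c_def P_def)
qed

subsection \<open>Kronecker products\<close>

text \<open>The premises are equations between dimensions instead of carrier memberships with
  parameters to be guessed, so that these rules work as conditional rewrite rules on large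
  expressions.\<close>

lemma dim_mult_distrib:
  fixes A B C :: "'a::field mat"
  shows "dim_row B = dim_row C \<Longrightarrow> dim_col B = dim_col C \<Longrightarrow> dim_col A = dim_row B \<Longrightarrow> A * (B + C) = A * B + A * C"
    and "dim_row A = dim_row B \<Longrightarrow> dim_col A = dim_col B \<Longrightarrow> dim_col A = dim_row C \<Longrightarrow> (A + B) * C = A * C + B * C"
proof -
  assume "dim_row B = dim_row C" "dim_col B = dim_col C" "dim_col A = dim_row B"
  then have "C \<in> carrier_mat (dim_row B) (dim_col B)" "A \<in> carrier_mat (dim_row A) (dim_row B)"
    by (intro carrier_matI; simp)+
  then show "A * (B + C) = A * B + A * C" using mult_add_distrib_mat[of A _ _ B _ C] by blast
next
  assume "dim_row A = dim_row B" "dim_col A = dim_col B" "dim_col A = dim_row C"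
  then have "B \<in> carrier_mat (dim_row A) (dim_col A)" "C \<in> carrier_mat (dim_col A) (dim_col C)"
    by (intro carrier_matI; simp)+
  then show "(A + B) * C = A * C + B * C" using add_mult_distrib_mat[of A _ _ B C] by blast
qed

lemma dim_mult_smult:
  fixes A B :: "'a::field mat"
  shows "dim_col A = dim_row B \<Longrightarrow> A * (c \<cdot>\<^sub>m B) = c \<cdot>\<^sub>m (A * B)"
    and "dim_col A = dim_row B \<Longrightarrow> (c \<cdot>\<^sub>m A) * B = c \<cdot>\<^sub>m (A * B)"
proof -
  assume "dim_col A = dim_row B"
  then have B: "B \<in> carrier_mat (dim_col A) (dim_col B)" by (intro carrier_matI) simp_all
  have A: "A \<in> carrier_mat (dim_row A) (dim_col A)" by (rule carrier_matI[OF refl refl])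
  show "A * (c \<cdot>\<^sub>m B) = c \<cdot>\<^sub>m (A * B)" by (rule mult_smult_distrib[OF A B])
  show "(c \<cdot>\<^sub>m A) * B = c \<cdot>\<^sub>m (A * B)" by (rule mult_smult_assoc_mat[OF A B])
qed

lemma dim_mult_assoc:
  fixes A B C :: "'a::field mat"
  shows "dim_col A = dim_row B \<Longrightarrow> dim_col B = dim_row C \<Longrightarrow> A * B * C = A * (B * C)"
proof -
  assume "dim_col A = dim_row B" "dim_col B = dim_row C"
  then have B: "B \<in> carrier_mat (dim_col A) (dim_col B)" and C: "C \<in> carrier_mat (dim_col B) (dim_col C)"
    by (intro carrier_matI; simp)+
  show "A * B * C = A * (B * C)" by (rule assoc_mult_mat[OF carrier_matI[OF refl refl] B C])
qed

lemma dim_add_mult_vec: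
  fixes A B :: "'a::field mat"
  assumes "dim_row A = dim_row B" "dim_col A = dim_col B" "dim_vec x = dim_col B"
  shows "(A + B) *\<^sub>v x = A *\<^sub>v x + B *\<^sub>v x"
  by (rule add_mult_distrib_mat_vec[OF carrier_matI[OF assms(1,2)] carrier_matI[OF refl refl] carrier_vecI[OF assms(3)]])

lemma smult_add_mat:
  fixes A B :: "'a::field mat"
  shows "dim_row A = dim_row B \<Longrightarrow> dim_col A = dim_col B \<Longrightarrow> c \<cdot>\<^sub>m (A + B) = c \<cdot>\<^sub>m A + c \<cdot>\<^sub>m B"
  by (intro eq_matI) (auto simp: distrib_left)

lemma smult_smult_mat: "c \<cdot>\<^sub>m (d \<cdot>\<^sub>m A) = (c * d) \<cdot>\<^sub>m (A :: 'a::field mat)"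
  by (intro eq_matI) (auto simp: mult.assoc)

lemma uminus_mat_smult: "- A = (- 1) \<cdot>\<^sub>m (A :: 'a::field mat)"
  by (intro eq_matI) auto

lemma minus_mat_smult:
  "dim_row A = dim_row B \<Longrightarrow> dim_col A = dim_col B \<Longrightarrow> A - B = A + (- 1) \<cdot>\<^sub>m (B :: 'a::field mat)"
  by (intro eq_matI) auto

lemma one_smult_mat: "1 \<cdot>\<^sub>m A = (A :: 'a::field mat)"
  by (intro eq_matI) auto

lemma dim_mult_one_zero:
  fixes A :: "'a::field mat"
  shows "dim_row A = n \<Longrightarrow> 1\<^sub>m n * A = A" "dim_col A = n \<Longrightarrow> A * 1\<^sub>m n = A"
    "dim_row A = n \<Longrightarrow> 0\<^sub>m l n * A = 0\<^sub>m l (dim_col A)" "dim_col A = n \<Longrightarrow> A * 0\<^sub>m n l = 0\<^sub>m (dim_row A) l"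
  by auto

lemma dim_kron [simp]:
  "dim_row (kron A B) = dim_row A * dim_row B" "dim_col (kron A B) = dim_col A * dim_col B"
  by (auto simp: kron_def)

lemma kron_carrier [simp]:
  "A \<in> carrier_mat m n \<Longrightarrow> B \<in> carrier_mat p q \<Longrightarrow> kron A B \<in> carrier_mat (m * p) (n * q)"
  by (auto simp: kron_def)

lemma index_kron:
  "i < dim_row A * dim_row B \<Longrightarrow> j < dim_col A * dim_col B \<Longrightarrow>
   kron A B $$ (i, j) = A $$ (i div dim_row B, j div dim_col B) * B $$ (i mod dim_row B, j mod dim_col B)"
  by (simp add: kron_def)

lemma div_mod_less:
  assumes "(i::nat) < m * n" shows "i div n < m" "i mod n < n"
proof -
  have "n > 0" using assms by (cases n) auto
  then show "i div n < m" "i mod n < n" using assms by (auto simp: less_mult_imp_div_less)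
qed

lemma sum_div_mod:
  fixes f :: "nat \<Rightarrow> nat \<Rightarrow> 'a::comm_monoid_add"
  shows "(\<Sum>k\<in>{0..<m * n}. f (k div n) (k mod n)) = (\<Sum>i\<in>{0..<m}. \<Sum>j\<in>{0..<n}. f i j)"
proof -
  have "(\<Sum>k\<in>{0..<m * n}. f (k div n) (k mod n)) = (\<Sum>k<m * n. f (k div n) (k mod n))"
    by (simp add: atLeast0LessThan)
  also have "\<dots> = (\<Sum>i<m. \<Sum>k=i * n..<i * n + n. f (k div n) (k mod n))"
    by (rule sum.nat_group[symmetric])
  also have "\<dots> = (\<Sum>i<m. \<Sum>j\<in>{0..<n}. f i j)"
  proof (rule sum.cong[OF refl])
    fix i
    have "(\<Sum>k=i * n..<i * n + n. f (k div n) (k mod n)) =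
        (\<Sum>k=0..<n. f ((k + i * n) div n) ((k + i * n) mod n))"
      using sum.shift_bounds_nat_ivl[of "\<lambda>k. f (k div n) (k mod n)" 0 "i * n" n] by (simp add: add.commute)
    also have "\<dots> = (\<Sum>j\<in>{0..<n}. f i j)" by (intro sum.cong) auto
    finally show "(\<Sum>k=i * n..<i * n + n. f (k div n) (k mod n)) = (\<Sum>j\<in>{0..<n}. f i j)" .
  qed
  finally show ?thesis by (simp add: atLeast0LessThan)
qed

lemma kron_mult:
  assumes "dim_col A = dim_row C" "dim_col B = dim_row D"
  shows "kron A B * kron C D = kron (A * C) (B * D)"
proof (rule eq_matI)
  fix i j assume "i < dim_row (kron (A * C) (B * D))" "j < dim_col (kron (A * C) (B * D))"
  then have ij: "i < dim_row A * dim_row B" "j < dim_col C * dim_col D" by auto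
  let ?i = "i div dim_row B" and ?i' = "i mod dim_row B" and ?j = "j div dim_col D" and ?j' = "j mod dim_col D"
  have lt: "?i < dim_row A" "?i' < dim_row B" "?j < dim_col C" "?j' < dim_col D"
    using div_mod_less[OF ij(1)] div_mod_less[OF ij(2)] by auto
  have "(kron A B * kron C D) $$ (i, j) = (\<Sum>k\<in>{0..<dim_row C * dim_row D}.
      A $$ (?i, k div dim_row D) * B $$ (?i', k mod dim_row D) * (C $$ (k div dim_row D, ?j) * D $$ (k mod dim_row D, ?j')))"
    using ij assms by (simp add: scalar_prod_def index_kron)
  also have "\<dots> = (\<Sum>a\<in>{0..<dim_row C}. \<Sum>b\<in>{0..<dim_row D}. A $$ (?i, a) * B $$ (?i', b) * (C $$ (a, ?j) * D $$ (b, ?j')))"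
    by (rule sum_div_mod[of "\<lambda>a b. A $$ (?i, a) * B $$ (?i', b) * (C $$ (a, ?j) * D $$ (b, ?j'))"])
  also have "\<dots> = (\<Sum>a\<in>{0..<dim_row C}. A $$ (?i, a) * C $$ (a, ?j)) * (\<Sum>b\<in>{0..<dim_row D}. B $$ (?i', b) * D $$ (b, ?j'))"
    by (simp add: sum_product algebra_simps)
  also have "\<dots> = (A * C) $$ (?i, ?j) * (B * D) $$ (?i', ?j')"
    using lt assms by (simp add: scalar_prod_def)
  also have "\<dots> = kron (A * C) (B * D) $$ (i, j)" using ij by (simp add: index_kron)
  finally show "(kron A B * kron C D) $$ (i, j) = kron (A * C) (B * D) $$ (i, j)" .
qed simp_all

lemma kron_add:
  "dim_row A = dim_row A' \<Longrightarrow> dim_col A = dim_col A' \<Longrightarrow> kron (A + A') B = kron A B + kron A' B"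
  "dim_row B = dim_row B' \<Longrightarrow> dim_col B = dim_col B' \<Longrightarrow> kron A (B + B') = kron A B + kron A B'"
  by (intro eq_matI; simp add: index_kron div_mod_less distrib_left distrib_right)+

lemma kron_smult: "kron (c \<cdot>\<^sub>m A) B = c \<cdot>\<^sub>m kron A B" "kron A (c \<cdot>\<^sub>m B) = c \<cdot>\<^sub>m kron A B"
  by (intro eq_matI; simp add: index_kron div_mod_less)+

lemma kron_zero: "kron (0\<^sub>m m n) B = 0\<^sub>m (m * dim_row B) (n * dim_col B)"
  "kron A (0\<^sub>m m n) = 0\<^sub>m (dim_row A * m) (dim_col A * n)"
  by (intro eq_matI; simp add: index_kron div_mod_less)+

lemma kron_one: "kron (1\<^sub>m m) (1\<^sub>m n) = (1\<^sub>m (m * n) :: 'a::field mat)"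
proof (rule eq_matI)
  fix i j assume "i < dim_row (1\<^sub>m (m * n) :: 'a mat)" "j < dim_col (1\<^sub>m (m * n) :: 'a mat)"
  then have ij: "i < m * n" "j < m * n" by auto
  have "i = j" if "i div n = j div n" "i mod n = j mod n" using that by (metis div_mult_mod_eq)
  then show "kron (1\<^sub>m m) (1\<^sub>m n) $$ (i, j) = (1\<^sub>m (m * n) :: 'a mat) $$ (i, j)"
    using ij by (auto simp: index_kron div_mod_less)
qed auto

lemma kron_one_right: "kron A (1\<^sub>m 1) = (A :: 'a::field mat)"
  by (intro eq_matI) (auto simp: index_kron)

lemma kron_one_left: "kron (1\<^sub>m 1) A = (A :: 'a::field mat)"
  by (intro eq_matI) (auto simp: index_kron)

lemmas mat_simps = dim_mult_distrib dim_mult_smult dim_mult_assoc smult_add_mat smult_smult_mat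
  one_smult_mat dim_mult_one_zero kron_mult kron_add kron_smult kron_zero

text \<open>\<open>X\<close> is its own Kronecker product with the identity of size 1, so the mixed
  product rule applies. Terms of this shape describe maps out of free modules: \<open>z\<close>
  holds images of generators and \<open>e\<close> selects a coordinate.\<close>

lemma mult_kron_row:
  "dim_row e = 1 \<Longrightarrow> dim_col X = dim_row z \<Longrightarrow> X * kron z e = kron (X * z) (e :: 'a::field mat)"
  using kron_mult[of X z "1\<^sub>m 1" e] kron_one_right[of X] by simp

lemma diag_block_mat_replicate:
  fixes A :: "'a::field mat"
  assumes A: "A \<in> carrier_mat m m"
  shows "diag_block_mat (replicate n A) = kron (1\<^sub>m n) A"
proof (induction n)
  case 0
  then show ?case by (intro eq_matI) auto
next
  case (Suc n)
  let ?D = "diag_block_mat (replicate n A)"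
  have D: "?D \<in> carrier_mat (n * m) (n * m)" using Suc A by auto
  show ?case
  proof (rule eq_matI)
    fix i j assume "i < dim_row (kron (1\<^sub>m (Suc n)) A)" "j < dim_col (kron (1\<^sub>m (Suc n)) A)"
    then have ij: "i < Suc n * m" "j < Suc n * m" using A by auto
    have "diag_block_mat (replicate (Suc n) A) $$ (i, j) =
      four_block_mat A (0\<^sub>m m (n * m)) (0\<^sub>m (n * m) m) ?D $$ (i, j)"
      using A D by (simp add: Let_def)
    also have "\<dots> = kron (1\<^sub>m (Suc n)) A $$ (i, j)"
    proof -
      have m: "m > 0" using ij by (cases m) auto
      have shift: "k div m = Suc ((k - m) div m)" "k mod m = (k - m) mod m" if "\<not> k < m" for k
        using that m by (auto simp: le_div_geq le_mod_geq)
      show ?thesis using ij A D m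
        by (cases "i < m"; cases "j < m")
          (auto simp: index_kron Suc shift div_mod_less)
    qed
    finally show "diag_block_mat (replicate (Suc n) A) $$ (i, j) = kron (1\<^sub>m (Suc n)) A $$ (i, j)" .
  qed (use A D in \<open>auto simp: Let_def\<close>)
qed

section \<open>The defining relations as rewrite rules, and the module structure on a tensor
  product\<close>

lemma d4_moduleD:
  assumes "d4_module M"
  shows "act M g \<in> carrier_mat (mdim M) (mdim M)"
    "dim_row (act M g) = mdim M" "dim_col (act M g) = mdim M"
    "act M Gb * act M Ga = - (act M Ga * act M Gb)" "act M Gd * act M Gb = - (act M Gb * act M Gd)"
    "act M Gc * act M Ga = - (act M Ga * act M Gc)" "act M Gd * act M Gc = - (act M Gc * act M Gd)"
    "act M Gb * act M Gc = act M Gc * act M Gb"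
    "act M Ga * act M Ga = 0\<^sub>m (mdim M) (mdim M)" "act M Gb * act M Gb = 1\<^sub>m (mdim M)"
    "act M Gc * act M Gc = 1\<^sub>m (mdim M)" "act M Gd * act M Gd = 0\<^sub>m (mdim M) (mdim M)"
    "act M Gd * act M Ga + act M Ga * act M Gd = 1\<^sub>m (mdim M) - act M Gb * act M Gc"
  using assms by (auto simp: d4_module_def Let_def)

lemma act_tensor:
  "mdim (tensor M N) = mdim M * mdim N"
  "act (tensor M N) Ga = kron (act M Ga) (act N Gb) + kron (1\<^sub>m (mdim M)) (act N Ga)"
  "act (tensor M N) Gb = kron (act M Gb) (act N Gb)"
  "act (tensor M N) Gc = kron (act M Gc) (act N Gc)"
  "act (tensor M N) Gd = kron (act M Gd) (act N Gc) + kron (1\<^sub>m (mdim M)) (act N Gd)"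
  by (simp_all add: tensor_def)

text \<open>The relations are oriented so that mixed products are brought into the order
  \<open>a\<close>, \<open>b\<close>, \<open>c\<close>, \<open>d\<close>; negation is turned into a
  scalar factor so that signs are collected uniformly.\<close>

lemma d4_module_normal_form:
  assumes M: "d4_module M"
  shows "act M Gb * act M Ga = (- 1) \<cdot>\<^sub>m (act M Ga * act M Gb)" "act M Gd * act M Gb = (- 1) \<cdot>\<^sub>m (act M Gb * act M Gd)"
    "act M Gc * act M Ga = (- 1) \<cdot>\<^sub>m (act M Ga * act M Gc)" "act M Gd * act M Gc = (- 1) \<cdot>\<^sub>m (act M Gc * act M Gd)"
    "act M Gc * act M Gb = act M Gb * act M Gc"
    "act M Ga * act M Ga = 0\<^sub>m (mdim M) (mdim M)" "act M Gb * act M Gb = 1\<^sub>m (mdim M)"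
    "act M Gc * act M Gc = 1\<^sub>m (mdim M)" "act M Gd * act M Gd = 0\<^sub>m (mdim M) (mdim M)"
    "act M Gd * act M Ga = 1\<^sub>m (mdim M) + (- 1) \<cdot>\<^sub>m (act M Gb * act M Gc) + (- 1) \<cdot>\<^sub>m (act M Ga * act M Gd)"
proof -
  note m = d4_moduleD[OF M]
  show "act M Gd * act M Ga = 1\<^sub>m (mdim M) + (- 1) \<cdot>\<^sub>m (act M Gb * act M Gc) + (- 1) \<cdot>\<^sub>m (act M Ga * act M Gd)"
  proof (rule eq_matI)
    fix i j assume "i < dim_row (1\<^sub>m (mdim M) + (- 1) \<cdot>\<^sub>m (act M Gb * act M Gc) + (- 1) \<cdot>\<^sub>m (act M Ga * act M Gd))"
      "j < dim_col (1\<^sub>m (mdim M) + (- 1) \<cdot>\<^sub>m (act M Gb * act M Gc) + (- 1) \<cdot>\<^sub>m (act M Ga * act M Gd))"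
    then have ij: "i < mdim M" "j < mdim M" using m(2,3) by auto
    then show "(act M Gd * act M Ga) $$ (i, j) =
      (1\<^sub>m (mdim M) + (- 1) \<cdot>\<^sub>m (act M Gb * act M Gc) + (- 1) \<cdot>\<^sub>m (act M Ga * act M Gd)) $$ (i, j)"
      using arg_cong[OF m(13), of "\<lambda>X. X $$ (i, j)"] m(2,3) by (simp add: algebra_simps del: index_mult_mat(1))
  qed (use m(2,3) in auto)
qed (use d4_moduleD(4-12)[OF M] in \<open>simp_all only: uminus_mat_smult\<close>)

text \<open>The comultiplication respects the defining relations: expanded by the mixed product
  rule, both sides of each relation reduce to the same ordered expression through the relations of
  the two factors.\<close>

lemma d4_module_tensor:
  assumes M: "d4_module M" and N: "d4_module N"
  shows "d4_module (tensor M N)"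
proof -
  note d = d4_moduleD(2,3)[OF M] d4_moduleD(2,3)[OF N]
  note r = d4_module_normal_form[OF M] d4_module_normal_form[OF N]
  have c: "act (tensor M N) g \<in> carrier_mat (mdim M * mdim N) (mdim M * mdim N)" for g
    using d by (cases g) (auto simp: act_tensor)
  show ?thesis
    unfolding d4_module_def Let_def act_tensor(1)
  proof (intro conjI allI c)
  qed (auto simp: act_tensor mat_simps uminus_mat_smult kron_one d r
    intro!: eq_matI simp del: index_mult_mat(1))
qed

subsection \<open>Free modules over the exterior algebra and projective covers\<close>

lemma parity_sign_square [simp]: "parity_sign r * parity_sign r = (1 :: 'a::field)"
  by (simp add: parity_sign_def)

lemma parity_sign_square_left [simp]: "parity_sign r * (parity_sign r * x) = (x :: 'a::field)"
  by (simp add: parity_sign_def)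

section \<open>Homomorphisms, isomorphisms and direct sums of copies\<close>

lemma act_mult_carrier:
  assumes "d4_module X" "z \<in> carrier_mat (mdim X) n"
  shows "act X g * z \<in> carrier_mat (mdim X) n"
  by (rule mult_carrier_mat[OF d4_moduleD(1)[OF assms(1)] assms(2)])

lemma d4_homD:
  assumes "T \<in> d4_hom M N"
  shows "T \<in> carrier_mat (mdim N) (mdim M)" "T * act M g = act N g * T"
  using assms by (auto simp: d4_hom_def)

lemma d4_hom_comp:
  assumes T: "T \<in> d4_hom M N" and S: "S \<in> d4_hom N K"
    and M: "d4_module M" and N: "d4_module N" and K: "d4_module K"
  shows "S * T \<in> d4_hom M K"
proof -
  note Tc = d4_homD(1)[OF T] and Sc = d4_homD(1)[OF S]
  have "S * T * act M g = act K g * (S * T)" for g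
  proof -
    have "S * T * act M g = S * (T * act M g)" by (rule assoc_mult_mat[OF Sc Tc d4_moduleD(1)[OF M]])
    also have "\<dots> = S * act N g * T"
      unfolding d4_homD(2)[OF T] by (rule assoc_mult_mat[OF Sc d4_moduleD(1)[OF N] Tc, symmetric])
    also have "\<dots> = act K g * (S * T)"
      unfolding d4_homD(2)[OF S] by (rule assoc_mult_mat[OF d4_moduleD(1)[OF K] Sc Tc])
    finally show ?thesis .
  qed
  then show ?thesis using Tc Sc by (auto simp: d4_hom_def)
qed

lemma d4_hom_inverse:
  assumes T: "T \<in> d4_hom M N" and S: "S \<in> carrier_mat (mdim M) (mdim N)"
    and inv: "T * S = 1\<^sub>m (mdim N)" "S * T = 1\<^sub>m (mdim M)"
    and M: "d4_module M" and N: "d4_module N"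
  shows "S \<in> d4_hom N M"
proof -
  note Tc = d4_homD(1)[OF T] and Mc = d4_moduleD(1)[OF M] and Nc = d4_moduleD(1)[OF N]
  have "S * act N g = act M g * S" for g
  proof -
    have "S * act N g = S * (act N g * (T * S))" using inv(1) Nc[of g] by simp
    also have "act N g * (T * S) = act N g * T * S" by (rule assoc_mult_mat[OF Nc Tc S, symmetric])
    also have "act N g * T = T * act M g" using d4_homD(2)[OF T] by simp
    also have "T * act M g * S = T * (act M g * S)" by (rule assoc_mult_mat[OF Tc Mc S])
    also have "S * (T * (act M g * S)) = S * T * (act M g * S)"
      by (rule assoc_mult_mat[OF S Tc mult_carrier_mat[OF Mc S], symmetric])
    also have "\<dots> = act M g * S" unfolding inv(2) by (rule left_mult_one_mat[OF mult_carrier_mat[OF Mc S]])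
    finally show ?thesis .
  qed
  then show ?thesis using S by (simp add: d4_hom_def)
qed

lemma isomorphicI:
  assumes T: "T \<in> d4_hom M N" and S: "S \<in> carrier_mat (mdim M) (mdim N)"
    and inv: "T * S = 1\<^sub>m (mdim N)" "S * T = 1\<^sub>m (mdim M)"
  shows "M \<simeq> N"
proof -
  note Tc = d4_homD(1)[OF T]
  have "bij_betw ((*\<^sub>v) T) (space M) (space N)"
  proof (rule bij_betw_byWitness[where f' = "(*\<^sub>v) S"])
    show "\<forall>x\<in>space M. S *\<^sub>v (T *\<^sub>v x) = x" using assoc_mult_mat_vec[OF S Tc] inv by simp
    show "\<forall>x\<in>space N. T *\<^sub>v (S *\<^sub>v x) = x" using assoc_mult_mat_vec[OF Tc S] inv by simp
  qed (use Tc S in auto)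
  then show ?thesis unfolding isomorphic_def using T by blast
qed

lemma act_copies:
  assumes "d4_module P"
  shows "mdim (copies n P) = n * mdim P" "act (copies n P) g = kron (1\<^sub>m n) (act P g)"
  using diag_block_mat_replicate[OF d4_moduleD(1)[OF assms]] by (simp_all add: copies_def)

lemma d4_module_copies:
  assumes P: "d4_module P"
  shows "d4_module (copies n P)"
proof -
  note d = d4_moduleD(2,3)[OF P] and r = d4_module_normal_form[OF P]
  have c: "act (copies n P) g \<in> carrier_mat (n * mdim P) (n * mdim P)" for g
    using d by (auto simp: act_copies[OF P])
  show ?thesis
    unfolding d4_module_def Let_def act_copies(1)[OF P]
  proof (intro conjI allI c)
  qed (auto simp: act_copies[OF P] mat_simps uminus_mat_smult kron_one d r
    intro!: eq_matI simp del: index_mult_mat(1))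
qed

lemma copies_hom:
  assumes P: "d4_module P" and Q: "d4_module Q" and T: "T \<in> d4_hom P Q"
  shows "kron (1\<^sub>m n) T \<in> d4_hom (copies n P) (copies n Q)"
  using d4_homD[OF T] d4_moduleD(2,3)[OF P] d4_moduleD(2,3)[OF Q]
  by (auto simp: d4_hom_def act_copies[OF P] act_copies[OF Q] kron_mult)

section \<open>An explicit four-dimensional model of the projective cover\<close>

text \<open>The algebra modulo \<open>bc = 1\<close> and the projection onto the eigenspace of \<open>b\<close>: the basis is
  \<open>p, ap, dp, adp\<close> with \<open>bp = cp = (-1)\<^sup>r p\<close>.\<close>

definition proj4 :: "bit \<Rightarrow> 'k::field d4mod" where
  "proj4 r =
     \<lparr>mdim = 4,
      act = (\<lambda>g. case g of
          Ga \<Rightarrow> mat 4 4 (\<lambda>(i, j). if (i = 1 \<and> j = 0) \<or> (i = 3 \<and> j = 2) then 1 else 0)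
        | Gb \<Rightarrow> mat 4 4 (\<lambda>(i, j). if i = j then (if i = 0 \<or> i = 3 then parity_sign r else - parity_sign r) else 0)
        | Gc \<Rightarrow> mat 4 4 (\<lambda>(i, j). if i = j then (if i = 0 \<or> i = 3 then parity_sign r else - parity_sign r) else 0)
        | Gd \<Rightarrow> mat 4 4 (\<lambda>(i, j). if i = 2 \<and> j = 0 then 1 else if i = 3 \<and> j = 1 then - 1 else 0))\<rparr>"

lemma less_4_cases: "(i::nat) < 4 \<Longrightarrow> i = 0 \<or> i = 1 \<or> i = 2 \<or> i = 3"
  by auto

lemma sum_upto_4: "(\<Sum>i\<in>{0..<4}. f i) = f 0 + f 1 + f 2 + (f (3::nat) :: 'a::comm_monoid_add)"
  by (simp add: numeral_eq_Suc add.assoc)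

lemma d4_module_proj4: "d4_module (proj4 r :: 'k::field d4mod)"
proof -
  have c: "act (proj4 r) g \<in> carrier_mat 4 4" for g by (cases g) (simp_all add: proj4_def)
  have [simp]: "mdim (proj4 r) = 4" by (simp add: proj4_def)
  show ?thesis
    unfolding d4_module_def Let_def
  proof (intro conjI allI)
  qed (simp_all add: c, (rule eq_matI; auto simp: proj4_def scalar_prod_def sum_upto_4 dest!: less_4_cases)+)
qed

text \<open>The path from the top to the socle: \<open>d\<close> carries coordinate 0 to coordinate
  2, and \<open>a\<close> carries this one to coordinate 3. Hence \<open>ad\<close> does not kill a
  vector with nonzero top coordinate.\<close>

lemma proj4_entries:
  fixes Y :: "'k::field mat"
  assumes "Y \<in> carrier_mat 4 n" "j < n"
  shows "(act (proj4 r) Ga * Y) $$ (3, j) = Y $$ (2, j)" "(act (proj4 r) Gd * Y) $$ (2, j) = Y $$ (0, j)"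
  using assms by (simp_all add: proj4_def scalar_prod_def sum_upto_4)

text \<open>These are the coordinate functionals for the basis \<open>p\<close>, \<open>ap\<close>,
  \<open>dp\<close>, \<open>adp\<close>. Kronecker products with them write a map out of a free
  module as a sum of four terms.\<close>

definition row4 :: "nat \<Rightarrow> 'k::field mat" where
  "row4 q = mat 1 4 (\<lambda>(_, j). if j = q then 1 else 0)"

lemma row4_dims [simp]: "dim_row (row4 q) = 1" "dim_col (row4 q) = 4"
  by (simp_all add: row4_def)

text \<open>The table of \<open>proj4\<close> in transposed form, acting on coordinate functionals
  from the right.\<close>

lemma row4_proj4:
  fixes r :: bit
  shows "row4 0 * act (proj4 r) Ga = (0\<^sub>m 1 4 :: 'k::field mat)" "row4 1 * act (proj4 r) Ga = (row4 0 :: 'k::field mat)"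
    "row4 2 * act (proj4 r) Ga = (0\<^sub>m 1 4 :: 'k::field mat)" "row4 3 * act (proj4 r) Ga = (row4 2 :: 'k::field mat)"
    "row4 0 * act (proj4 r) Gd = (0\<^sub>m 1 4 :: 'k::field mat)" "row4 1 * act (proj4 r) Gd = (0\<^sub>m 1 4 :: 'k::field mat)"
    "row4 2 * act (proj4 r) Gd = (row4 0 :: 'k::field mat)" "row4 3 * act (proj4 r) Gd = (- 1) \<cdot>\<^sub>m (row4 1 :: 'k::field mat)"
    "g = Gb \<or> g = Gc \<Longrightarrow> row4 0 * act (proj4 r) g = parity_sign r \<cdot>\<^sub>m (row4 0 :: 'k::field mat)"
    "g = Gb \<or> g = Gc \<Longrightarrow> row4 1 * act (proj4 r) g = (- parity_sign r) \<cdot>\<^sub>m (row4 1 :: 'k::field mat)"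
    "g = Gb \<or> g = Gc \<Longrightarrow> row4 2 * act (proj4 r) g = (- parity_sign r) \<cdot>\<^sub>m (row4 2 :: 'k::field mat)"
    "g = Gb \<or> g = Gc \<Longrightarrow> row4 3 * act (proj4 r) g = parity_sign r \<cdot>\<^sub>m (row4 3 :: 'k::field mat)"
  by (rule eq_matI; auto simp: row4_def proj4_def scalar_prod_def sum_upto_4 dest!: less_4_cases)+

text \<open>The homomorphism out of a free module that sends the generators to the columns of \<open>z\<close>.\<close>

definition free_map :: "'k::field d4mod \<Rightarrow> 'k mat \<Rightarrow> 'k mat" where
  "free_map X z = kron z (row4 0) + kron (act X Ga * z) (row4 1) + kron (act X Gd * z) (row4 2)
     + kron (act X Ga * (act X Gd * z)) (row4 3)"

lemma free_map_carrier [simp]: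
  assumes "d4_module X" "z \<in> carrier_mat (mdim X) n"
  shows "free_map X z \<in> carrier_mat (mdim X) (n * 4)"
  using assms d4_moduleD(2)[OF assms(1)] by (auto simp: free_map_def)

text \<open>Equal weights of \<open>b\<close> and \<open>c\<close> with square 1 give
  \<open>bc = 1\<close> on these columns, so \<open>a\<close> and \<open>d\<close> anticommute
  there. The sign \<open>\<tau>\<close> is left general because the lemma is applied again to the
  columns of \<open>d w\<close>, which have weight \<open>- \<tau>\<close>.\<close>

lemma weight_column_relations:
  assumes X: "d4_module X" and w: "w \<in> carrier_mat (mdim X) n"
    and b: "act X Gb * w = \<tau> \<cdot>\<^sub>m w" and c: "act X Gc * w = \<tau> \<cdot>\<^sub>m w" and \<tau>: "\<tau> * \<tau> = 1"
  shows "act X Ga * (act X Ga * w) = 0\<^sub>m (mdim X) n" "act X Gd * (act X Gd * w) = 0\<^sub>m (mdim X) n"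
    "act X Gd * (act X Ga * w) = (- 1) \<cdot>\<^sub>m (act X Ga * (act X Gd * w))"
    "act X Gb * (act X Ga * w) = (- \<tau>) \<cdot>\<^sub>m (act X Ga * w)" "act X Gc * (act X Ga * w) = (- \<tau>) \<cdot>\<^sub>m (act X Ga * w)"
    "act X Gb * (act X Gd * w) = (- \<tau>) \<cdot>\<^sub>m (act X Gd * w)" "act X Gc * (act X Gd * w) = (- \<tau>) \<cdot>\<^sub>m (act X Gd * w)"
proof -
  note d = d4_moduleD(2,3)[OF X] and r = d4_module_normal_form[OF X]
  note dw = carrier_matD[OF w]
  have assoc: "act X g * (act X h * w) = (act X g * act X h) * w" for g h
    by (simp add: dim_mult_assoc d dw)
  show "act X Ga * (act X Ga * w) = 0\<^sub>m (mdim X) n" "act X Gd * (act X Gd * w) = 0\<^sub>m (mdim X) n"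
    unfolding assoc r by (simp_all add: dim_mult_one_zero dw)
  show "act X Gb * (act X Ga * w) = (- \<tau>) \<cdot>\<^sub>m (act X Ga * w)" "act X Gc * (act X Ga * w) = (- \<tau>) \<cdot>\<^sub>m (act X Ga * w)"
    unfolding assoc r by (simp_all add: mat_simps d dw b c)
  have bd: "act X Gb * act X Gd = (- 1) \<cdot>\<^sub>m (act X Gd * act X Gb)" and cd: "act X Gc * act X Gd = (- 1) \<cdot>\<^sub>m (act X Gd * act X Gc)"
    unfolding r by (simp_all add: smult_smult_mat one_smult_mat)
  show "act X Gb * (act X Gd * w) = (- \<tau>) \<cdot>\<^sub>m (act X Gd * w)" "act X Gc * (act X Gd * w) = (- \<tau>) \<cdot>\<^sub>m (act X Gd * w)"
    unfolding assoc bd cd by (simp_all add: mat_simps d dw b c)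
  have "act X Gd * (act X Ga * w) = w + (- 1) \<cdot>\<^sub>m w + (- 1) \<cdot>\<^sub>m (act X Ga * (act X Gd * w))"
    unfolding assoc r by (simp add: mat_simps d dw b c \<tau>)
  also have "\<dots> = (- 1) \<cdot>\<^sub>m (act X Ga * (act X Gd * w))"
    by (rule eq_matI) (auto simp: d dw simp del: index_mult_mat(1))
  finally show "act X Gd * (act X Ga * w) = (- 1) \<cdot>\<^sub>m (act X Ga * (act X Gd * w))" .
qed

context
  fixes X :: "'k::field d4mod" and z :: "'k mat" and n :: nat and r :: bit
  assumes X: "d4_module X" and z: "z \<in> carrier_mat (mdim X) n"
    and b: "act X Gb * z = parity_sign r \<cdot>\<^sub>m z" and c: "act X Gc * z = parity_sign r \<cdot>\<^sub>m z"
begin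

lemma free_relations:
  "act X Ga * (act X Ga * z) = 0\<^sub>m (mdim X) n" "act X Gd * (act X Gd * z) = 0\<^sub>m (mdim X) n"
  "act X Gd * (act X Ga * z) = (- 1) \<cdot>\<^sub>m (act X Ga * (act X Gd * z))"
  "act X Ga * (act X Ga * (act X Gd * z)) = 0\<^sub>m (mdim X) n"
  "act X Gd * (act X Ga * (act X Gd * z)) = 0\<^sub>m (mdim X) n"
  "act X Gb * (act X Ga * z) = (- parity_sign r) \<cdot>\<^sub>m (act X Ga * z)"
  "act X Gc * (act X Ga * z) = (- parity_sign r) \<cdot>\<^sub>m (act X Ga * z)"
  "act X Gb * (act X Gd * z) = (- parity_sign r) \<cdot>\<^sub>m (act X Gd * z)"
  "act X Gc * (act X Gd * z) = (- parity_sign r) \<cdot>\<^sub>m (act X Gd * z)"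
  "act X Gb * (act X Ga * (act X Gd * z)) = parity_sign r \<cdot>\<^sub>m (act X Ga * (act X Gd * z))"
  "act X Gc * (act X Ga * (act X Gd * z)) = parity_sign r \<cdot>\<^sub>m (act X Ga * (act X Gd * z))"
proof -
  note R = weight_column_relations[OF X z b c parity_sign_square]
  have dz: "act X Gd * z \<in> carrier_mat (mdim X) n" by (rule act_mult_carrier[OF X z])
  note S = weight_column_relations[OF X dz R(6,7)]
  show "act X Ga * (act X Ga * z) = 0\<^sub>m (mdim X) n" "act X Gd * (act X Gd * z) = 0\<^sub>m (mdim X) n"
    "act X Gd * (act X Ga * z) = (- 1) \<cdot>\<^sub>m (act X Ga * (act X Gd * z))"
    "act X Gb * (act X Ga * z) = (- parity_sign r) \<cdot>\<^sub>m (act X Ga * z)"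
    "act X Gc * (act X Ga * z) = (- parity_sign r) \<cdot>\<^sub>m (act X Ga * z)"
    "act X Gb * (act X Gd * z) = (- parity_sign r) \<cdot>\<^sub>m (act X Gd * z)"
    "act X Gc * (act X Gd * z) = (- parity_sign r) \<cdot>\<^sub>m (act X Gd * z)" by (fact R)+
  show "act X Ga * (act X Ga * (act X Gd * z)) = 0\<^sub>m (mdim X) n"
    "act X Gb * (act X Ga * (act X Gd * z)) = parity_sign r \<cdot>\<^sub>m (act X Ga * (act X Gd * z))"
    "act X Gc * (act X Ga * (act X Gd * z)) = parity_sign r \<cdot>\<^sub>m (act X Ga * (act X Gd * z))"
    using S(1,4,5) by simp_all
  show "act X Gd * (act X Ga * (act X Gd * z)) = 0\<^sub>m (mdim X) n"
    using S(3) R(2) d4_moduleD(1)[OF X, of Ga] by simp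
qed

text \<open>Multiplication by \<open>a\<close> or \<open>d\<close> annihilates every term that
  already contains this letter; after \<open>ad\<close> only the coefficient of the generators is
  left. These truncations drive the proof of injectivity.\<close>

lemma free_map_mult:
  "act X Ga * free_map X z = kron (act X Ga * z) (row4 0) + kron (act X Ga * (act X Gd * z)) (row4 2)"
  "act X Gd * free_map X z = kron (act X Gd * z) (row4 0) + (- 1) \<cdot>\<^sub>m kron (act X Ga * (act X Gd * z)) (row4 1)"
  "act X Ga * (act X Gd * free_map X z) = kron (act X Ga * (act X Gd * z)) (row4 0)"
proof -
  note d = d4_moduleD(2,3)[OF X] carrier_matD[OF z]
  have zz: "0\<^sub>m m l + (A :: 'k mat) = A" "A + 0\<^sub>m m l = A" if "dim_row A = m" "dim_col A = l" for A m l
    using that by (auto intro!: eq_matI)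
  show "act X Ga * free_map X z = kron (act X Ga * z) (row4 0) + kron (act X Ga * (act X Gd * z)) (row4 2)"
    by (simp add: free_map_def dim_mult_distrib mult_kron_row d free_relations kron_zero zz)
  show *: "act X Gd * free_map X z = kron (act X Gd * z) (row4 0) + (- 1) \<cdot>\<^sub>m kron (act X Ga * (act X Gd * z)) (row4 1)"
    by (simp add: free_map_def dim_mult_distrib mult_kron_row d free_relations kron_zero kron_smult zz)
  show "act X Ga * (act X Gd * free_map X z) = kron (act X Ga * (act X Gd * z)) (row4 0)"
    unfolding * by (simp add: dim_mult_distrib dim_mult_smult mult_kron_row d free_relations kron_zero zz)
qed

lemma free_map_hom: "free_map X z \<in> d4_hom (copies n (proj4 r)) X"
proof -
  note d = d4_moduleD(2,3)[OF X] carrier_matD[OF z] d4_moduleD(2,3)[OF d4_module_proj4[of r]]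
  have [simp]: "mdim (proj4 r) = 4" by (simp add: proj4_def)
  have zz: "0\<^sub>m m l + (A :: 'k mat) = A" "A + 0\<^sub>m m l = A" if "dim_row A = m" "dim_col A = l" for A m l
    using that by (auto intro!: eq_matI)
  have "free_map X z * kron (1\<^sub>m n) (act (proj4 r) g) = act X g * free_map X z" for g
  proof (cases g)
    case Ga
    show ?thesis
      unfolding Ga free_map_mult
      by (simp add: free_map_def dim_mult_distrib kron_mult d row4_proj4 row4_proj4[unfolded One_nat_def] kron_zero zz)
  next
    case Gd
    show ?thesis
      unfolding Gd free_map_mult
      by (simp add: free_map_def dim_mult_distrib kron_mult d row4_proj4 row4_proj4[unfolded One_nat_def] kron_zero kron_smult zz)
  next
    case Gb
    show ?thesis
      unfolding Gb
      by (simp add: free_map_def dim_mult_distrib kron_mult mult_kron_row d row4_proj4 row4_proj4[unfolded One_nat_def] free_relations b c kron_smult)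
  next
    case Gc
    show ?thesis
      unfolding Gc
      by (simp add: free_map_def dim_mult_distrib kron_mult mult_kron_row d row4_proj4 row4_proj4[unfolded One_nat_def] free_relations b c kron_smult)
  qed
  then show ?thesis
    unfolding d4_hom_def using free_map_carrier[OF X z] by (simp add: act_copies[OF d4_module_proj4])
qed

text \<open>If a combination vanishes, applying \<open>ad\<close> isolates the coefficients at the
  generators, which are zero by the assumed injectivity. Then \<open>a\<close> isolates the
  coefficients at \<open>dp\<close>, \<open>d\<close> those at \<open>ap\<close>, and finally only
  the terms with \<open>adp\<close> remain.\<close>

lemma free_map_inj:
  assumes inj: "inj_mat (act X Ga * (act X Gd * z))"
  shows "inj_mat (free_map X z)"
proof (rule inj_matI[OF free_map_carrier[OF X z]])
  fix x assume x: "x \<in> carrier_vec (n * 4)" and T0: "free_map X z *\<^sub>v x = 0\<^sub>v (mdim X)"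
  note d = d4_moduleD(2,3)[OF X] carrier_matD[OF z]
  define w where "w = act X Ga * (act X Gd * z)"
  have az: "act X Ga * z \<in> carrier_mat (mdim X) n" and dz: "act X Gd * z \<in> carrier_mat (mdim X) n"
    and w: "w \<in> carrier_mat (mdim X) n"
    unfolding w_def by (intro act_mult_carrier[OF X] z)+
  \<comment> \<open>\<open>K q *\<^sub>v x\<close> collects the coefficients of \<open>x\<close> at
    basis element \<open>q\<close>, one for each of the \<open>n\<close> generators.\<close>
  define K :: "nat \<Rightarrow> 'k mat" where "K q = kron (1\<^sub>m n) (row4 q)" for q
  have K: "K q \<in> carrier_mat n (n * 4)" for q by (rule carrier_matI) (simp_all add: K_def)
  have fac: "kron y (row4 q) *\<^sub>v x = y *\<^sub>v (K q *\<^sub>v x)" if y: "y \<in> carrier_mat (mdim X) n" for y q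
  proof -
    have "kron y (row4 q) = y * K q"
      using y mult_kron_row[of "row4 q" y "1\<^sub>m n"] by (simp add: K_def)
    then show ?thesis using assoc_mult_mat_vec[OF y K x] by simp
  qed
  have kc: "kron y (row4 q) \<in> carrier_mat (mdim X) (n * 4)" if "y \<in> carrier_mat (mdim X) n" for y :: "'k mat" and q
    using that by (intro carrier_matI) auto
  have Kx: "K q *\<^sub>v x \<in> carrier_vec n" for q by (rule mult_mat_vec_carrier[OF K x])
  have T: "free_map X z \<in> carrier_mat (mdim X) (n * 4)" by (rule free_map_carrier[OF X z])
  have aT: "(act X g * Y) *\<^sub>v x = 0\<^sub>v (mdim X)" if "Y \<in> carrier_mat (mdim X) (n * 4)" "Y *\<^sub>v x = 0\<^sub>v (mdim X)" for g Y
    using assoc_mult_mat_vec[OF d4_moduleD(1)[OF X] that(1) x, of g] that d4_moduleD(1)[OF X, of g] by simp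
  have injw: "K q *\<^sub>v x = 0\<^sub>v n" if "w *\<^sub>v (K q *\<^sub>v x) = 0\<^sub>v (mdim X)" for q
    using inj_matD[OF inj[folded w_def] w Kx that] .
  have zero_add: "u = 0\<^sub>v m" if "(0\<^sub>v m :: 'k vec) + u = 0\<^sub>v m" "u \<in> carrier_vec m" for u :: "'k vec" and m
    using that by simp
  have dT: "act X Gd * free_map X z \<in> carrier_mat (mdim X) (n * 4)" by (rule act_mult_carrier[OF X T])
  have "kron w (row4 0) *\<^sub>v x = 0\<^sub>v (mdim X)"
    using aT[OF dT aT[OF T T0], of Ga] free_map_mult(3) by (simp add: w_def)
  then have K0: "K 0 *\<^sub>v x = 0\<^sub>v n" using fac[OF w] injw by simp
  have y0: "kron y (row4 0) *\<^sub>v x = 0\<^sub>v (mdim X)" if y: "y \<in> carrier_mat (mdim X) n" for y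
    using fac[OF y] K0 y by simp
  have "kron (act X Ga * z) (row4 0) *\<^sub>v x + kron w (row4 2) *\<^sub>v x = 0\<^sub>v (mdim X)"
    using aT[OF T T0, of Ga] free_map_mult(1) add_mult_distrib_mat_vec[OF kc[OF az] kc[OF w] x] by (simp add: w_def)
  then have "w *\<^sub>v (K 2 *\<^sub>v x) = 0\<^sub>v (mdim X)" using y0[OF az] fac[OF w] w Kx by simp
  then have K2: "K 2 *\<^sub>v x = 0\<^sub>v n" by (rule injw)
  have "kron (act X Gd * z) (row4 0) *\<^sub>v x + ((- 1) \<cdot>\<^sub>m kron w (row4 1)) *\<^sub>v x = 0\<^sub>v (mdim X)"
    using aT[OF T T0, of Gd] free_map_mult(2) add_mult_distrib_mat_vec[OF kc[OF dz] _ x, of "(- 1) \<cdot>\<^sub>m kron w (row4 1)"] kc[OF w, of 1]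
    by (simp add: w_def)
  then have "(- 1) \<cdot>\<^sub>v (w *\<^sub>v (K 1 *\<^sub>v x)) = 0\<^sub>v (mdim X)"
    using y0[OF dz] fac[OF w, of 1] w Kx[of 1] smult_mat_mult_vec[OF kc[OF w, of 1] x, of "- 1"] by simp
  then have "(- 1) \<cdot>\<^sub>v ((- 1) \<cdot>\<^sub>v (w *\<^sub>v (K 1 *\<^sub>v x))) = (- 1) \<cdot>\<^sub>v 0\<^sub>v (mdim X)" by simp
  then have "w *\<^sub>v (K 1 *\<^sub>v x) = 0\<^sub>v (mdim X)" by (simp add: smult_smult_assoc)
  then have K1: "K 1 *\<^sub>v x = 0\<^sub>v n" by (rule injw)
  have "free_map X z *\<^sub>v x = kron z (row4 0) *\<^sub>v x + kron (act X Ga * z) (row4 1) *\<^sub>v x + kron (act X Gd * z) (row4 2) *\<^sub>v x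
     + kron w (row4 3) *\<^sub>v x"
    unfolding free_map_def w_def[symmetric]
    using carrier_matD[OF z] carrier_matD[OF az] carrier_matD[OF dz] carrier_matD[OF w] carrier_vecD[OF x]
    by (simp add: dim_add_mult_vec)
  then have "w *\<^sub>v (K 3 *\<^sub>v x) = 0\<^sub>v (mdim X)"
    using T0 y0[OF z] fac[OF az, of 1] fac[OF dz, of 2] fac[OF w, of 3] K1 K2 az dz w Kx by simp
  then have K3: "K 3 *\<^sub>v x = 0\<^sub>v n" by (rule injw)
  have e: "kron (1\<^sub>m n) ((row4 q)\<^sup>T) * K q = kron (1\<^sub>m n) ((row4 q)\<^sup>T * row4 q)" for q
    unfolding K_def by (simp add: kron_mult)
  \<comment> \<open>A decomposition of the identity, by which the four coefficient vectors determine
    \<open>x\<close>.\<close>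
  have "(row4 0)\<^sup>T * row4 0 + (row4 1)\<^sup>T * row4 1 + (row4 2)\<^sup>T * row4 2 + (row4 3)\<^sup>T * row4 3 = (1\<^sub>m 4 :: 'k mat)"
    by (rule eq_matI) (auto simp: row4_def scalar_prod_def dest!: less_4_cases)
  then have "kron (1\<^sub>m n) ((row4 0)\<^sup>T) * K 0 + kron (1\<^sub>m n) ((row4 1)\<^sup>T) * K 1 + kron (1\<^sub>m n) ((row4 2)\<^sup>T) * K 2
     + kron (1\<^sub>m n) ((row4 3)\<^sup>T) * K 3 = 1\<^sub>m (n * 4)"
    unfolding e by (simp add: kron_add(2)[symmetric] kron_one)
  then have "x = (kron (1\<^sub>m n) ((row4 0)\<^sup>T) * K 0 + kron (1\<^sub>m n) ((row4 1)\<^sup>T) * K 1 + kron (1\<^sub>m n) ((row4 2)\<^sup>T) * K 2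
     + kron (1\<^sub>m n) ((row4 3)\<^sup>T) * K 3) *\<^sub>v x" using x by simp
  also have "\<dots> = 0\<^sub>v (n * 4)"
  proof -
    have L: "kron (1\<^sub>m n) ((row4 q)\<^sup>T :: 'k mat) \<in> carrier_mat (n * 4) n" for q :: nat by (rule carrier_matI) auto
    have LK: "kron (1\<^sub>m n) ((row4 q)\<^sup>T) * K q \<in> carrier_mat (n * 4) (n * 4)" for q by (rule mult_carrier_mat[OF L K])
    have "(kron (1\<^sub>m n) ((row4 q)\<^sup>T) * K q) *\<^sub>v x = 0\<^sub>v (n * 4)" if "K q *\<^sub>v x = 0\<^sub>v n" for q
      using assoc_mult_mat_vec[OF L K x, of q q] that mult_zero_vec[OF L[of q]] by simp
    then show ?thesis using K0 K1 K2 K3 carrier_matD[OF LK] carrier_vecD[OF x]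
      by (simp add: dim_add_mult_vec del: assoc_mult_mat_vec)
  qed
  finally show "x = 0\<^sub>v (n * 4)" .
qed

end

section \<open>Comparison of the model with an arbitrary projective cover\<close>

lemma hom_free_map:
  assumes H: "H \<in> d4_hom X Y" and X: "d4_module X" and Y: "d4_module Y" and z: "z \<in> carrier_mat (mdim X) n"
  shows "H * free_map X z = free_map Y (H * z)"
proof -
  note Hd = carrier_matD[OF d4_homD(1)[OF H]]
  note d = d4_moduleD(2,3)[OF X] d4_moduleD(2,3)[OF Y] carrier_matD[OF z] Hd
  have Ha: "H * (act X g * w) = act Y g * (H * w)" if "dim_row w = mdim X" for g w
  proof -
    have "H * (act X g * w) = (H * act X g) * w" using that d by (simp add: dim_mult_assoc)
    also have "\<dots> = act Y g * (H * w)" unfolding d4_homD(2)[OF H] using that d by (simp add: dim_mult_assoc)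
    finally show ?thesis .
  qed
  show ?thesis by (simp add: free_map_def dim_mult_distrib mult_kron_row d Ha)
qed

text \<open>For an involution \<open>B\<close> the operator \<open>(1 + \<sigma> B) / 2\<close>
  projects onto the eigenspace for \<sigma>.\<close>

lemma involution_eigenvector:
  fixes B :: "'a::field mat"
  assumes two: "(2::'a) \<noteq> 0" and B: "B \<in> carrier_mat m m" "B * B = 1\<^sub>m m" and \<sigma>: "\<sigma> * \<sigma> = 1" and v: "v \<in> carrier_vec m"
  shows "B *\<^sub>v (inverse 2 \<cdot>\<^sub>v (v + \<sigma> \<cdot>\<^sub>v (B *\<^sub>v v))) = \<sigma> \<cdot>\<^sub>v (inverse 2 \<cdot>\<^sub>v (v + \<sigma> \<cdot>\<^sub>v (B *\<^sub>v v)))"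
proof -
  have Bv: "B *\<^sub>v v \<in> carrier_vec m" by (rule mult_mat_vec_carrier[OF B(1) v])
  have BB: "B *\<^sub>v (B *\<^sub>v v) = v" using assoc_mult_mat_vec[OF B(1,1) v] B(2) v by simp
  have "B *\<^sub>v (inverse 2 \<cdot>\<^sub>v (v + \<sigma> \<cdot>\<^sub>v (B *\<^sub>v v))) = inverse 2 \<cdot>\<^sub>v (B *\<^sub>v v + \<sigma> \<cdot>\<^sub>v v)"
    using v Bv by (simp add: mult_mat_vec[OF B(1)] mult_add_distrib_mat_vec[OF B(1)] BB)
  also have "\<dots> = \<sigma> \<cdot>\<^sub>v (inverse 2 \<cdot>\<^sub>v (v + \<sigma> \<cdot>\<^sub>v (B *\<^sub>v v)))"
  proof (rule eq_vecI)
    fix i assume "i < dim_vec (\<sigma> \<cdot>\<^sub>v (inverse 2 \<cdot>\<^sub>v (v + \<sigma> \<cdot>\<^sub>v (B *\<^sub>v v))))"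
    then have i: "i < m" using B(1) by simp
    have "\<sigma> * (\<sigma> * (B *\<^sub>v v) $ i) = (B *\<^sub>v v) $ i" using \<sigma> by (simp add: mult.assoc[symmetric])
    then show "(inverse 2 \<cdot>\<^sub>v (B *\<^sub>v v + \<sigma> \<cdot>\<^sub>v v)) $ i = (\<sigma> \<cdot>\<^sub>v (inverse 2 \<cdot>\<^sub>v (v + \<sigma> \<cdot>\<^sub>v (B *\<^sub>v v)))) $ i"
      using i v B(1) by (simp add: algebra_simps del: index_mult_mat_vec)
  qed (use v B(1) in auto)
  finally show ?thesis .
qed

lemma projective_cover_proj4:
  fixes P :: "'k::field d4mod"
  assumes two: "(2::'k) \<noteq> 0" and pc: "projective_cover P (V_mod r)"
  obtains G S where "G \<in> d4_hom (proj4 r) P" "S \<in> carrier_mat 4 (mdim P)" "G * S = 1\<^sub>m (mdim P)" "S * G = 1\<^sub>m 4"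
    "d4_module P"
proof -
  let ?\<sigma> = "parity_sign r :: 'k"
  let ?V = "V_mod r :: 'k d4mod"
  let ?P4 = "proj4 r :: 'k d4mod"
  have [simp]: "mdim ?P4 = 4" "mdim ?V = 1" by (simp_all add: proj4_def V_mod_def)
  obtain T where proj: "projective P" and T: "surj_hom P ?V T"
    and ess: "\<And>U. d4_submodule P U \<Longrightarrow> sub_sum U (mat_kernel T) = space P \<Longrightarrow> U = space P"
    using pc by (auto simp: projective_cover_def)
  have P: "d4_module P" using proj by (simp add: projective_def)
  define m where "m = mdim P"
  note Pc = d4_moduleD(1)[OF P, folded m_def]
  have Thom: "T \<in> d4_hom P ?V" using T by (simp add: surj_hom_def)
  have Tc: "T \<in> carrier_mat 1 m" using d4_homD(1)[OF Thom] by (simp add: m_def)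
  have Tb: "T * act P g = ?\<sigma> \<cdot>\<^sub>m T" if "g = Gb \<or> g = Gc" for g
    using that d4_homD(2)[OF Thom, of g] Tc by (auto simp: V_mod_def mult_smult_assoc_mat[of _ 1 1])
  have Tbv: "T *\<^sub>v (act P g *\<^sub>v v) = ?\<sigma> \<cdot>\<^sub>v (T *\<^sub>v v)" if "g = Gb \<or> g = Gc" "v \<in> carrier_vec m" for g v
    using assoc_mult_mat_vec[OF Tc Pc that(2), of g] Tb[OF that(1)] smult_mat_mult_vec[OF Tc that(2)] by simp
  have half: "inverse 2 * x + inverse 2 * x = x" for x :: 'k
  proof -
    have "inverse 2 * x + inverse 2 * x = (inverse 2 * 2) * x" by (simp add: algebra_simps)
    then show ?thesis using two by simp
  qed
  have Tproj: "T *\<^sub>v (inverse 2 \<cdot>\<^sub>v (v + ?\<sigma> \<cdot>\<^sub>v (act P g *\<^sub>v v))) = T *\<^sub>v v"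
    if g: "g = Gb \<or> g = Gc" and v: "v \<in> carrier_vec m" for g v
  proof -
    have gv: "act P g *\<^sub>v v \<in> carrier_vec m" by (rule mult_mat_vec_carrier[OF Pc v])
    have "T *\<^sub>v (inverse 2 \<cdot>\<^sub>v (v + ?\<sigma> \<cdot>\<^sub>v (act P g *\<^sub>v v))) = inverse 2 \<cdot>\<^sub>v (T *\<^sub>v v + ?\<sigma> \<cdot>\<^sub>v (?\<sigma> \<cdot>\<^sub>v (T *\<^sub>v v)))"
      using v gv Tbv[OF g v] by (simp add: mult_mat_vec[OF Tc] mult_add_distrib_mat_vec[OF Tc])
    also have "\<dots> = T *\<^sub>v v"
      using Tc by (intro eq_vecI) (auto simp: distrib_left half two simp del: index_mult_mat_vec)
    finally show ?thesis .
  qed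
  obtain p0 where p0: "p0 \<in> carrier_vec m" "T *\<^sub>v p0 = unit_vec 1 0"
  proof -
    have "unit_vec 1 0 \<in> (\<lambda>v. T *\<^sub>v v) ` carrier_vec m" using T by (simp add: surj_hom_def m_def)
    then show ?thesis using that by auto
  qed
  \<comment> \<open>Averaging with \<open>c\<close> and then with \<open>b\<close> turns the
    preimage into a common eigenvector. The value of \<open>T\<close> is preserved, since
    \<open>V(r)\<close> has exactly this weight, and the second average keeps the
    \<open>c\<close>-eigenvalue because \<open>b\<close> and \<open>c\<close> commute.\<close>
  define p1 where "p1 = inverse 2 \<cdot>\<^sub>v (p0 + ?\<sigma> \<cdot>\<^sub>v (act P Gc *\<^sub>v p0))"
  have p1: "p1 \<in> carrier_vec m" using p0 mult_mat_vec_carrier[OF Pc p0(1)] by (simp add: p1_def)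
  have Cp1: "act P Gc *\<^sub>v p1 = ?\<sigma> \<cdot>\<^sub>v p1"
    unfolding p1_def
    by (rule involution_eigenvector[OF two Pc d4_moduleD(11)[OF P, folded m_def] parity_sign_square p0(1)])
  define p where "p = inverse 2 \<cdot>\<^sub>v (p1 + ?\<sigma> \<cdot>\<^sub>v (act P Gb *\<^sub>v p1))"
  have Bp1: "act P Gb *\<^sub>v p1 \<in> carrier_vec m" by (rule mult_mat_vec_carrier[OF Pc p1])
  have p: "p \<in> carrier_vec m" using p1 Bp1 by (simp add: p_def)
  have Bp: "act P Gb *\<^sub>v p = ?\<sigma> \<cdot>\<^sub>v p"
    unfolding p_def
    by (rule involution_eigenvector[OF two Pc d4_moduleD(10)[OF P, folded m_def] parity_sign_square p1])
  have Cp: "act P Gc *\<^sub>v p = ?\<sigma> \<cdot>\<^sub>v p"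
  proof -
    have "act P Gc *\<^sub>v (act P Gb *\<^sub>v p1) = act P Gb *\<^sub>v (act P Gc *\<^sub>v p1)"
      using assoc_mult_mat_vec[OF Pc Pc p1, of Gc Gb] assoc_mult_mat_vec[OF Pc Pc p1, of Gb Gc] d4_moduleD(8)[OF P] by simp
    also have "\<dots> = ?\<sigma> \<cdot>\<^sub>v (act P Gb *\<^sub>v p1)" unfolding Cp1 by (rule mult_mat_vec[OF Pc p1])
    finally have CB: "act P Gc *\<^sub>v (act P Gb *\<^sub>v p1) = ?\<sigma> \<cdot>\<^sub>v (act P Gb *\<^sub>v p1)" .
    have "act P Gc *\<^sub>v p = inverse 2 \<cdot>\<^sub>v (?\<sigma> \<cdot>\<^sub>v p1 + ?\<sigma> \<cdot>\<^sub>v (?\<sigma> \<cdot>\<^sub>v (act P Gb *\<^sub>v p1)))"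
      unfolding p_def using p1 Bp1
      by (simp add: mult_mat_vec[OF Pc] mult_add_distrib_mat_vec[OF Pc] CB Cp1)
    also have "\<dots> = ?\<sigma> \<cdot>\<^sub>v p"
      unfolding p_def using p1 Pc[of Gb] by (intro eq_vecI) (auto simp: algebra_simps simp del: index_mult_mat_vec)
    finally show ?thesis .
  qed
  have Tp: "T *\<^sub>v p = unit_vec 1 0" unfolding p_def using Tproj[of Gb p1] p1 p0 Tproj[of Gc p0] by (simp add: p1_def)
  define z where "z = mat_of_cols m [p]"
  have zc: "z \<in> carrier_mat (mdim P) 1" by (rule carrier_matI) (simp_all add: z_def m_def)
  have colz: "col z 0 = p" unfolding z_def using p by (subst col_mat_of_cols) auto
  have gz: "act P g * z = ?\<sigma> \<cdot>\<^sub>m z" if "g = Gb \<or> g = Gc" for g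
  proof (rule mat_col_eqI)
    fix j assume "j < dim_col (?\<sigma> \<cdot>\<^sub>m z)"
    then have j: "j = 0" using zc by simp
    have "col (act P g * z) 0 = act P g *\<^sub>v col z 0" by (rule col_mult2[OF d4_moduleD(1)[OF P] zc]) simp
    also have "\<dots> = ?\<sigma> \<cdot>\<^sub>v col z 0" using that Bp Cp colz by auto
    also have "\<dots> = col (?\<sigma> \<cdot>\<^sub>m z) 0" using zc by simp
    finally show "col (act P g * z) j = col (?\<sigma> \<cdot>\<^sub>m z) j" using j by simp
  qed (use zc d4_moduleD(2)[OF P] in auto)
  have Bz: "act P Gb * z = ?\<sigma> \<cdot>\<^sub>m z" and Cz: "act P Gc * z = ?\<sigma> \<cdot>\<^sub>m z" using gz by auto
  define G where "G = free_map P z"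
  have c1: "copies 1 ?P4 = ?P4"
    by (rule d4mod.equality) (auto simp: act_copies[OF d4_module_proj4] kron_one_left simp del: One_nat_def)
  have Ghom: "G \<in> d4_hom ?P4 P" using free_map_hom[OF P zc Bz Cz] c1 by (simp add: G_def)
  have Gc: "G \<in> carrier_mat m 4" using d4_homD(1)[OF Ghom] by (simp add: m_def)
  have Ge0: "G *\<^sub>v unit_vec 4 0 = p"
  proof -
    have "G *\<^sub>v unit_vec 4 0 = col G 0" by (rule mult_mat_unit_vec[OF Gc]) simp
    also have "\<dots> = p"
    proof (rule eq_vecI)
      fix i assume "i < dim_vec p"
      then have i: "i < m" using p by simp
      have "G $$ (i, 0) = z $$ (i, 0)"
        using i zc d4_moduleD(2)[OF P]
        by (simp add: G_def free_map_def index_kron row4_def m_def del: index_mult_mat(1))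
      also have "\<dots> = p $ i" using i p by (simp add: z_def mat_of_cols_index)
      finally show "col G 0 $ i = p $ i" using i Gc by simp
    qed (use Gc p in auto)
    finally show ?thesis .
  qed
  have sub: "d4_submodule P (rng G)"
    unfolding d4_submodule_def
  proof (intro conjI)
    have s: "subsp m (rng G)" by (rule subsp_rng[OF Gc])
    then show "rng G \<subseteq> space P" "0\<^sub>v (mdim P) \<in> rng G" "\<forall>u\<in>rng G. \<forall>w\<in>rng G. u + w \<in> rng G"
      "\<forall>c. \<forall>u\<in>rng G. c \<cdot>\<^sub>v u \<in> rng G" by (auto simp: subsp_def m_def)
    show "\<forall>g. \<forall>u\<in>rng G. act P g *\<^sub>v u \<in> rng G"
    proof (intro allI ballI)
      fix g u assume "u \<in> rng G"
      then obtain x where x: "x \<in> carrier_vec 4" "u = G *\<^sub>v x" using Gc by (rule rngE)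
      have c4: "act ?P4 g \<in> carrier_mat 4 4" using d4_moduleD(1)[OF d4_module_proj4[of r]] by (simp add: proj4_def)
      have "act P g *\<^sub>v u = G *\<^sub>v (act ?P4 g *\<^sub>v x)"
        using assoc_mult_mat_vec[OF Pc Gc x(1), of g] assoc_mult_mat_vec[OF Gc c4 x(1)] d4_homD(2)[OF Ghom, of g] x(2) by simp
      then show "act P g *\<^sub>v u \<in> rng G" using rngI[OF Gc mult_mat_vec_carrier[OF c4 x(1)]] by simp
    qed
  qed
  \<comment> \<open>\<open>T p\<close> spans the one-dimensional \<open>V(r)\<close>, so subtracting
    a multiple of \<open>p\<close> moves any vector into the kernel of \<open>T\<close>.\<close>
  have "sub_sum (rng G) (mat_kernel T) = space P"
  proof (intro equalityI subsetI)
    fix v assume "v \<in> sub_sum (rng G) (mat_kernel T)"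
    then show "v \<in> space P"
      using subsp_closed(4)[OF subsp_rng[OF Gc]] Tc by (auto simp: sub_sum_def mat_kernel_def m_def)
  next
    fix v assume "v \<in> space P"
    then have v: "v \<in> carrier_vec m" by (simp add: m_def)
    let ?t = "(T *\<^sub>v v) $ 0"
    have tp: "?t \<cdot>\<^sub>v p \<in> carrier_vec m" using p by simp
    have "T *\<^sub>v (v - ?t \<cdot>\<^sub>v p) = T *\<^sub>v v - ?t \<cdot>\<^sub>v unit_vec 1 0"
      using mult_minus_distrib_mat_vec[OF Tc v tp] mult_mat_vec[OF Tc p, of ?t] Tp by simp
    also have "\<dots> = 0\<^sub>v 1" using Tc by (intro eq_vecI) (auto simp del: index_mult_mat_vec)
    finally have "v - ?t \<cdot>\<^sub>v p \<in> mat_kernel T" using v tp Tc by (simp add: mat_kernel_def)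
    moreover have "?t \<cdot>\<^sub>v p \<in> rng G"
      using subsp_closed(2)[OF subsp_rng[OF Gc]] rngI[OF Gc, of "unit_vec 4 0"] Ge0 by simp
    moreover have "v = ?t \<cdot>\<^sub>v p + (v - ?t \<cdot>\<^sub>v p)" by (rule vec_diff_add[OF v tp])
    ultimately show "v \<in> sub_sum (rng G) (mat_kernel T)" unfolding sub_sum_def by blast
  qed
  then have rngG: "rng G = carrier_vec m" using ess[OF sub] by (simp add: m_def)
  have r4c: "row4 0 \<in> carrier_mat 1 4" by (rule carrier_matI) simp_all
  have row0x: "row4 0 *\<^sub>v x = x $ 0 \<cdot>\<^sub>v (unit_vec 1 0 :: 'k vec)" if "x \<in> carrier_vec 4" for x
    using that by (intro eq_vecI) (auto simp: row4_def scalar_prod_def sum_upto_4)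
  \<comment> \<open>The coordinate at \<open>p\<close> is the projection of the model onto its
    top.\<close>
  have T0: "surj_hom ?P4 ?V (row4 0)"
    unfolding surj_hom_def
  proof
    have "row4 0 * act ?P4 g = act ?V g * row4 0" for g
      using row4_proj4(9)[of g r, where 'k = 'k] row4_proj4(1,5)[of r, where 'k = 'k]
      by (cases g) (simp_all add: V_mod_def dim_mult_smult dim_mult_one_zero)
    then show "row4 0 \<in> d4_hom ?P4 ?V" using r4c by (simp add: d4_hom_def)
    show "(*\<^sub>v) (row4 0) ` space ?P4 = space ?V"
    proof (intro equalityI subsetI)
      fix v assume v: "v \<in> space ?V"
      have "v = row4 0 *\<^sub>v (v $ 0 \<cdot>\<^sub>v unit_vec 4 0)"
        using v row0x[of "v $ 0 \<cdot>\<^sub>v unit_vec 4 0"] by (intro eq_vecI) auto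
      then show "v \<in> (*\<^sub>v) (row4 0) ` space ?P4" by (intro image_eqI) auto
    qed (use mult_mat_vec_carrier[OF r4c] in auto)
  qed
  have Vmod: "d4_module ?V"
    unfolding d4_module_def Let_def
    by (auto simp: V_mod_def mat_simps uminus_mat_smult intro!: eq_matI)
  obtain H where H: "H \<in> d4_hom P ?P4" "row4 0 * H = T"
    using proj T0 Vmod Thom d4_module_proj4[of r, where 'k = 'k] unfolding projective_def by blast
  have Hc: "H \<in> carrier_mat 4 m" using d4_homD(1)[OF H(1)] by (simp add: m_def)
  define x where "x = H *\<^sub>v p"
  have x: "x \<in> carrier_vec 4" using Hc p by (simp add: x_def)
  have x0: "x $ 0 = 1"
  proof -
    have "row4 0 *\<^sub>v x = unit_vec 1 0" using assoc_mult_mat_vec[OF r4c Hc p] H(2) Tp by (simp add: x_def)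
    then have "(x $ 0 \<cdot>\<^sub>v (unit_vec 1 0 :: 'k vec)) $ 0 = (unit_vec 1 0 :: 'k vec) $ 0" using row0x[OF x] by simp
    then show ?thesis by simp
  qed
  have Hz: "H * z \<in> carrier_mat (mdim ?P4) 1" using Hc zc by (simp add: m_def)
  have Hgz: "act ?P4 g * (H * z) = ?\<sigma> \<cdot>\<^sub>m (H * z)" if "g = Gb \<or> g = Gc" for g
  proof -
    note dd = carrier_matD[OF Hc] carrier_matD[OF zc, folded m_def] carrier_matD[OF Pc] d4_moduleD(2,3)[OF d4_module_proj4[of r, where 'k = 'k]]
    have "act ?P4 g * (H * z) = (act ?P4 g * H) * z" using dd by (simp add: dim_mult_assoc)
    also have "\<dots> = H * (act P g * z)" unfolding d4_homD(2)[OF H(1), symmetric] using dd by (simp add: dim_mult_assoc)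
    also have "\<dots> = ?\<sigma> \<cdot>\<^sub>m (H * z)" unfolding gz[OF that] using dd by (simp add: dim_mult_smult)
    finally show ?thesis .
  qed
  \<comment> \<open>The coordinate of \<open>ad (H p)\<close> at \<open>adp\<close> equals the top
    coordinate of \<open>H p\<close>, which is 1.\<close>
  have inj4: "inj_mat (act ?P4 Ga * (act ?P4 Gd * (H * z)))" (is "inj_mat ?w")
  proof (rule inj_matI)
    show w: "?w \<in> carrier_mat 4 1"
      using act_mult_carrier[OF d4_module_proj4 act_mult_carrier[OF d4_module_proj4 Hz]] by simp
    fix y :: "'k vec" assume y: "y \<in> carrier_vec 1" "?w *\<^sub>v y = 0\<^sub>v 4"
    have "(H * z) $$ (0, 0) = 1"
    proof -
      have "(H * z) $$ (0, 0) = col (H * z) 0 $ 0"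
        by (rule index_col[symmetric]) (use Hc zc in auto)
      also have "col (H * z) 0 = x" using col_mult2[OF Hc zc[folded m_def], of 0] colz by (simp add: x_def)
      finally show ?thesis using x0 by simp
    qed
    then have "?w $$ (3, 0) = 1"
      using proj4_entries(1)[of "act ?P4 Gd * (H * z)" 1 0 r] proj4_entries(2)[of "H * z" 1 0 r]
        act_mult_carrier[OF d4_module_proj4 Hz] Hz by simp
    moreover have "(?w *\<^sub>v y) $ 3 = 0" using y by simp
    moreover have "(W *\<^sub>v y) $ 3 = W $$ (3, 0) * y $ 0" if "W \<in> carrier_mat 4 1" for W
      using that y(1) by (simp add: scalar_prod_def)
    from this[OF w] have "(?w *\<^sub>v y) $ 3 = ?w $$ (3, 0) * y $ 0" .
    ultimately show "y = 0\<^sub>v 1" using y(1) by (intro eq_vecI) auto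
  qed
  have HG: "H * G = free_map ?P4 (H * z)" unfolding G_def by (rule hom_free_map[OF H(1) P d4_module_proj4 zc])
  have injHG: "inj_mat (H * G)"
    unfolding HG using free_map_inj[OF d4_module_proj4 Hz Hgz Hgz inj4] by simp
  have injG: "inj_mat G"
  proof (rule inj_matI[OF Gc])
    fix y assume y: "y \<in> carrier_vec 4" "G *\<^sub>v y = 0\<^sub>v m"
    then have "(H * G) *\<^sub>v y = 0\<^sub>v 4" using assoc_mult_mat_vec[OF Hc Gc y(1)] Hc by simp
    then show "y = 0\<^sub>v 4" using inj_matD[OF injHG mult_carrier_mat[OF Hc Gc] y(1)] by simp
  qed
  have m4: "m = 4" using rng_carrier_square[OF Gc injG rngG] by simp
  obtain S where S: "S \<in> carrier_mat 4 4" "S * G = 1\<^sub>m 4" "G * S = 1\<^sub>m 4"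
    using inj_mat_square[OF Gc[unfolded m4] injG] .
  show ?thesis by (rule that[OF Ghom _ _ S(2) P]) (use S m4 in \<open>simp_all add: m_def\<close>)
qed

subsection \<open>Socle and length\<close>

lemma act_vec_carrier:
  assumes "d4_module M" "v \<in> space M"
  shows "act M g *\<^sub>v v \<in> space M"
  by (rule mult_mat_vec_carrier[OF d4_moduleD(1)[OF assms(1)] assms(2)])

lemma act_vec_linear:
  assumes M: "d4_module M" and v: "v \<in> space M"
  shows "w \<in> space M \<Longrightarrow> act M g *\<^sub>v (v + w) = act M g *\<^sub>v v + act M g *\<^sub>v w"
    "w \<in> space M \<Longrightarrow> act M g *\<^sub>v (v - w) = act M g *\<^sub>v v - act M g *\<^sub>v w"
    "act M g *\<^sub>v (c \<cdot>\<^sub>v v) = c \<cdot>\<^sub>v (act M g *\<^sub>v v)"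
  using mult_add_distrib_mat_vec[OF d4_moduleD(1)[OF M] v] mult_minus_distrib_mat_vec[OF d4_moduleD(1)[OF M] v]
    mult_mat_vec[OF d4_moduleD(1)[OF M] v] by auto

lemma act_zero_vec:
  assumes "d4_module M"
  shows "act M g *\<^sub>v 0\<^sub>v (mdim M) = 0\<^sub>v (mdim M)"
  by (rule mult_zero_vec[OF d4_moduleD(1)[OF assms]])

lemma d4_module_vec_relations:
  assumes M: "d4_module M" and v: "v \<in> space M"
  shows "act M Gb *\<^sub>v (act M Ga *\<^sub>v v) = (- 1) \<cdot>\<^sub>v (act M Ga *\<^sub>v (act M Gb *\<^sub>v v))"
    "act M Gb *\<^sub>v (act M Gd *\<^sub>v v) = (- 1) \<cdot>\<^sub>v (act M Gd *\<^sub>v (act M Gb *\<^sub>v v))"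
    "act M Gc *\<^sub>v (act M Ga *\<^sub>v v) = (- 1) \<cdot>\<^sub>v (act M Ga *\<^sub>v (act M Gc *\<^sub>v v))"
    "act M Gc *\<^sub>v (act M Gd *\<^sub>v v) = (- 1) \<cdot>\<^sub>v (act M Gd *\<^sub>v (act M Gc *\<^sub>v v))"
    "act M Gc *\<^sub>v (act M Gb *\<^sub>v v) = act M Gb *\<^sub>v (act M Gc *\<^sub>v v)"
    "act M Ga *\<^sub>v (act M Ga *\<^sub>v v) = 0\<^sub>v (mdim M)" "act M Gb *\<^sub>v (act M Gb *\<^sub>v v) = v"
    "act M Gc *\<^sub>v (act M Gc *\<^sub>v v) = v" "act M Gd *\<^sub>v (act M Gd *\<^sub>v v) = 0\<^sub>v (mdim M)"
    "act M Gb = act M Gc \<Longrightarrow> act M Gd *\<^sub>v (act M Ga *\<^sub>v v) = (- 1) \<cdot>\<^sub>v (act M Ga *\<^sub>v (act M Gd *\<^sub>v v))"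
proof -
  note c = d4_moduleD(1)[OF M] and r = d4_module_normal_form[OF M]
  have as: "act M g *\<^sub>v (act M h *\<^sub>v v) = (act M g * act M h) *\<^sub>v v" for g h
    by (rule assoc_mult_mat_vec[OF c c v, symmetric])
  have sm: "((- 1) \<cdot>\<^sub>m (act M g * act M h)) *\<^sub>v v = (- 1) \<cdot>\<^sub>v ((act M g * act M h) *\<^sub>v v)" for g h
    by (rule smult_mat_mult_vec[OF mult_carrier_mat[OF c c] v])
  have bd: "act M Gb * act M Gd = (- 1) \<cdot>\<^sub>m (act M Gd * act M Gb)" and cd: "act M Gc * act M Gd = (- 1) \<cdot>\<^sub>m (act M Gd * act M Gc)"
    unfolding r by (simp_all add: smult_smult_mat one_smult_mat)
  show "act M Gb *\<^sub>v (act M Ga *\<^sub>v v) = (- 1) \<cdot>\<^sub>v (act M Ga *\<^sub>v (act M Gb *\<^sub>v v))"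
    "act M Gb *\<^sub>v (act M Gd *\<^sub>v v) = (- 1) \<cdot>\<^sub>v (act M Gd *\<^sub>v (act M Gb *\<^sub>v v))"
    "act M Gc *\<^sub>v (act M Ga *\<^sub>v v) = (- 1) \<cdot>\<^sub>v (act M Ga *\<^sub>v (act M Gc *\<^sub>v v))"
    "act M Gc *\<^sub>v (act M Gd *\<^sub>v v) = (- 1) \<cdot>\<^sub>v (act M Gd *\<^sub>v (act M Gc *\<^sub>v v))"
    unfolding as sm[symmetric] by (simp_all only: r(1,3) bd cd)
  show "act M Gc *\<^sub>v (act M Gb *\<^sub>v v) = act M Gb *\<^sub>v (act M Gc *\<^sub>v v)"
    "act M Ga *\<^sub>v (act M Ga *\<^sub>v v) = 0\<^sub>v (mdim M)" "act M Gb *\<^sub>v (act M Gb *\<^sub>v v) = v"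
    "act M Gc *\<^sub>v (act M Gc *\<^sub>v v) = v" "act M Gd *\<^sub>v (act M Gd *\<^sub>v v) = 0\<^sub>v (mdim M)"
    unfolding as r using v by (simp_all add: zero_mat_mult_vec)
  assume bc: "act M Gb = act M Gc"
  have "act M Gd * act M Ga = (- 1) \<cdot>\<^sub>m (act M Ga * act M Gd)"
    unfolding r(10) bc r(8) using d4_moduleD(2,3)[OF M] by (intro eq_matI) (auto simp del: index_mult_mat(1))
  then show "act M Gd *\<^sub>v (act M Ga *\<^sub>v v) = (- 1) \<cdot>\<^sub>v (act M Ga *\<^sub>v (act M Gd *\<^sub>v v))"
    unfolding as sm[symmetric] by simp
qed

lemma d4_submodule_iff:
  "d4_submodule M U \<longleftrightarrow> subsp (mdim M) U \<and> (\<forall>g. \<forall>u\<in>U. act M g *\<^sub>v u \<in> U)"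
  by (auto simp: d4_submodule_def subsp_def)

lemma d4_submodule_subsp: "d4_submodule M U \<Longrightarrow> subsp (mdim M) U"
  by (simp add: d4_submodule_iff)

lemma d4_submodule_act: "d4_submodule M U \<Longrightarrow> u \<in> U \<Longrightarrow> act M g *\<^sub>v u \<in> U"
  by (simp add: d4_submodule_iff)

lemma zero_submodule: "d4_module M \<Longrightarrow> d4_submodule M (zero_sub M)"
  by (auto simp: d4_submodule_iff subsp_def act_zero_vec)

lemma subsp_sub_sum:
  assumes U: "subsp n U" and W: "subsp n W"
  shows "subsp n (sub_sum U W)"
  unfolding subsp_def
proof (intro conjI ballI allI)
  note u = subsp_closed[OF U] and w = subsp_closed[OF W]
  show "sub_sum U W \<subseteq> carrier_vec n" using u(4) w(4) by (auto simp: sub_sum_def)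
  show "0\<^sub>v n \<in> sub_sum U W" unfolding sub_sum_def using u(3) w(3) by force
  fix x assume "x \<in> sub_sum U W"
  then obtain x1 x2 where x: "x = x1 + x2" "x1 \<in> U" "x2 \<in> W" by (auto simp: sub_sum_def)
  then have xc: "x1 \<in> carrier_vec n" "x2 \<in> carrier_vec n" using u(4) w(4) by auto
  show "c \<cdot>\<^sub>v x \<in> sub_sum U W" for c
    unfolding x(1) smult_add_distrib_vec[OF xc] sub_sum_def using u(2)[OF x(2)] w(2)[OF x(3)] by blast
  fix y assume "y \<in> sub_sum U W"
  then obtain y1 y2 where y: "y = y1 + y2" "y1 \<in> U" "y2 \<in> W" by (auto simp: sub_sum_def)
  then have yc: "y1 \<in> carrier_vec n" "y2 \<in> carrier_vec n" using u(4) w(4) by auto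
  have "x + y = (x1 + y1) + (x2 + y2)" unfolding x(1) y(1) using xc yc by (intro eq_vecI) auto
  then show "x + y \<in> sub_sum U W" unfolding sub_sum_def using u(1)[OF x(2) y(2)] w(1)[OF x(3) y(3)] by blast
qed

lemma sub_sum_memI: "u \<in> U \<Longrightarrow> w \<in> W \<Longrightarrow> u + w \<in> sub_sum U W"
  by (auto simp: sub_sum_def)

lemma d4_submodule_sub_sum:
  assumes M: "d4_module M" and U: "subsp (mdim M) U" and W: "subsp (mdim M) W"
    and "\<And>g u. u \<in> U \<Longrightarrow> act M g *\<^sub>v u \<in> sub_sum U W" "\<And>g w. w \<in> W \<Longrightarrow> act M g *\<^sub>v w \<in> sub_sum U W"
  shows "d4_submodule M (sub_sum U W)"
  unfolding d4_submodule_iff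
proof (intro conjI allI ballI)
  show s: "subsp (mdim M) (sub_sum U W)" by (rule subsp_sub_sum[OF U W])
  fix g x assume "x \<in> sub_sum U W"
  then obtain u w where x: "x = u + w" "u \<in> U" "w \<in> W" by (auto simp: sub_sum_def)
  then have "u \<in> space M" "w \<in> space M" using subsp_closed(4)[OF U] subsp_closed(4)[OF W] by auto
  then have "act M g *\<^sub>v x = act M g *\<^sub>v u + act M g *\<^sub>v w" unfolding x(1) by (rule act_vec_linear[OF M])
  then show "act M g *\<^sub>v x \<in> sub_sum U W" using subsp_closed(1)[OF s] assms(4,5) x by simp
qed

section \<open>Weight spaces and the common kernel of \<open>a\<close> and \<open>d\<close>\<close>

definition eig :: "'k::field d4mod \<Rightarrow> 'k \<Rightarrow> 'k vec set" where
  "eig M \<tau> = {v \<in> space M. act M Gb *\<^sub>v v = \<tau> \<cdot>\<^sub>v v}"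

text \<open>For \<tau> with square 1 this is the projection onto \<open>eig M \<tau>\<close> along
  \<open>eig M (- \<tau>)\<close>.\<close>

definition eig_part :: "'k::field d4mod \<Rightarrow> 'k \<Rightarrow> 'k vec \<Rightarrow> 'k vec" where
  "eig_part M \<tau> v = inverse 2 \<cdot>\<^sub>v (v + \<tau> \<cdot>\<^sub>v (act M Gb *\<^sub>v v))"

definition ann :: "'k::field d4mod \<Rightarrow> 'k vec set" where
  "ann M = {v \<in> space M. act M Ga *\<^sub>v v = 0\<^sub>v (mdim M) \<and> act M Gd *\<^sub>v v = 0\<^sub>v (mdim M)}"

lemma subsp_eig:
  assumes M: "d4_module M"
  shows "subsp (mdim M) (eig M \<tau>)"
  unfolding subsp_def
proof (intro conjI ballI allI)
  fix u w assume "u \<in> eig M \<tau>" "w \<in> eig M \<tau>"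
  then show "u + w \<in> eig M \<tau>" unfolding eig_def using act_vec_linear(1)[OF M, of u w Gb]
    by (auto simp: smult_add_distrib_vec[of _ "mdim M"])
next
  fix u c assume "u \<in> eig M \<tau>"
  then show "c \<cdot>\<^sub>v u \<in> eig M \<tau>" unfolding eig_def using act_vec_linear(3)[OF M, of u Gb c]
    by (auto simp: smult_smult_assoc mult.commute)
qed (auto simp: eig_def act_zero_vec[OF M])

lemma subsp_ann:
  assumes M: "d4_module M"
  shows "subsp (mdim M) (ann M)"
  unfolding subsp_def
proof (intro conjI ballI allI)
  fix u w assume "u \<in> ann M" "w \<in> ann M"
  then show "u + w \<in> ann M" unfolding ann_def using act_vec_linear(1)[OF M, of u w] by auto
next
  fix u c assume "u \<in> ann M"
  then show "c \<cdot>\<^sub>v u \<in> ann M" unfolding ann_def using act_vec_linear(3)[OF M, of u] by auto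
qed (auto simp: ann_def act_zero_vec[OF M])

text \<open>\<open>b\<close> and \<open>c\<close> anticommute with \<open>a\<close> and
  \<open>d\<close>, so they preserve the common kernel.\<close>

lemma ann_submodule:
  assumes M: "d4_module M"
  shows "d4_submodule M (ann M)"
  unfolding d4_submodule_iff
proof (intro conjI allI ballI)
  show "subsp (mdim M) (ann M)" by (rule subsp_ann[OF M])
  fix g u assume u: "u \<in> ann M"
  then have uc: "u \<in> space M" and au: "act M Ga *\<^sub>v u = 0\<^sub>v (mdim M)" and du: "act M Gd *\<^sub>v u = 0\<^sub>v (mdim M)"
    by (auto simp: ann_def)
  note R = d4_module_vec_relations[OF M uc]
  have neg: "x = 0\<^sub>v (mdim M)" if "0\<^sub>v (mdim M) = (- 1) \<cdot>\<^sub>v x" "x \<in> space M" for x :: "'a vec"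
  proof (rule eq_vecI)
    fix i assume "i < dim_vec (0\<^sub>v (mdim M) :: 'a vec)"
    then show "x $ i = 0\<^sub>v (mdim M) $ i" using arg_cong[OF that(1), of "\<lambda>v. v $ i"] that(2) by simp
  qed (use that in auto)
  have "act M Ga *\<^sub>v (act M g *\<^sub>v u) = 0\<^sub>v (mdim M) \<and> act M Gd *\<^sub>v (act M g *\<^sub>v u) = 0\<^sub>v (mdim M)"
  proof (cases g)
    case Gb
    have "0\<^sub>v (mdim M) = (- 1) \<cdot>\<^sub>v (act M Ga *\<^sub>v (act M Gb *\<^sub>v u))" "0\<^sub>v (mdim M) = (- 1) \<cdot>\<^sub>v (act M Gd *\<^sub>v (act M Gb *\<^sub>v u))"
      by (rule R(1)[unfolded au act_zero_vec[OF M]], rule R(2)[unfolded du act_zero_vec[OF M]])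
    then have "act M Ga *\<^sub>v (act M Gb *\<^sub>v u) = 0\<^sub>v (mdim M)" "act M Gd *\<^sub>v (act M Gb *\<^sub>v u) = 0\<^sub>v (mdim M)"
      using neg[OF _ act_vec_carrier[OF M act_vec_carrier[OF M uc]]] by blast+
    then show ?thesis using Gb by simp
  next
    case Gc
    have "0\<^sub>v (mdim M) = (- 1) \<cdot>\<^sub>v (act M Ga *\<^sub>v (act M Gc *\<^sub>v u))" "0\<^sub>v (mdim M) = (- 1) \<cdot>\<^sub>v (act M Gd *\<^sub>v (act M Gc *\<^sub>v u))"
      by (rule R(3)[unfolded au act_zero_vec[OF M]], rule R(4)[unfolded du act_zero_vec[OF M]])
    then have "act M Ga *\<^sub>v (act M Gc *\<^sub>v u) = 0\<^sub>v (mdim M)" "act M Gd *\<^sub>v (act M Gc *\<^sub>v u) = 0\<^sub>v (mdim M)"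
      using neg[OF _ act_vec_carrier[OF M act_vec_carrier[OF M uc]]] by blast+
    then show ?thesis using Gc by simp
  qed (use au du act_zero_vec[OF M] in auto)
  then show "act M g *\<^sub>v u \<in> ann M" unfolding ann_def using act_vec_carrier[OF M uc] by simp
qed

context
  fixes M :: "'k::field d4mod"
  assumes two: "(2::'k) \<noteq> 0" and M: "d4_module M"
begin

lemma half_sum: "inverse 2 * x + inverse 2 * x = (x :: 'k)"
proof -
  have "inverse 2 * x + inverse 2 * x = (inverse 2 * 2) * x" by (simp add: algebra_simps)
  then show ?thesis using two by simp
qed

lemma eig_part_carrier: "v \<in> space M \<Longrightarrow> eig_part M \<tau> v \<in> space M"
  unfolding eig_part_def using act_vec_carrier[OF M] by simp

lemma eig_part_eig: "v \<in> space M \<Longrightarrow> \<tau> * \<tau> = 1 \<Longrightarrow> eig_part M \<tau> v \<in> eig M \<tau>"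
  unfolding eig_def
  using involution_eigenvector[OF two d4_moduleD(1,10)[OF M], of \<tau> v] eig_part_carrier[of v \<tau>]
  by (simp add: eig_part_def)

lemma eig_part_sum:
  assumes v: "v \<in> space M"
  shows "v = eig_part M \<tau> v + eig_part M (- \<tau>) v"
proof (rule eq_vecI)
  fix i assume "i < dim_vec (eig_part M \<tau> v + eig_part M (- \<tau>) v)"
  then have i: "i < mdim M" using eig_part_carrier[OF v, of "- \<tau>"] by simp
  have "act M Gb *\<^sub>v v \<in> space M" by (rule act_vec_carrier[OF M v])
  then show "v $ i = (eig_part M \<tau> v + eig_part M (- \<tau>) v) $ i"
    using i v d4_moduleD(2)[OF M]
    by (simp add: eig_part_def algebra_simps half_sum two del: index_mult_mat_vec)
qed (use v eig_part_carrier[OF v, of "- \<tau>"] in simp)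

lemma eig_disjoint:
  assumes "v \<in> eig M \<tau>" "v \<in> eig M (- \<tau>)" "\<tau> * \<tau> = 1"
  shows "v = 0\<^sub>v (mdim M)"
proof (rule eq_vecI)
  fix i assume "i < dim_vec (0\<^sub>v (mdim M) :: 'k vec)"
  then have i: "i < mdim M" by simp
  have vc: "v \<in> space M" using assms(1) by (simp add: eig_def)
  have e: "\<tau> \<cdot>\<^sub>v v = (- \<tau>) \<cdot>\<^sub>v v" using assms by (auto simp: eig_def)
  have "\<tau> * v $ i = - \<tau> * v $ i"
    using arg_cong[OF e, of "\<lambda>v. v $ i"] i vc by simp
  then have "2 * (\<tau> * v $ i) = 0" by (simp add: algebra_simps)
  then have "\<tau> * v $ i = 0" using two by simp
  moreover have "\<tau> \<noteq> 0" using assms(3) by auto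
  ultimately have "v $ i = 0" by (simp only: mult_eq_0_iff simp_thms)
  then show "v $ i = 0\<^sub>v (mdim M) $ i" using i by simp
qed (use assms in \<open>auto simp: eig_def\<close>)

lemma eig_part_submodule:
  assumes U: "d4_submodule M U" and v: "v \<in> U"
  shows "eig_part M \<tau> v \<in> U"
  unfolding eig_part_def
  by (intro subsp_closed(1,2)[OF d4_submodule_subsp[OF U]] d4_submodule_act[OF U] v)

lemma eig_swap:
  assumes v: "v \<in> eig M \<tau>" and g: "g = Ga \<or> g = Gd"
  shows "act M g *\<^sub>v v \<in> eig M (- \<tau>)"
proof -
  have vc: "v \<in> space M" and bv: "act M Gb *\<^sub>v v = \<tau> \<cdot>\<^sub>v v" using v by (auto simp: eig_def)
  have "act M Gb *\<^sub>v (act M g *\<^sub>v v) = (- 1) \<cdot>\<^sub>v (act M g *\<^sub>v (\<tau> \<cdot>\<^sub>v v))"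
    using g d4_module_vec_relations(1,2)[OF M vc] bv by auto
  also have "\<dots> = (- \<tau>) \<cdot>\<^sub>v (act M g *\<^sub>v v)"
    unfolding act_vec_linear(3)[OF M vc] by (simp add: smult_smult_assoc)
  finally show ?thesis using act_vec_carrier[OF M vc] by (simp add: eig_def)
qed

section \<open>Modules on which \<open>b\<close> and \<open>c\<close> coincide: socle, length and
  dimension\<close>

context
  assumes bc: "act M Gb = act M Gc"
begin

text \<open>For \<open>b = c\<close> the square-zero operators \<open>a\<close> and \<open>d\<close>
  anticommute. A vector of \<open>U'\<close> outside \<open>U\<close> is replaced by its image under
  \<open>a\<close> if that image is still outside \<open>U\<close>, then likewise for
  \<open>d\<close>; afterwards both images lie in \<open>U\<close>. One of its two weight components
  is outside \<open>U\<close>. So every nonzero quotient of submodules contains a one-dimensional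
  one.\<close>

lemma relative_socle_vector:
  assumes U: "d4_submodule M U" and U': "d4_submodule M U'" and UU: "U \<subset> U'"
  obtains x \<tau> where "x \<in> U'" "x \<notin> U" "act M Ga *\<^sub>v x \<in> U" "act M Gd *\<^sub>v x \<in> U" "\<tau> * \<tau> = 1" "x \<in> eig M \<tau>"
proof -
  note s = subsp_closed[OF d4_submodule_subsp[OF U]] and s' = subsp_closed[OF d4_submodule_subsp[OF U']]
  note act = d4_submodule_act[OF U] and act' = d4_submodule_act[OF U']
  obtain u where u: "u \<in> U'" "u \<notin> U" using UU by blast
  obtain u1 where u1: "u1 \<in> U'" "u1 \<notin> U" "act M Ga *\<^sub>v u1 \<in> U"
  proof (cases "act M Ga *\<^sub>v u \<in> U")
    case True
    then show ?thesis using that u by blast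
  next
    case False
    then show ?thesis
      using that[of "act M Ga *\<^sub>v u"] u act' s(3) d4_module_vec_relations(6)[OF M s'(4)[OF u(1)]] by simp
  qed
  obtain u2 where u2: "u2 \<in> U'" "u2 \<notin> U" "act M Ga *\<^sub>v u2 \<in> U" "act M Gd *\<^sub>v u2 \<in> U"
  proof (cases "act M Gd *\<^sub>v u1 \<in> U")
    case True
    then show ?thesis using that u1 by blast
  next
    case False
    note R = d4_module_vec_relations[OF M s'(4)[OF u1(1)]]
    \<comment> \<open>Replacing \<open>u1\<close> by \<open>d u1\<close> does not spoil the
      condition on \<open>a\<close>: by anticommutation \<open>a d u1\<close> is minus
      \<open>d a u1\<close>, which lies in \<open>U\<close>.\<close>
    have "(- 1) \<cdot>\<^sub>v (act M Ga *\<^sub>v (act M Gd *\<^sub>v u1)) \<in> U" using act[OF u1(3), of Gd] R(10)[OF bc] by simp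
    then have "(- 1) \<cdot>\<^sub>v ((- 1) \<cdot>\<^sub>v (act M Ga *\<^sub>v (act M Gd *\<^sub>v u1))) \<in> U" by (rule s(2))
    then have "act M Ga *\<^sub>v (act M Gd *\<^sub>v u1) \<in> U" by (simp add: smult_smult_assoc)
    then show ?thesis using that[of "act M Gd *\<^sub>v u1"] False u1 act' s(3) R(9) by simp
  qed
  have u2c: "u2 \<in> space M" by (rule s'(4)[OF u2(1)])
  have "eig_part M 1 u2 \<notin> U \<or> eig_part M (- 1) u2 \<notin> U"
    using eig_part_sum[OF u2c, of 1] s(1) u2(2) by metis
  then obtain \<tau> :: 'k where \<tau>: "\<tau> = 1 \<or> \<tau> = - 1" "eig_part M \<tau> u2 \<notin> U" by blast
  have ag: "act M g *\<^sub>v (eig_part M \<tau> u2) \<in> U" if g: "g = Ga \<or> g = Gd" for g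
  proof -
    note R = d4_module_vec_relations[OF M u2c]
    have gu: "act M g *\<^sub>v u2 \<in> U" using g u2 by auto
    have "(- 1) \<cdot>\<^sub>v (act M g *\<^sub>v (act M Gb *\<^sub>v u2)) \<in> U"
      using act[OF gu, of Gb] R(1,2) g by auto
    then have "(- 1) \<cdot>\<^sub>v ((- 1) \<cdot>\<^sub>v (act M g *\<^sub>v (act M Gb *\<^sub>v u2))) \<in> U" by (rule s(2))
    then have gb: "act M g *\<^sub>v (act M Gb *\<^sub>v u2) \<in> U" by (simp add: smult_smult_assoc)
    have bu: "act M Gb *\<^sub>v u2 \<in> space M" by (rule act_vec_carrier[OF M u2c])
    have "act M g *\<^sub>v (eig_part M \<tau> u2) = inverse 2 \<cdot>\<^sub>v (act M g *\<^sub>v u2 + \<tau> \<cdot>\<^sub>v (act M g *\<^sub>v (act M Gb *\<^sub>v u2)))"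
      unfolding eig_part_def using u2c bu by (simp add: act_vec_linear[OF M])
    then show ?thesis using s(1,2) gu gb by simp
  qed
  have "\<tau> * \<tau> = 1" using \<tau> by auto
  show ?thesis
    by (rule that[OF eig_part_submodule[OF U' u2(1)] \<tau>(2)])
      (use ag \<open>\<tau> * \<tau> = 1\<close> eig_part_eig[OF u2c] in auto)
qed

text \<open>All composition factors are one-dimensional, so the term with index \<open>i\<close> of
  a composition series has dimension \<open>i\<close>. This turns the lengths in
  \<open>has_type\<close> into dimensions.\<close>

lemma has_length_imp_mdim:
  assumes "has_length M n"
  shows "mdim M = n"
proof -
  obtain Us where Us: "composition_series M Us" and len: "length Us = Suc n"
    using assms by (auto simp: has_length_def)
  have sub: "d4_submodule M (Us ! i)" if "i \<le> n" for i
    using that Us len by (auto simp: composition_series_def)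
  have "\<exists>Q. Q \<in> carrier_mat (mdim M) i \<and> inj_mat Q \<and> rng Q = Us ! i" if "i \<le> n" for i
    using that
  proof (induction i)
    case 0
    define Z :: "'k mat" where "Z = mat (mdim M) 0 (\<lambda>_. 0)"
    have Z: "Z \<in> carrier_mat (mdim M) 0" by (simp add: Z_def)
    have "Us ! 0 = {0\<^sub>v (mdim M)}" using Us len by (auto simp: composition_series_def hd_conv_nth)
    moreover have "rng Z = {0\<^sub>v (mdim M)}"
    proof
      show "rng Z \<subseteq> {0\<^sub>v (mdim M)}"
        by (auto simp: rng_def Z_def scalar_prod_def intro!: eq_vecI)
      show "{0\<^sub>v (mdim M)} \<subseteq> rng Z" using subsp_closed(3)[OF subsp_rng[OF Z]] by simp
    qed
    moreover have "inj_mat Z" by (rule inj_matI[OF Z]) auto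
    ultimately show ?case using Z by metis
  next
    case (Suc i)
    then obtain Q where Q: "Q \<in> carrier_mat (mdim M) i" "inj_mat Q" "rng Q = Us ! i" by auto
    have i: "i \<le> n" "Suc i \<le> n" using Suc.prems by auto
    have lt: "Us ! i \<subset> Us ! Suc i"
      and max: "\<And>W. d4_submodule M W \<Longrightarrow> Us ! i \<subseteq> W \<Longrightarrow> W \<subseteq> Us ! Suc i \<Longrightarrow> W = Us ! i \<or> W = Us ! Suc i"
      using Us len i by (auto simp: composition_series_def)
    obtain x \<tau> where x: "x \<in> Us ! Suc i" "x \<notin> Us ! i" "act M Ga *\<^sub>v x \<in> Us ! i" "act M Gd *\<^sub>v x \<in> Us ! i" "x \<in> eig M \<tau>"
      using relative_socle_vector[OF sub[OF i(1)] sub[OF i(2)] lt] by metis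
    have xc: "x \<in> carrier_vec (mdim M)" and bx: "act M Gb *\<^sub>v x = \<tau> \<cdot>\<^sub>v x" using x(5) by (auto simp: eig_def)
    note s = subsp_closed[OF d4_submodule_subsp[OF sub[OF i(1)]]]
    let ?R = "snoc_col Q x"
    have R: "?R \<in> carrier_mat (mdim M) (Suc i)" by (rule snoc_col_carrier[OF Q(1)])
    have inj: "inj_mat ?R" using snoc_col_inj[OF Q(1) xc Q(2)] x(2) Q(3) by simp
    define X where "X = {c \<cdot>\<^sub>v x | c. True}"
    have X: "subsp (mdim M) X"
      unfolding subsp_def
    proof (intro conjI ballI allI)
      show "0\<^sub>v (mdim M) \<in> X" unfolding X_def using zero_smult_vec[OF xc] by (metis (mono_tags, lifting) mem_Collect_eq)
      fix u w assume "u \<in> X" "w \<in> X"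
      then show "u + w \<in> X" unfolding X_def using add_smult_distrib_vec[of _ _ x] by (auto simp flip: add_smult_distrib_vec)
    qed (auto simp: X_def xc smult_smult_assoc)
    have xX: "x \<in> X" unfolding X_def by (auto intro: exI[of _ 1])
    have rngR: "rng ?R = sub_sum (Us ! i) X"
    proof (intro equalityI subsetI)
      fix v assume "v \<in> rng ?R"
      then obtain y where y: "y \<in> carrier_vec (Suc i)" "v = ?R *\<^sub>v y" using R by (rule rngE)
      show "v \<in> sub_sum (Us ! i) X"
        unfolding y(2) snoc_col_mult_vec[OF Q(1) xc y(1)]
        by (rule sub_sum_memI) (use rngI[OF Q(1)] Q(3) in \<open>auto simp: X_def\<close>)
    next
      fix v assume "v \<in> sub_sum (Us ! i) X"
      then obtain u c where v: "v = u + c \<cdot>\<^sub>v x" "u \<in> Us ! i" by (auto simp: sub_sum_def X_def)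
      then obtain y where y: "y \<in> carrier_vec i" "u = Q *\<^sub>v y" using Q rngE by blast
      let ?y = "vec (Suc i) (\<lambda>j. if j < i then y $ j else c)"
      have "vec i (($) ?y) = y" using y by (intro eq_vecI) auto
      then have "?R *\<^sub>v ?y = v" using snoc_col_mult_vec[OF Q(1) xc, of ?y] v y by simp
      then show "v \<in> rng ?R" using rngI[OF R, of ?y] by simp
    qed
    have subm: "d4_submodule M (sub_sum (Us ! i) X)"
    proof (rule d4_submodule_sub_sum[OF M d4_submodule_subsp[OF sub[OF i(1)]] X])
      have zX: "0\<^sub>v (mdim M) \<in> X" by (rule subsp_closed(3)[OF X])
      have UX: "u \<in> sub_sum (Us ! i) X" if "u \<in> Us ! i" for u
        using sub_sum_memI[OF that zX] s(4)[OF that] by simp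
      have XX: "w \<in> sub_sum (Us ! i) X" if "w \<in> X" for w
        using sub_sum_memI[OF s(3) that] subsp_closed(4)[OF X that] by simp
      show "act M g *\<^sub>v u \<in> sub_sum (Us ! i) X" if "u \<in> Us ! i" for g u
        by (rule UX[OF d4_submodule_act[OF sub[OF i(1)] that]])
      fix g w assume "w \<in> X"
      then obtain c where c: "w = c \<cdot>\<^sub>v x" by (auto simp: X_def)
      have "act M g *\<^sub>v x \<in> sub_sum (Us ! i) X"
        by (cases g) (use x UX XX bx bc in \<open>auto simp: X_def\<close>)
      then show "act M g *\<^sub>v w \<in> sub_sum (Us ! i) X"
        unfolding c act_vec_linear(3)[OF M xc]
        by (rule subsp_closed(2)[OF subsp_sub_sum[OF d4_submodule_subsp[OF sub[OF i(1)]] X]])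
    qed
    have "Us ! i \<subseteq> sub_sum (Us ! i) X"
      using rngI[OF Q(1)] sub_sum_memI[OF _ subsp_closed(3)[OF X]] s(4) by (metis right_zero_vec subsetI)
    moreover have "sub_sum (Us ! i) X \<subseteq> Us ! Suc i"
      unfolding rngR[symmetric]
      by (rule snoc_col_rng[OF d4_submodule_subsp[OF sub[OF i(2)]] Q(1) _ x(1)]) (use Q(3) lt in auto)
    moreover have "x \<in> sub_sum (Us ! i) X" using sub_sum_memI[OF s(3) xX] xc by simp
    \<comment> \<open>No submodule lies strictly between consecutive terms, so adjoining a single
      weight vector already reaches the next one.\<close>
    ultimately have "sub_sum (Us ! i) X = Us ! Suc i" using max[OF subm] x(2) by blast
    then show ?case using R inj rngR by blast
  qed
  then obtain Q where Q: "Q \<in> carrier_mat (mdim M) n" "inj_mat Q" "rng Q = Us ! n" by blast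
  moreover have "Us ! n = carrier_vec (mdim M)"
    using Us len by (auto simp: composition_series_def last_conv_nth)
  ultimately have "n = mdim M" by (intro rng_carrier_square) simp_all
  then show ?thesis by simp
qed

text \<open>A weight vector in \<open>ann M\<close> spans a simple submodule, and every simple
  submodule contains such a line and therefore is one. So \<open>ann M\<close> contains all simple
  submodules, and each of its elements is the sum of its two weight components, which lie in simple
  lines or vanish.\<close>

lemma soc_eq_ann: "soc M = ann M"
proof
  have line: "simple_sub M {c \<cdot>\<^sub>v x | c. True}"
    if x: "x \<in> ann M" "x \<in> eig M \<tau>" "x \<noteq> 0\<^sub>v (mdim M)" for x \<tau>
  proof -
    have xc: "x \<in> space M" and bx: "act M Gb *\<^sub>v x = \<tau> \<cdot>\<^sub>v x" using x(2) by (auto simp: eig_def)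
    let ?X = "{c \<cdot>\<^sub>v x | c. True}"
    have zX: "0\<^sub>v (mdim M) \<in> ?X" using zero_smult_vec[OF xc] by (metis (mono_tags, lifting) mem_Collect_eq)
    have "d4_submodule M ?X"
      unfolding d4_submodule_def
    proof (intro conjI allI ballI)
      fix g u assume "u \<in> ?X"
      then obtain c where c: "u = c \<cdot>\<^sub>v x" by auto
      have "act M g *\<^sub>v x = 0\<^sub>v (mdim M) \<or> act M g *\<^sub>v x = \<tau> \<cdot>\<^sub>v x"
        using x(1) bx bc by (cases g) (auto simp: ann_def)
      then have "act M g *\<^sub>v u = 0\<^sub>v (mdim M) \<or> act M g *\<^sub>v u = (c * \<tau>) \<cdot>\<^sub>v x"
        unfolding c act_vec_linear(3)[OF M xc] by (auto simp: smult_smult_assoc)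
      then show "act M g *\<^sub>v u \<in> ?X" using zX by auto
    next
      fix u w assume "u \<in> ?X" "w \<in> ?X"
      then show "u + w \<in> ?X" by (auto simp flip: add_smult_distrib_vec)
    qed (use xc zX in \<open>auto simp: smult_smult_assoc\<close>)
    moreover have "x \<in> ?X" by (auto intro: exI[of _ 1])
    then have "?X \<noteq> zero_sub M" using x(3) by blast
    moreover have "U = zero_sub M \<or> U = ?X" if U: "d4_submodule M U" "U \<subseteq> ?X" for U
    proof (cases "U = zero_sub M")
      case False
      note s = subsp_closed[OF d4_submodule_subsp[OF U(1)]]
      obtain u where u: "u \<in> U" "u \<noteq> 0\<^sub>v (mdim M)" using False s(3) by blast
      then obtain c where c: "u = c \<cdot>\<^sub>v x" using U(2) by blast
      then have "c \<noteq> 0" using u(2) zero_smult_vec[OF xc] by metis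
      have "inverse c \<cdot>\<^sub>v u \<in> U" by (rule s(2)[OF u(1)])
      then have "x \<in> U" unfolding c using \<open>c \<noteq> 0\<close> by (simp add: smult_smult_assoc)
      then have "?X \<subseteq> U" using s(2) by blast
      then show ?thesis using U(2) by blast
    qed simp
    ultimately show ?thesis unfolding simple_sub_def by blast
  qed
  show "soc M \<subseteq> ann M"
  proof -
    have "S \<subseteq> ann M" if S: "simple_sub M S" for S
    proof -
      have sub: "d4_submodule M S" and "S \<noteq> zero_sub M" using S by (auto simp: simple_sub_def)
      then have "zero_sub M \<subset> S" using subsp_closed(3)[OF d4_submodule_subsp[OF sub]] by blast
      then obtain x \<tau> where x: "x \<in> S" "x \<notin> zero_sub M" "act M Ga *\<^sub>v x \<in> zero_sub M" "act M Gd *\<^sub>v x \<in> zero_sub M"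
          "x \<in> eig M \<tau>"
        using relative_socle_vector[OF zero_submodule[OF M] sub] by metis
      have xa: "x \<in> ann M" using x by (auto simp: ann_def eig_def)
      have "simple_sub M {c \<cdot>\<^sub>v x | c. True}" by (rule line[OF xa x(5)]) (use x(2) in simp)
      moreover have "{c \<cdot>\<^sub>v x | c. True} \<subseteq> S" using subsp_closed(2)[OF d4_submodule_subsp[OF sub] x(1)] by blast
      ultimately have "S = {c \<cdot>\<^sub>v x | c. True}" using S unfolding simple_sub_def by blast
      then show "S \<subseteq> ann M" using subsp_closed(2)[OF subsp_ann[OF M] xa] by auto
    qed
    then show ?thesis unfolding soc_def using ann_submodule[OF M] by blast
  qed
  show "ann M \<subseteq> soc M"
    unfolding soc_def
  proof (intro subsetI InterI, clarify)
    fix v W assume v: "v \<in> ann M" and W: "d4_submodule M W" and all: "\<forall>S. simple_sub M S \<longrightarrow> S \<subseteq> W"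
    have vc: "v \<in> space M" using v by (simp add: ann_def)
    note s = subsp_closed[OF d4_submodule_subsp[OF W]]
    have "eig_part M \<tau> v \<in> W" if "\<tau> * \<tau> = 1" for \<tau>
    proof (cases "eig_part M \<tau> v = 0\<^sub>v (mdim M)")
      case True
      then show ?thesis using s(3) by simp
    next
      case False
      have "simple_sub M {c \<cdot>\<^sub>v eig_part M \<tau> v | c. True}"
        by (rule line[OF eig_part_submodule[OF ann_submodule[OF M] v] eig_part_eig[OF vc that] False])
      then have "{c \<cdot>\<^sub>v eig_part M \<tau> v | c. True} \<subseteq> W" using all by blast
      moreover have "eig_part M \<tau> v \<in> {c \<cdot>\<^sub>v eig_part M \<tau> v | c. True}" by (auto intro: exI[of _ 1])
      ultimately show ?thesis by blast
    qed
    from this[of 1] this[of "- 1"] show "v \<in> W" using eig_part_sum[OF vc, of 1] s(1) by (metis mult_minus1 minus_minus mult_1)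
  qed
qed

end

end

subsection \<open>The pencil of \<open>M\<^sub>s(r,\<eta>)\<close>\<close>

text \<open>\<open>b\<close> and \<open>c\<close> each anticommute with \<open>a\<close> and with
  \<open>d\<close>, so the two signs cancel.\<close>

lemma bc_central:
  assumes M: "d4_module M" and v: "v \<in> space M"
  shows "act M Gb *\<^sub>v (act M Gc *\<^sub>v (act M g *\<^sub>v v)) = act M g *\<^sub>v (act M Gb *\<^sub>v (act M Gc *\<^sub>v v))"
proof -
  note R = d4_module_vec_relations[OF M]
  have cv: "act M Gc *\<^sub>v v \<in> space M" and gv: "act M g *\<^sub>v v \<in> space M" for g by (intro act_vec_carrier[OF M] v)+
  have anti: "act M Gb *\<^sub>v (act M Gc *\<^sub>v (act M g *\<^sub>v v)) = act M g *\<^sub>v (act M Gb *\<^sub>v (act M Gc *\<^sub>v v))"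
    if g: "g = Ga \<or> g = Gd" for g
  proof -
    have gcv: "act M g *\<^sub>v (act M Gc *\<^sub>v v) \<in> space M" by (rule act_vec_carrier[OF M cv])
    have "act M Gc *\<^sub>v (act M g *\<^sub>v v) = (- 1) \<cdot>\<^sub>v (act M g *\<^sub>v (act M Gc *\<^sub>v v))"
      using g R(3,4)[OF v] by auto
    then have "act M Gb *\<^sub>v (act M Gc *\<^sub>v (act M g *\<^sub>v v)) = (- 1) \<cdot>\<^sub>v (act M Gb *\<^sub>v (act M g *\<^sub>v (act M Gc *\<^sub>v v)))"
      using act_vec_linear(3)[OF M gcv] by simp
    also have "act M Gb *\<^sub>v (act M g *\<^sub>v (act M Gc *\<^sub>v v)) = (- 1) \<cdot>\<^sub>v (act M g *\<^sub>v (act M Gb *\<^sub>v (act M Gc *\<^sub>v v)))"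
      using g R(1,2)[OF cv] by auto
    finally show ?thesis by (simp add: smult_smult_assoc)
  qed
  show ?thesis
    by (cases g) (use anti R(5,7,8)[OF v] R(5,7,8)[OF cv] in auto)
qed

text \<open>The central involution \<open>bc\<close> splits \<open>M\<close> into two eigenspaces
  that are submodules. The vector \<open>x\<close> has the same weight for \<open>b\<close> and
  \<open>c\<close>, so it lies in the part for 1; the part for -1 vanishes, and
  \<open>bc = 1\<close>.\<close>

lemma indecomposable_bc:
  fixes M :: "'k::field d4mod"
  assumes two: "(2::'k) \<noteq> 0" and M: "d4_module M" and ind: "indecomposable M"
    and x: "x \<in> space M" "x \<noteq> 0\<^sub>v (mdim M)" "act M Gb *\<^sub>v x = \<tau> \<cdot>\<^sub>v x" "act M Gc *\<^sub>v x = \<tau> \<cdot>\<^sub>v x" "\<tau> * \<tau> = 1"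
  shows "act M Gb = act M Gc"
proof -
  define K where "K v = act M Gb *\<^sub>v (act M Gc *\<^sub>v v)" for v
  have Kc: "K v \<in> space M" if "v \<in> space M" for v unfolding K_def by (intro act_vec_carrier[OF M] that)
  have Kadd: "K (v + w) = K v + K w" if "v \<in> space M" "w \<in> space M" for v w
    unfolding K_def using that act_vec_carrier[OF M] by (simp add: act_vec_linear[OF M])
  have Ksm: "K (c \<cdot>\<^sub>v v) = c \<cdot>\<^sub>v K v" if "v \<in> space M" for v c
    unfolding K_def using that act_vec_carrier[OF M] by (simp add: act_vec_linear[OF M])
  have KK: "K (K v) = v" if v: "v \<in> space M" for v
  proof -
    have cv: "act M Gc *\<^sub>v v \<in> space M" by (rule act_vec_carrier[OF M v])
    have "K (K v) = act M Gb *\<^sub>v (act M Gb *\<^sub>v (act M Gc *\<^sub>v (act M Gc *\<^sub>v v)))"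
      unfolding K_def using d4_module_vec_relations(5)[OF M cv] by simp
    also have "\<dots> = v" using d4_module_vec_relations(7,8)[OF M v] by simp
    finally show ?thesis .
  qed
  define U where "U \<tau> = {v \<in> space M. K v = \<tau> \<cdot>\<^sub>v v}" for \<tau>
  have sub: "d4_submodule M (U \<tau>)" for \<tau>
    unfolding d4_submodule_def
  proof (intro conjI allI ballI)
    show "0\<^sub>v (mdim M) \<in> U \<tau>" by (simp add: U_def K_def act_zero_vec[OF M])
    fix u assume u: "u \<in> U \<tau>"
    then have uc: "u \<in> space M" and Ku: "K u = \<tau> \<cdot>\<^sub>v u" by (auto simp: U_def)
    show "u + w \<in> U \<tau>" if "w \<in> U \<tau>" for w
      using that uc Ku Kadd[of u w] by (auto simp: U_def smult_add_distrib_vec[of _ "mdim M"])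
    show "c \<cdot>\<^sub>v u \<in> U \<tau>" for c
      using uc Ku Ksm[OF uc] by (simp add: U_def smult_smult_assoc mult.commute)
    show "act M g *\<^sub>v u \<in> U \<tau>" for g
      using act_vec_carrier[OF M uc, of g] bc_central[OF M uc, of g] act_vec_linear(3)[OF M uc, of g \<tau>] Ku
      by (simp add: U_def K_def)
  qed (auto simp: U_def)
  have half: "inverse 2 * t + inverse 2 * t = t" for t :: 'k
    by (rule half_sum[OF two M])
  have part: "inverse 2 \<cdot>\<^sub>v (v + \<tau> \<cdot>\<^sub>v K v) \<in> U \<tau>" if v: "v \<in> space M" and t: "\<tau> * \<tau> = 1" for v \<tau>
  proof -
    have "K (inverse 2 \<cdot>\<^sub>v (v + \<tau> \<cdot>\<^sub>v K v)) = inverse 2 \<cdot>\<^sub>v (K v + \<tau> \<cdot>\<^sub>v v)"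
      using v Kc[OF v] by (simp add: Ksm Kadd KK)
    also have "\<dots> = \<tau> \<cdot>\<^sub>v (inverse 2 \<cdot>\<^sub>v (v + \<tau> \<cdot>\<^sub>v K v))"
    proof (rule eq_vecI)
      fix i assume "i < dim_vec (\<tau> \<cdot>\<^sub>v (inverse 2 \<cdot>\<^sub>v (v + \<tau> \<cdot>\<^sub>v K v)))"
      then have i: "i < mdim M" using Kc[OF v] by simp
      have "\<tau> * (\<tau> * K v $ i) = K v $ i" using t by (simp add: mult.assoc[symmetric])
      then show "(inverse 2 \<cdot>\<^sub>v (K v + \<tau> \<cdot>\<^sub>v v)) $ i = (\<tau> \<cdot>\<^sub>v (inverse 2 \<cdot>\<^sub>v (v + \<tau> \<cdot>\<^sub>v K v))) $ i"
        using i v Kc[OF v] by (simp add: algebra_simps)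
    qed (use v Kc[OF v] in simp)
    finally show ?thesis using v Kc[OF v] by (simp add: U_def)
  qed
  have sum: "v = inverse 2 \<cdot>\<^sub>v (v + 1 \<cdot>\<^sub>v K v) + inverse 2 \<cdot>\<^sub>v (v + (- 1) \<cdot>\<^sub>v K v)" if v: "v \<in> space M" for v
    using v Kc[OF v] by (intro eq_vecI) (auto simp: algebra_simps half two)
  have "sub_sum (U 1) (U (- 1)) = space M"
  proof (intro equalityI subsetI)
    fix v assume "v \<in> space M"
    then show "v \<in> sub_sum (U 1) (U (- 1))"
      using sum part[of v 1] part[of v "- 1"] sub_sum_memI by (metis mult_1 mult_minus1 minus_minus)
  qed (auto simp: sub_sum_def U_def)
  moreover have "U 1 \<inter> U (- 1) = zero_sub M"
  proof (intro equalityI subsetI)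
    fix v assume v: "v \<in> U 1 \<inter> U (- 1)"
    then have vc: "v \<in> space M" and e: "v = (- 1) \<cdot>\<^sub>v v" by (auto simp: U_def)
    have "v $ i = 0" if "i < mdim M" for i
    proof -
      have "v $ i = - (v $ i)" using arg_cong[OF e, of "\<lambda>v. v $ i"] that vc by simp
      then have "2 * v $ i = 0" by (metis add.right_inverse mult_2)
      then show ?thesis using two by simp
    qed
    then show "v \<in> zero_sub M" using vc by (auto intro!: eq_vecI)
  qed (use subsp_closed(3)[OF d4_submodule_subsp[OF sub]] in auto)
  ultimately have "U 1 = zero_sub M \<or> U (- 1) = zero_sub M"
    using ind sub unfolding indecomposable_def by blast
  moreover have "x \<in> U 1"
    using x act_vec_linear(3)[OF M x(1), of Gb \<tau>] by (simp add: U_def K_def smult_smult_assoc)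
  ultimately have U0: "U (- 1) = zero_sub M" using x(2) by blast
  have "act M Gb *\<^sub>v v = act M Gc *\<^sub>v v" if v: "v \<in> space M" for v
  proof -
    have "inverse 2 \<cdot>\<^sub>v (v + (- 1) \<cdot>\<^sub>v K v) \<in> U (- 1)" by (rule part[OF v]) simp
    then have z: "inverse 2 \<cdot>\<^sub>v (v + (- 1) \<cdot>\<^sub>v K v) = 0\<^sub>v (mdim M)" using U0 by blast
    have "v = K v"
    proof (rule eq_vecI)
      fix i assume "i < dim_vec (K v)"
      then have "i < mdim M" using Kc[OF v] by simp
      then show "v $ i = K v $ i"
        using arg_cong[OF z, of "\<lambda>v. v $ i"] v Kc[OF v] two by simp
    qed (use v Kc[OF v] in simp)
    then have "act M Gb *\<^sub>v v = act M Gb *\<^sub>v (act M Gb *\<^sub>v (act M Gc *\<^sub>v v))" by (simp add: K_def)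
    also have "\<dots> = act M Gc *\<^sub>v v"
      by (rule d4_module_vec_relations(7)[OF M act_vec_carrier[OF M v]])
    finally show ?thesis .
  qed
  then show ?thesis by (intro mat_eq_by_vec[OF d4_moduleD(1,1)[OF M]])
qed

text \<open>The member \<open>p d + q a\<close> of the pencil that annihilates \<open>v\<^sub>1\<close> in \<open>M\<^sub>1(r,\<eta>)\<close>.\<close>

definition coord_d :: "'k::field proj_line \<Rightarrow> 'k" where
  "coord_d \<eta> = (case \<eta> of Fin x \<Rightarrow> 1 | Infty \<Rightarrow> 0)"

definition coord_a :: "'k::field proj_line \<Rightarrow> 'k" where
  "coord_a \<eta> = (case \<eta> of Fin x \<Rightarrow> x | Infty \<Rightarrow> 1)"

lemma parity_sign_Suc: "parity_sign (r + 1) = - (parity_sign r :: 'k::field)"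
  by (cases r) (simp_all add: parity_sign_def)

text \<open>\<open>x\<close> is the image of the first basis vector. It lies outside
  \<open>ann M\<close> because \<open>a\<close> or \<open>d\<close> sends it to the nonzero image of
  the second one.\<close>

lemma M1_generator:
  fixes M :: "'k::field d4mod"
  assumes M: "d4_module M" and rep: "represents_sub M U (M1 r \<eta>)"
  obtains x where "x \<in> space M" "x \<noteq> 0\<^sub>v (mdim M)" "act M Gb *\<^sub>v x = (- parity_sign r) \<cdot>\<^sub>v x"
    "act M Gc *\<^sub>v x = (- parity_sign r) \<cdot>\<^sub>v x" "x \<notin> ann M"
    "coord_d \<eta> \<cdot>\<^sub>v (act M Gd *\<^sub>v x) + coord_a \<eta> \<cdot>\<^sub>v (act M Ga *\<^sub>v x) = 0\<^sub>v (mdim M)"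
proof -
  let ?N = "M1 r \<eta>"
  have [simp]: "mdim ?N = 2" by (simp add: M1_def)
  obtain T where T: "T \<in> d4_hom ?N M" and bij: "bij_betw ((*\<^sub>v) T) (space ?N) U" and N: "d4_module ?N"
    using rep by (auto simp: represents_sub_def)
  have Tc: "T \<in> carrier_mat (mdim M) 2" using d4_homD(1)[OF T] by simp
  have Tg: "act M g *\<^sub>v (T *\<^sub>v v) = T *\<^sub>v (act ?N g *\<^sub>v v)" if "v \<in> carrier_vec 2" for g v
  proof -
    have gc: "act ?N g \<in> carrier_mat 2 2" using d4_moduleD(1)[OF N] by simp
    show ?thesis
      using assoc_mult_mat_vec[OF d4_moduleD(1)[OF M] Tc that, of g] assoc_mult_mat_vec[OF Tc gc that] d4_homD(2)[OF T, of g]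
      by simp
  qed
  have inj: "v = 0\<^sub>v 2" if "T *\<^sub>v v = 0\<^sub>v (mdim M)" "v \<in> carrier_vec 2" for v
    using inj_onD[OF bij_betw_imp_inj_on[OF bij], of v "0\<^sub>v 2"] that mult_zero_vec[OF Tc] by simp
  let ?e = "unit_vec 2 0 :: 'k vec" and ?f = "unit_vec 2 1 :: 'k vec"
  define x y where "x = T *\<^sub>v ?e" and "y = T *\<^sub>v ?f"
  have x: "x \<in> space M" and y: "y \<in> space M" using Tc by (auto simp: x_def y_def)
  have x0: "x \<noteq> 0\<^sub>v (mdim M)" and y0: "y \<noteq> 0\<^sub>v (mdim M)"
    using inj[of ?e] inj[of ?f] unit_vec_nonzero[of 0 2] unit_vec_nonzero[of 1 2] by (auto simp: x_def y_def)
  have s2: "(\<Sum>i\<in>{0..<2::nat}. h i) = h 0 + (h 1 :: 'k)" for h by (simp add: numeral_2_eq_2)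
  have l2: "i = 0 \<or> i = 1" if "i < 2" for i :: nat using that by auto
  have "act ?N Ga *\<^sub>v ?e = (case \<eta> of Fin x \<Rightarrow> 1 | Infty \<Rightarrow> 0) \<cdot>\<^sub>v ?f"
    "act ?N Gd *\<^sub>v ?e = (case \<eta> of Fin x \<Rightarrow> - x | Infty \<Rightarrow> 1) \<cdot>\<^sub>v ?f"
    "act ?N Gb *\<^sub>v ?e = (- parity_sign r) \<cdot>\<^sub>v ?e" "act ?N Gc *\<^sub>v ?e = (- parity_sign r) \<cdot>\<^sub>v ?e"
    unfolding M1_def parity_sign_Suc
    by (rule eq_vecI; auto simp: mat_of_rows_list_def scalar_prod_def s2 dest!: l2)+
  then have ax: "act M Ga *\<^sub>v x = (case \<eta> of Fin x \<Rightarrow> 1 | Infty \<Rightarrow> 0) \<cdot>\<^sub>v y"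
    and dx: "act M Gd *\<^sub>v x = (case \<eta> of Fin x \<Rightarrow> - x | Infty \<Rightarrow> 1) \<cdot>\<^sub>v y"
    and bx: "act M Gb *\<^sub>v x = (- parity_sign r) \<cdot>\<^sub>v x" and cx: "act M Gc *\<^sub>v x = (- parity_sign r) \<cdot>\<^sub>v x"
    unfolding x_def y_def by (simp_all add: Tg mult_mat_vec[OF Tc])
  have "x \<notin> ann M" using ax dx y0 y by (cases \<eta>) (auto simp: ann_def)
  moreover have "coord_d \<eta> \<cdot>\<^sub>v (act M Gd *\<^sub>v x) + coord_a \<eta> \<cdot>\<^sub>v (act M Ga *\<^sub>v x) = 0\<^sub>v (mdim M)"
    unfolding ax dx using y by (cases \<eta>) (auto simp: coord_a_def coord_d_def intro!: eq_vecI)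
  ultimately show ?thesis using that x x0 bx cx by blast
qed

lemma hom_vec:
  assumes T: "T \<in> d4_hom X Y" and X: "d4_module X" and Y: "d4_module Y" and v: "v \<in> space X"
  shows "T *\<^sub>v (act X g *\<^sub>v v) = act Y g *\<^sub>v (T *\<^sub>v v)"
  using assoc_mult_mat_vec[OF d4_homD(1)[OF T] d4_moduleD(1)[OF X] v, of g]
    assoc_mult_mat_vec[OF d4_moduleD(1)[OF Y] d4_homD(1)[OF T] v, of g] d4_homD(2)[OF T, of g] by simp

text \<open>Together with \<open>inj_hom_bc\<close> this passes \<open>b = c\<close> on to quotients
  and submodules, so that the results on socle and length apply to them.\<close>

lemma surj_hom_bc:
  assumes T: "surj_hom X Y T" and X: "d4_module X" and Y: "d4_module Y" and bc: "act X Gb = act X Gc"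
  shows "act Y Gb = act Y Gc"
proof (rule mat_eq_by_vec[OF d4_moduleD(1,1)[OF Y]])
  fix v assume "v \<in> space Y"
  then obtain w where "w \<in> space X" "v = T *\<^sub>v w" using T unfolding surj_hom_def by blast
  then show "act Y Gb *\<^sub>v v = act Y Gc *\<^sub>v v"
    using hom_vec[of T X Y w] T X Y bc unfolding surj_hom_def by metis
qed

lemma inj_hom_bc:
  assumes T: "T \<in> d4_hom X Y" "inj_mat T" and X: "d4_module X" and Y: "d4_module Y" and bc: "act Y Gb = act Y Gc"
  shows "act X Gb = act X Gc"
proof (rule mat_eq_by_vec[OF d4_moduleD(1,1)[OF X]])
  fix v assume v: "v \<in> space X"
  show "act X Gb *\<^sub>v v = act X Gc *\<^sub>v v"
    by (rule inj_mat_eqD[OF T(2) d4_homD(1)[OF T(1)] act_vec_carrier[OF X v] act_vec_carrier[OF X v]])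
      (simp only: hom_vec[OF T(1) X Y v] bc)
qed

text \<open>The quotient by the socle has Loewy length 1 and is its own socle, where
  \<open>a\<close> and \<open>d\<close> vanish. Hence their values in \<open>M\<close> lie in the
  socle, which is \<open>ann M\<close>.\<close>

lemma loewy_length_2_ann:
  fixes M :: "'k::field d4mod"
  assumes two: "(2::'k) \<noteq> 0" and M: "d4_module M" and bc: "act M Gb = act M Gc"
    and l: "loewy_length M 2" and v: "v \<in> space M" and g: "g = Ga \<or> g = Gd"
  shows "act M g *\<^sub>v v \<in> ann M"
proof -
  have "loewy_length M (Suc (Suc 0))" using l by (simp add: numeral_2_eq_2)
  then obtain Q where Q: "represents_quot M (soc M) Q" "loewy_length Q (Suc 0)"
    by (cases rule: loewy_length.cases) auto
  from Q(2) obtain Q' where Q': "represents_quot Q (soc Q) Q'" "loewy_length Q' 0"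
    by (cases rule: loewy_length.cases) auto
  from Q'(2) have 0: "mdim Q' = 0" by (cases rule: loewy_length.cases) auto
  obtain T where T: "surj_hom M Q T" "mat_kernel T = soc M" and Qm: "d4_module Q"
    using Q(1) by (auto simp: represents_quot_def)
  obtain T' where T': "surj_hom Q Q' T'" "mat_kernel T' = soc Q"
    using Q'(1) by (auto simp: represents_quot_def)
  have Th: "T \<in> d4_hom M Q" using T(1) by (simp add: surj_hom_def)
  have T'c: "T' \<in> carrier_mat 0 (mdim Q)" using T'(1) 0 d4_homD(1)[of T' Q Q'] by (simp add: surj_hom_def)
  have bcQ: "act Q Gb = act Q Gc" by (rule surj_hom_bc[OF T(1) M Qm bc])
  \<comment> \<open>The second quotient is zero-dimensional, so the kernel of \<open>T'\<close>,
    which is the socle of \<open>Q\<close>, is the whole of \<open>Q\<close>.\<close>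
  have "space Q \<subseteq> mat_kernel T'" using T'c by (auto simp: mat_kernel_def intro!: eq_vecI)
  then have annQ: "space Q \<subseteq> ann Q" using T'(2) soc_eq_ann[OF two Qm bcQ] by simp
  have Tv: "T *\<^sub>v v \<in> space Q" by (rule mult_mat_vec_carrier[OF d4_homD(1)[OF Th] v])
  have "T *\<^sub>v (act M g *\<^sub>v v) = 0\<^sub>v (mdim Q)"
    unfolding hom_vec[OF Th M Qm v] using annQ Tv g by (auto simp: ann_def)
  then have "act M g *\<^sub>v v \<in> mat_kernel T"
    using act_vec_carrier[OF M v] d4_homD(1)[OF Th] by (simp add: mat_kernel_def)
  then show ?thesis using T(2) soc_eq_ann[OF two M bc] by simp
qed

text \<open>\<open>a\<close> and \<open>d\<close> interchange the weight spaces and map into the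
  socle, so a complement of the socle part in one weight space, plus the socle part of the other, is
  a submodule. The two submodules of this kind decompose \<open>M\<close>. The vector
  \<open>x\<close> keeps one of them nonzero, so the other is zero: socle and top have opposite
  weights.\<close>

lemma indecomposable_socle_eigenspace:
  fixes M :: "'k::field d4mod"
  assumes two: "(2::'k) \<noteq> 0" and M: "d4_module M" and ind: "indecomposable M" and bc: "act M Gb = act M Gc"
    and l: "loewy_length M 2" and x: "x \<in> eig M (- \<sigma>)" "x \<notin> ann M" and \<sigma>: "\<sigma> * \<sigma> = 1"
  shows "ann M = eig M \<sigma>"
proof -
  note sA = subsp_ann[OF M] and sE = subsp_eig[OF M]
  have sAE: "subsp (mdim M) (ann M \<inter> eig M \<tau>)" for \<tau> by (rule subsp_Int[OF sA sE])
  have \<sigma>': "- \<sigma> * - \<sigma> = 1" using \<sigma> by simp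
  obtain Cp where Cp: "subsp (mdim M) Cp" "Cp \<subseteq> eig M \<sigma>" "(ann M \<inter> eig M \<sigma>) \<inter> Cp = {0\<^sub>v (mdim M)}"
    "\<And>u. u \<in> eig M \<sigma> \<Longrightarrow> \<exists>s\<in>ann M \<inter> eig M \<sigma>. \<exists>c\<in>Cp. u = s + c"
    by (rule complement_exists[OF sAE[of \<sigma>] sE[of \<sigma>] Int_lower2]) (rule that; blast)
  obtain Cm where Cm: "subsp (mdim M) Cm" "Cm \<subseteq> eig M (- \<sigma>)" "(ann M \<inter> eig M (- \<sigma>)) \<inter> Cm = {0\<^sub>v (mdim M)}"
    "\<And>u. u \<in> eig M (- \<sigma>) \<Longrightarrow> \<exists>s\<in>ann M \<inter> eig M (- \<sigma>). \<exists>c\<in>Cm. u = s + c"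
    by (rule complement_exists[OF sAE[of "- \<sigma>"] sE[of "- \<sigma>"] Int_lower2]) (rule that; blast)
  have subm: "d4_submodule M (sub_sum C (ann M \<inter> eig M (- \<tau>)))" if C: "subsp (mdim M) C" "C \<subseteq> eig M \<tau>" for C \<tau>
  proof (rule d4_submodule_sub_sum[OF M C(1) sAE])
    note sc = subsp_closed[OF C(1)] and ss = subsp_closed[OF sAE[of "- \<tau>"]]
    have CC: "u \<in> sub_sum C (ann M \<inter> eig M (- \<tau>))" if "u \<in> C" for u
      using sub_sum_memI[OF that ss(3)] sc(4)[OF that] by simp
    have SS: "w \<in> sub_sum C (ann M \<inter> eig M (- \<tau>))" if "w \<in> ann M \<inter> eig M (- \<tau>)" for w
      using sub_sum_memI[OF sc(3) that] ss(4)[OF that] by simp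
    fix g
    show "act M g *\<^sub>v u \<in> sub_sum C (ann M \<inter> eig M (- \<tau>))" if u: "u \<in> C" for u
    proof (cases "g = Ga \<or> g = Gd")
      case True
      have "u \<in> eig M \<tau>" using u C(2) by blast
      then show ?thesis
        using loewy_length_2_ann[OF two M bc l sc(4)[OF u] True] eig_swap[OF two M _ True] by (intro SS) auto
    next
      case False
      then have "act M g = act M Gb" using bc by (cases g) auto
      moreover have "act M Gb *\<^sub>v u = \<tau> \<cdot>\<^sub>v u" using u C(2) by (auto simp: eig_def)
      ultimately show ?thesis using CC[OF sc(2)[OF u]] by simp
    qed
    show "act M g *\<^sub>v w \<in> sub_sum C (ann M \<inter> eig M (- \<tau>))" if w: "w \<in> ann M \<inter> eig M (- \<tau>)" for w
    proof (cases "g = Ga \<or> g = Gd")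
      case True
      then have "act M g *\<^sub>v w = 0\<^sub>v (mdim M)" using w by (auto simp: ann_def)
      then show ?thesis using SS[OF ss(3)] by simp
    next
      case False
      then have "act M g = act M Gb" using bc by (cases g) auto
      moreover have "act M Gb *\<^sub>v w = (- \<tau>) \<cdot>\<^sub>v w" using w by (auto simp: eig_def)
      ultimately show ?thesis using SS[OF ss(2)[OF w]] by simp
    qed
  qed
  define Sp Sm where "Sp = ann M \<inter> eig M \<sigma>" and "Sm = ann M \<inter> eig M (- \<sigma>)"
  note cCp = subsp_closed[OF Cp(1)] and cCm = subsp_closed[OF Cm(1)]
  have cSp: "subsp (mdim M) Sp" and cSm: "subsp (mdim M) Sm" unfolding Sp_def Sm_def by (rule sAE)+
  have sub1: "d4_submodule M (sub_sum Cm Sp)" using subm[OF Cm(1,2)] by (simp add: Sp_def)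
  have sub2: "d4_submodule M (sub_sum Cp Sm)" using subm[OF Cp(1,2)] by (simp add: Sm_def)
  have "sub_sum Cm Sp \<inter> sub_sum Cp Sm = zero_sub M"
  proof (intro equalityI subsetI)
    fix v assume "v \<in> sub_sum Cm Sp \<inter> sub_sum Cp Sm"
    then obtain c1 s1 c2 s2 where v: "v = c1 + s1" "v = c2 + s2" "c1 \<in> Cm" "s1 \<in> Sp" "c2 \<in> Cp" "s2 \<in> Sm"
      unfolding sub_sum_def by blast
    have c: "c1 \<in> space M" "s1 \<in> space M" "c2 \<in> space M" "s2 \<in> space M"
      using v cCp(4) cCm(4) subsp_closed(4)[OF cSp] subsp_closed(4)[OF cSm] by auto
    \<comment> \<open>Sorted by weight, the equation has elements of opposite weight spaces on its
      two sides, so both sides vanish.\<close>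
    have e: "c1 - s2 = c2 - s1"
    proof (rule eq_vecI)
      fix i assume "i < dim_vec (c2 - s1)"
      then have i: "i < mdim M" using c by simp
      have "c1 $ i + s1 $ i = c2 $ i + s2 $ i"
        using arg_cong[OF trans[OF v(1)[symmetric] v(2)], of "\<lambda>v. v $ i"] i c by simp
      then show "(c1 - s2) $ i = (c2 - s1) $ i" using i c by (simp add: algebra_simps)
    qed (use c in simp)
    have "c1 - s2 \<in> eig M (- \<sigma>)" using v Cm(2) by (intro subsp_closed(5)[OF sE]) (auto simp: Sm_def)
    moreover have "c2 - s1 \<in> eig M \<sigma>" using v Cp(2) by (intro subsp_closed(5)[OF sE]) (auto simp: Sp_def)
    ultimately have z: "c2 - s1 = 0\<^sub>v (mdim M)" using e eig_disjoint[OF two M _ _ \<sigma>] by simp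
    have "c2 = s1" by (rule minus_eq_zero_vecD[OF c(3,2) z])
    moreover have "c1 = s2" by (rule minus_eq_zero_vecD[OF c(1,4) trans[OF e z]])
    ultimately have "s1 \<in> Sp \<inter> Cp" "c1 \<in> Sm \<inter> Cm" using v(3-6) by blast+
    then have "c1 = 0\<^sub>v (mdim M)" "s1 = 0\<^sub>v (mdim M)" using Cp(3) Cm(3) unfolding Sp_def Sm_def by blast+
    then show "v \<in> zero_sub M" using v(1) by simp
  qed (use subsp_closed(3)[OF d4_submodule_subsp[OF sub1]] subsp_closed(3)[OF d4_submodule_subsp[OF sub2]] in auto)
  moreover have "sub_sum (sub_sum Cm Sp) (sub_sum Cp Sm) = space M"
  proof (intro equalityI subsetI)
    fix v assume v: "v \<in> space M"
    obtain s c where 1: "s \<in> Sp" "c \<in> Cp" "eig_part M \<sigma> v = s + c"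
      using Cp(4)[OF eig_part_eig[OF two M v \<sigma>]] by (auto simp: Sp_def)
    obtain s' c' where 2: "s' \<in> Sm" "c' \<in> Cm" "eig_part M (- \<sigma>) v = s' + c'"
      using Cm(4)[OF eig_part_eig[OF two M v \<sigma>']] by (auto simp: Sm_def)
    have cc: "s \<in> space M" "c \<in> space M" "s' \<in> space M" "c' \<in> space M"
      using 1 2 cCp(4) cCm(4) subsp_closed(4)[OF cSp] subsp_closed(4)[OF cSm] by auto
    have "v = (s + c) + (s' + c')" using eig_part_sum[OF two M v, of \<sigma>] 1 2 by simp
    also have "\<dots> = (c' + s) + (c + s')" using cc by (intro eq_vecI) auto
    finally show "v \<in> sub_sum (sub_sum Cm Sp) (sub_sum Cp Sm)" using 1 2 by (auto intro!: sub_sum_memI)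
  next
    fix v assume "v \<in> sub_sum (sub_sum Cm Sp) (sub_sum Cp Sm)"
    then show "v \<in> space M"
      using subsp_closed(4)[OF subsp_sub_sum[OF d4_submodule_subsp[OF sub1] d4_submodule_subsp[OF sub2]]] by blast
  qed
  ultimately have alt: "sub_sum Cm Sp = zero_sub M \<or> sub_sum Cp Sm = zero_sub M"
    using ind sub1 sub2 unfolding indecomposable_def by blast
  have zero_l: "U = zero_sub M" "W = zero_sub M" if "sub_sum U W = zero_sub M" "subsp (mdim M) U" "subsp (mdim M) W" for U W
  proof -
    have "u \<in> zero_sub M" if "u \<in> U" for u
      using sub_sum_memI[OF that subsp_closed(3)[OF \<open>subsp (mdim M) W\<close>]] subsp_closed(4)[OF \<open>subsp (mdim M) U\<close> that]
        \<open>sub_sum U W = zero_sub M\<close> by simp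
    then show "U = zero_sub M" using subsp_closed(3)[OF \<open>subsp (mdim M) U\<close>] by blast
    have "u \<in> zero_sub M" if "u \<in> W" for u
      using sub_sum_memI[OF subsp_closed(3)[OF \<open>subsp (mdim M) U\<close>] that] subsp_closed(4)[OF \<open>subsp (mdim M) W\<close> that]
        \<open>sub_sum U W = zero_sub M\<close> by simp
    then show "W = zero_sub M" using subsp_closed(3)[OF \<open>subsp (mdim M) W\<close>] by blast
  qed
  have "sub_sum Cm Sp \<noteq> zero_sub M"
  proof
    assume "sub_sum Cm Sp = zero_sub M"
    then have "Cm = zero_sub M" by (rule zero_l(1)[OF _ Cm(1) cSp])
    moreover obtain s c where "s \<in> ann M \<inter> eig M (- \<sigma>)" "c \<in> Cm" "x = s + c" using Cm(4)[OF x(1)] by blast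
    ultimately have "x \<in> ann M" using subsp_closed(4)[OF sA] by auto
    then show False using x(2) by simp
  qed
  then have z: "sub_sum Cp Sm = zero_sub M" using alt by simp
  have Cp0: "Cp = zero_sub M" by (rule zero_l(1)[OF z Cp(1) cSm])
  have Sm0: "Sm = zero_sub M" by (rule zero_l(2)[OF z Cp(1) cSm])
  show ?thesis
  proof (intro equalityI subsetI)
    fix v assume v: "v \<in> ann M"
    then have vc: "v \<in> space M" by (simp add: ann_def)
    have "eig_part M (- \<sigma>) v \<in> Sm"
      unfolding Sm_def using eig_part_submodule[OF two M ann_submodule[OF M] v] eig_part_eig[OF two M vc \<sigma>'] by blast
    then have "eig_part M (- \<sigma>) v = 0\<^sub>v (mdim M)" using Sm0 by blast
    then have "v = eig_part M \<sigma> v" using eig_part_sum[OF two M vc, of \<sigma>] eig_part_carrier[OF two M vc, of \<sigma>] by simp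
    then show "v \<in> eig M \<sigma>" using eig_part_eig[OF two M vc \<sigma>] by simp
  next
    fix v assume v: "v \<in> eig M \<sigma>"
    then obtain s c where "s \<in> ann M \<inter> eig M \<sigma>" "c \<in> Cp" "v = s + c" using Cp(4) by blast
    then show "v \<in> ann M" using Cp0 subsp_closed(4)[OF sA] by auto
  qed
qed

text \<open>The columns of \<open>W\<close> span the socle, which is the weight space for
  \<open>parity_sign r\<close>; those of \<open>V\<close> span the opposite weight space, which maps
  isomorphically onto the quotient by the socle. As lengths are dimensions, both bases have
  \<open>s\<close> elements. In them \<open>A\<close> and \<open>D\<close> are the only nonzero
  blocks of \<open>a\<close> and \<open>d\<close>, and direct summands of the pencil correspond to
  direct summands of \<open>M\<close>.\<close>

lemma Ms_structure:
  fixes M :: "'k::field d4mod"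
  assumes two: "(2::'k) \<noteq> 0" and Ms: "is_Ms s r \<eta> M"
  obtains V W A D v where "d4_module M" "mdim M = 2 * s"
    "V \<in> carrier_mat (mdim M) s" "W \<in> carrier_mat (mdim M) s" "A \<in> carrier_mat s s" "D \<in> carrier_mat s s" "inj_mat W"
    "act M Gb * V = (- parity_sign r) \<cdot>\<^sub>m V" "act M Gc * V = (- parity_sign r) \<cdot>\<^sub>m V"
    "act M Gb * W = parity_sign r \<cdot>\<^sub>m W" "act M Gc * W = parity_sign r \<cdot>\<^sub>m W"
    "act M Ga * V = W * A" "act M Gd * V = W * D"
    "act M Ga * W = 0\<^sub>m (mdim M) s" "act M Gd * W = 0\<^sub>m (mdim M) s"
    "indecomposable_pencil s A D" "v \<in> carrier_vec s" "v \<noteq> 0\<^sub>v s"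
    "coord_d \<eta> \<cdot>\<^sub>v (D *\<^sub>v v) + coord_a \<eta> \<cdot>\<^sub>v (A *\<^sub>v v) = 0\<^sub>v s"
proof -
  let ?n = "mdim M"
  let ?\<sigma> = "parity_sign r :: 'k"
  have \<sigma>': "- ?\<sigma> * - ?\<sigma> = 1" by simp
  from Ms have M: "d4_module M" and ind: "indecomposable M" and l: "loewy_length M 2"
    by (auto simp: is_Ms_def has_type_def)
  from Ms obtain Q where Q: "represents_quot M (soc M) Q" "has_length Q s" by (auto simp: is_Ms_def has_type_def)
  from Ms obtain S where S: "represents_sub M (soc M) S" "has_length S s" by (auto simp: is_Ms_def has_type_def)
  from Ms obtain U where "represents_sub M U (M1 r \<eta>)" by (auto simp: is_Ms_def)
  from M1_generator[OF M this] obtain x where x: "x \<in> space M" "x \<noteq> 0\<^sub>v ?n" "act M Gb *\<^sub>v x = (- ?\<sigma>) \<cdot>\<^sub>v x"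
    "act M Gc *\<^sub>v x = (- ?\<sigma>) \<cdot>\<^sub>v x" "x \<notin> ann M"
    and rel: "coord_d \<eta> \<cdot>\<^sub>v (act M Gd *\<^sub>v x) + coord_a \<eta> \<cdot>\<^sub>v (act M Ga *\<^sub>v x) = 0\<^sub>v ?n" by metis
  have bc: "act M Gb = act M Gc" by (rule indecomposable_bc[OF two M ind x(1-4) \<sigma>'])
  have soc: "soc M = ann M" by (rule soc_eq_ann[OF two M bc])
  have xe: "x \<in> eig M (- ?\<sigma>)" using x by (simp add: eig_def)
  have annE: "ann M = eig M ?\<sigma>"
    by (rule indecomposable_socle_eigenspace[OF two M ind bc l xe x(5)]) simp
  obtain W where W: "W \<in> d4_hom S M" "bij_betw ((*\<^sub>v) W) (space S) (ann M)" and Sm: "d4_module S"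
    using S(1) soc by (auto simp: represents_sub_def)
  have Wc0: "W \<in> carrier_mat ?n (mdim S)" by (rule d4_homD(1)[OF W(1)])
  have injW: "inj_mat W"
  proof (rule inj_matI[OF Wc0])
    fix y assume "y \<in> carrier_vec (mdim S)" "W *\<^sub>v y = 0\<^sub>v ?n"
    then show "y = 0\<^sub>v (mdim S)"
      using inj_onD[OF bij_betw_imp_inj_on[OF W(2)], of y "0\<^sub>v (mdim S)"] mult_zero_vec[OF Wc0] by simp
  qed
  have "mdim S = s"
    by (rule has_length_imp_mdim[OF two Sm inj_hom_bc[OF W(1) injW Sm M bc] S(2)])
  then have Wc: "W \<in> carrier_mat ?n s" using Wc0 by simp
  have rngW: "rng W = ann M" using W(2) Wc0 by (auto simp: rng_def bij_betw_def)
  obtain T where T: "surj_hom M Q T" "mat_kernel T = ann M" and Qm: "d4_module Q"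
    using Q(1) soc by (auto simp: represents_quot_def)
  have "mdim Q = s" by (rule has_length_imp_mdim[OF two Qm surj_hom_bc[OF T(1) M Qm bc] Q(2)])
  then have Tc: "T \<in> carrier_mat s ?n" and Tsurj: "(*\<^sub>v) T ` carrier_vec ?n = carrier_vec s"
    using T(1) by (auto simp: surj_hom_def d4_hom_def)
  have Tann: "T *\<^sub>v v = 0\<^sub>v s \<longleftrightarrow> v \<in> ann M" if "v \<in> carrier_vec ?n" for v
    using T(2) Tc that by (auto simp: mat_kernel_def)
  obtain d V where V0: "V \<in> carrier_mat ?n d" and injV: "inj_mat V" and rngV: "rng V = eig M (- ?\<sigma>)"
    by (rule basis_exists[OF subsp_eig[OF M]])
  have Vx: "V *\<^sub>v y \<in> carrier_vec ?n" if "y \<in> carrier_vec d" for y by (rule mult_mat_vec_carrier[OF V0 that])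
  have Wx: "W *\<^sub>v y \<in> carrier_vec ?n" if "y \<in> carrier_vec s" for y by (rule mult_mat_vec_carrier[OF Wc that])
  have Ve: "V *\<^sub>v y \<in> eig M (- ?\<sigma>)" if "y \<in> carrier_vec d" for y using rngI[OF V0 that] rngV by simp
  have We: "W *\<^sub>v y \<in> eig M ?\<sigma>" if "y \<in> carrier_vec s" for y using rngI[OF Wc that] rngW annE by simp
  have TV: "T * V \<in> carrier_mat s d" by (rule mult_carrier_mat[OF Tc V0])
  have dis: "v = 0\<^sub>v ?n" if "v \<in> eig M ?\<sigma>" "v \<in> eig M (- ?\<sigma>)" for v
    by (rule eig_disjoint[OF two M that]) simp
  \<comment> \<open>The weight space spanned by \<open>V\<close> meets the socle trivially and fills
    \<open>M\<close> together with it, so \<open>T\<close> maps it bijectively onto the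
    quotient.\<close>
  have "d = s"
  proof (rule rng_carrier_square[OF TV])
    show "inj_mat (T * V)"
    proof (rule inj_matI[OF TV])
      fix y assume y: "y \<in> carrier_vec d" "(T * V) *\<^sub>v y = 0\<^sub>v s"
      then have "V *\<^sub>v y \<in> ann M" using Tann[OF Vx[OF y(1)]] assoc_mult_mat_vec[OF Tc V0 y(1)] by simp
      then have "V *\<^sub>v y = 0\<^sub>v ?n" using dis annE Ve[OF y(1)] by simp
      then show "y = 0\<^sub>v d" by (rule inj_matD[OF injV V0 y(1)])
    qed
    show "rng (T * V) = carrier_vec s"
    proof (intro equalityI subsetI)
      fix u :: "'k vec" assume "u \<in> carrier_vec s"
      then obtain v where v: "v \<in> carrier_vec ?n" "u = T *\<^sub>v v" using Tsurj by (metis imageE)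
      have p: "eig_part M \<tau> v \<in> carrier_vec ?n" for \<tau> by (rule eig_part_carrier[OF two M v(1)])
      have "eig_part M ?\<sigma> v \<in> ann M" unfolding annE by (rule eig_part_eig[OF two M v(1)]) simp
      then have "T *\<^sub>v eig_part M ?\<sigma> v = 0\<^sub>v s" using Tann[OF p] by simp
      then have "u = T *\<^sub>v eig_part M (- ?\<sigma>) v"
        using v(2) eig_part_sum[OF two M v(1), of ?\<sigma>] mult_add_distrib_mat_vec[OF Tc p p, of ?\<sigma> "- ?\<sigma>"]
          mult_mat_vec_carrier[OF Tc p[of "- ?\<sigma>"]] by simp
      moreover have "eig_part M (- ?\<sigma>) v \<in> rng V" unfolding rngV by (rule eig_part_eig[OF two M v(1) \<sigma>'])
      then obtain y where "y \<in> carrier_vec d" "eig_part M (- ?\<sigma>) v = V *\<^sub>v y" using V0 by (rule rngE)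
      ultimately show "u \<in> rng (T * V)" using rngI[OF TV, of y] assoc_mult_mat_vec[OF Tc V0] by simp
    qed (use rng_subset_carrier[OF TV] in blast)
  qed
  note V0 = V0[unfolded \<open>d = s\<close>] and Vx = Vx[unfolded \<open>d = s\<close>] and Ve = Ve[unfolded \<open>d = s\<close>]
  have split: "\<exists>y\<in>carrier_vec s. \<exists>z\<in>carrier_vec s. v = V *\<^sub>v y + W *\<^sub>v z" if v: "v \<in> carrier_vec ?n" for v
  proof -
    have "eig_part M (- ?\<sigma>) v \<in> rng V" unfolding rngV by (rule eig_part_eig[OF two M v \<sigma>'])
    then obtain y where y: "y \<in> carrier_vec s" "eig_part M (- ?\<sigma>) v = V *\<^sub>v y" using V0 by (rule rngE)
    have "eig_part M ?\<sigma> v \<in> rng W" unfolding rngW annE by (rule eig_part_eig[OF two M v]) simp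
    then obtain z where z: "z \<in> carrier_vec s" "eig_part M ?\<sigma> v = W *\<^sub>v z" using Wc by (rule rngE)
    have "v = V *\<^sub>v y + W *\<^sub>v z" using eig_part_sum[OF two M v, of "- ?\<sigma>"] y z by simp
    then show ?thesis using y z by blast
  qed
  have uniq: "y = 0\<^sub>v s \<and> z = 0\<^sub>v s" if y: "y \<in> carrier_vec s" and z: "z \<in> carrier_vec s" and e: "V *\<^sub>v y + W *\<^sub>v z = 0\<^sub>v ?n" for y z
  proof -
    have "V *\<^sub>v y = (- 1) \<cdot>\<^sub>v (W *\<^sub>v z)"
    proof (rule eq_vecI)
      fix i assume "i < dim_vec ((- 1) \<cdot>\<^sub>v (W *\<^sub>v z))"
      then have i: "i < ?n" using Wc by simp
      then show "(V *\<^sub>v y) $ i = ((- 1) \<cdot>\<^sub>v (W *\<^sub>v z)) $ i"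
        using arg_cong[OF e, of "\<lambda>v. v $ i"] carrier_matD[OF V0] carrier_matD[OF Wc] by (simp add: add_eq_0_iff2 del: index_mult_mat_vec)
    qed (use V0 Wc in simp)
    then have "V *\<^sub>v y \<in> eig M ?\<sigma>" using subsp_closed(2)[OF subsp_eig[OF M] We[OF z]] by simp
    then have Vy: "V *\<^sub>v y = 0\<^sub>v ?n" using dis Ve[OF y] by simp
    then have "W *\<^sub>v z = 0\<^sub>v ?n" using e Wx[OF z] by simp
    then show ?thesis using Vy inj_matD[OF injV V0 y] inj_matD[OF injW Wc z] by simp
  qed
  have n2: "?n = 2 * s"
  proof -
    \<comment> \<open>The two coordinate projections assemble \<open>V\<close> and \<open>W\<close>
      into one matrix with \<open>s + s\<close> columns; as these form a basis of \<open>M\<close>,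
      their number is the dimension.\<close>
    define L1 :: "'k mat" where "L1 = mat s (s + s) (\<lambda>(i, j). if j = i then 1 else 0)"
    define L2 :: "'k mat" where "L2 = mat s (s + s) (\<lambda>(i, j). if j = s + i then 1 else 0)"
    have L: "L1 \<in> carrier_mat s (s + s)" "L2 \<in> carrier_mat s (s + s)" by (auto simp: L1_def L2_def)
    have L1x: "L1 *\<^sub>v y = vec s (\<lambda>i. y $ i)" and L2x: "L2 *\<^sub>v y = vec s (\<lambda>i. y $ (s + i))" if y: "y \<in> carrier_vec (s + s)" for y
    proof -
      have d: "(\<Sum>j\<in>{0..<s + s}. (if j = k then 1 else 0) * y $ j) = y $ k" if "k < s + s" for k
      proof -
        have "(\<Sum>j\<in>{0..<s + s}. (if j = k then 1 else 0) * y $ j) = (\<Sum>j\<in>{0..<s + s}. if k = j then y $ j else 0)"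
          by (intro sum.cong) auto
        then show ?thesis using that by simp
      qed
      show "L1 *\<^sub>v y = vec s (\<lambda>i. y $ i)" "L2 *\<^sub>v y = vec s (\<lambda>i. y $ (s + i))"
        using y d by (intro eq_vecI; simp add: L1_def L2_def scalar_prod_def)+
    qed
    let ?Z = "V * L1 + W * L2"
    have VL: "V * L1 \<in> carrier_mat ?n (s + s)" and WL: "W * L2 \<in> carrier_mat ?n (s + s)"
      by (rule mult_carrier_mat[OF V0 L(1)], rule mult_carrier_mat[OF Wc L(2)])
    have Z: "?Z \<in> carrier_mat ?n (s + s)" using WL by simp
    have Zy: "?Z *\<^sub>v y = V *\<^sub>v (L1 *\<^sub>v y) + W *\<^sub>v (L2 *\<^sub>v y)" if y: "y \<in> carrier_vec (s + s)" for y
      using add_mult_distrib_mat_vec[OF VL WL y] assoc_mult_mat_vec[OF V0 L(1) y] assoc_mult_mat_vec[OF Wc L(2) y] by simp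
    have "s + s = ?n"
    proof (rule rng_carrier_square[OF Z])
      show "inj_mat ?Z"
      proof (rule inj_matI[OF Z])
        fix y assume y: "y \<in> carrier_vec (s + s)" "?Z *\<^sub>v y = 0\<^sub>v ?n"
        have "L1 *\<^sub>v y = 0\<^sub>v s \<and> L2 *\<^sub>v y = 0\<^sub>v s"
          by (rule uniq) (use y(2) Zy[OF y(1)] mult_mat_vec_carrier[OF L(1) y(1)] mult_mat_vec_carrier[OF L(2) y(1)] in auto)
        then have a: "vec s (\<lambda>i. y $ i) = 0\<^sub>v s" and b: "vec s (\<lambda>i. y $ (s + i)) = 0\<^sub>v s"
          using L1x[OF y(1)] L2x[OF y(1)] by auto
        have "y $ i = 0" if "i < s + s" for i
        proof (cases "i < s")
          case True
          then show ?thesis using arg_cong[OF a, of "\<lambda>v. v $ i"] by simp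
        next
          case False
          then have "s + (i - s) = i" "i - s < s" using that by auto
          then show ?thesis using arg_cong[OF b, of "\<lambda>v. v $ (i - s)"] by simp
        qed
        then show "y = 0\<^sub>v (s + s)" using y(1) by (intro eq_vecI) auto
      qed
      show "rng ?Z = carrier_vec ?n"
      proof (intro equalityI subsetI)
        fix v :: "'k vec" assume "v \<in> carrier_vec ?n"
        then obtain y z where yz: "y \<in> carrier_vec s" "z \<in> carrier_vec s" "v = V *\<^sub>v y + W *\<^sub>v z" using split by blast
        let ?y = "vec (s + s) (\<lambda>i. if i < s then y $ i else z $ (i - s))"
        have "L1 *\<^sub>v ?y = y" "L2 *\<^sub>v ?y = z" using yz by (auto simp: L1x L2x intro!: eq_vecI)
        then have "v = ?Z *\<^sub>v ?y" using Zy[of ?y] yz(3) by simp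
        then show "v \<in> rng ?Z" using rngI[OF Z, of ?y] by simp
      qed (use rng_subset_carrier[OF Z] in blast)
    qed
    then show ?thesis by simp
  qed
  have agV: "act M g *\<^sub>v (V *\<^sub>v y) \<in> rng W" if "g = Ga \<or> g = Gd" "y \<in> carrier_vec s" for g y
    unfolding rngW by (rule loewy_length_2_ann[OF two M bc l Vx[OF that(2)] that(1)])
  have gV: "act M g * V \<in> carrier_mat ?n s" for g by (rule act_mult_carrier[OF M V0])
  have gW: "act M g * W \<in> carrier_mat ?n s" for g by (rule act_mult_carrier[OF M Wc])
  have gVy: "(act M g * V) *\<^sub>v y = act M g *\<^sub>v (V *\<^sub>v y)" if "y \<in> carrier_vec s" for g y
    by (rule assoc_mult_mat_vec[OF d4_moduleD(1)[OF M] V0 that])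
  have gWy: "(act M g * W) *\<^sub>v y = act M g *\<^sub>v (W *\<^sub>v y)" if "y \<in> carrier_vec s" for g y
    by (rule assoc_mult_mat_vec[OF d4_moduleD(1)[OF M] Wc that])
  have "(act M Ga * V) *\<^sub>v y \<in> rng W" "(act M Gd * V) *\<^sub>v y \<in> rng W" if "y \<in> carrier_vec s" for y
    unfolding gVy[OF that] by (rule agV[OF _ that]; simp)+
  then obtain A D where A: "A \<in> carrier_mat s s" "act M Ga * V = W * A" and D: "D \<in> carrier_mat s s" "act M Gd * V = W * D"
    using factor_through[OF gV Wc] by metis
  have aV: "act M Ga *\<^sub>v (V *\<^sub>v y) = W *\<^sub>v (A *\<^sub>v y)" and dV: "act M Gd *\<^sub>v (V *\<^sub>v y) = W *\<^sub>v (D *\<^sub>v y)"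
    if "y \<in> carrier_vec s" for y
    by (rule trans[OF gVy[OF that, of Ga, unfolded A(2), symmetric] assoc_mult_mat_vec[OF Wc A(1) that]])
      (rule trans[OF gVy[OF that, of Gd, unfolded D(2), symmetric] assoc_mult_mat_vec[OF Wc D(1) that]])
  have eV: "act M g * V = (- ?\<sigma>) \<cdot>\<^sub>m V" if "g = Gb \<or> g = Gc" for g
  proof (rule mat_eq_by_vec[OF gV])
    fix y :: "'k vec" assume y: "y \<in> carrier_vec s"
    have "act M g = act M Gb" using that bc by auto
    then show "(act M g * V) *\<^sub>v y = ((- ?\<sigma>) \<cdot>\<^sub>m V) *\<^sub>v y"
      unfolding gVy[OF y] smult_mat_mult_vec[OF V0 y] using Ve[OF y] by (simp add: eig_def)
  qed (use V0 in simp)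
  have eW: "act M g * W = ?\<sigma> \<cdot>\<^sub>m W" if "g = Gb \<or> g = Gc" for g
  proof (rule mat_eq_by_vec[OF gW])
    fix y :: "'k vec" assume y: "y \<in> carrier_vec s"
    have "act M g = act M Gb" using that bc by auto
    then show "(act M g * W) *\<^sub>v y = (?\<sigma> \<cdot>\<^sub>m W) *\<^sub>v y"
      unfolding gWy[OF y] smult_mat_mult_vec[OF Wc y] using We[OF y] by (simp add: eig_def)
  qed (use Wc in simp)
  have nW: "act M g * W = 0\<^sub>m ?n s" if "g = Ga \<or> g = Gd" for g
  proof (rule mat_eq_by_vec[OF gW])
    fix y :: "'k vec" assume y: "y \<in> carrier_vec s"
    show "(act M g * W) *\<^sub>v y = 0\<^sub>m ?n s *\<^sub>v y"
      unfolding gWy[OF y] zero_mat_mult_vec[OF y] using that rngI[OF Wc y] rngW by (auto simp: ann_def)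
  qed simp
  have pencil: "indecomposable_pencil s A D"
    unfolding indecomposable_pencil_def
  proof (intro allI impI, elim conjE)
    fix V1 V2 W1 W2
    assume dV12: "direct_sum s V1 V2" and dW12: "direct_sum s W1 W2"
      and m1: "\<forall>x\<in>V1. A *\<^sub>v x \<in> W1 \<and> D *\<^sub>v x \<in> W1" and m2: "\<forall>x\<in>V2. A *\<^sub>v x \<in> W2 \<and> D *\<^sub>v x \<in> W2"
    have s: "subsp s V1" "subsp s V2" "subsp s W1" "subsp s W2"
      and i: "V1 \<inter> V2 = {0\<^sub>v s}" "W1 \<inter> W2 = {0\<^sub>v s}"
      using dV12 dW12 by (auto simp: direct_sum_def)
    \<comment> \<open>A part \<open>P\<close> of the top together with a part \<open>R\<close> of
      the socle that contains its images under both maps is a submodule.\<close>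
    define X where "X P R = {V *\<^sub>v y + W *\<^sub>v z | y z. y \<in> P \<and> z \<in> R}" for P R
    have Xsub: "d4_submodule M (X P R)" if P: "subsp s P" and R: "subsp s R"
      and m: "\<forall>x\<in>P. A *\<^sub>v x \<in> R \<and> D *\<^sub>v x \<in> R" for P R
    proof -
      note cP = subsp_closed[OF P] and cR = subsp_closed[OF R]
      have sV: "subsp ?n ((*\<^sub>v) V ` P)" and sW: "subsp ?n ((*\<^sub>v) W ` R)"
        by (rule subsp_image[OF V0 P], rule subsp_image[OF Wc R])
      have eq: "X P R = sub_sum ((*\<^sub>v) V ` P) ((*\<^sub>v) W ` R)" by (auto simp: X_def sub_sum_def)
      have WX: "W *\<^sub>v z \<in> X P R" if "z \<in> R" for z
      proof -
        have "W *\<^sub>v z = V *\<^sub>v 0\<^sub>v s + W *\<^sub>v z" using V0 Wx[OF cR(4)[OF that]] by simp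
        then show ?thesis unfolding X_def using cP(3) that by blast
      qed
      have VX: "V *\<^sub>v y \<in> X P R" if "y \<in> P" for y
      proof -
        have "V *\<^sub>v y = V *\<^sub>v y + W *\<^sub>v 0\<^sub>v s" using Wc Vx[OF cP(4)[OF that]] by simp
        then show ?thesis unfolding X_def using cR(3) that by blast
      qed
      show ?thesis
        unfolding eq
      proof (rule d4_submodule_sub_sum[OF M sV sW]; unfold eq[symmetric])
        fix g u assume "u \<in> (*\<^sub>v) V ` P"
        then obtain y where y: "y \<in> P" "u = V *\<^sub>v y" by blast
        have yc: "y \<in> carrier_vec s" by (rule cP(4)[OF y(1)])
        have bcg: "act M g *\<^sub>v u = V *\<^sub>v ((- ?\<sigma>) \<cdot>\<^sub>v y)" if "g = Gb \<or> g = Gc"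
        proof -
          have "act M g = act M Gb" using that bc by auto
          then show ?thesis using Ve[OF yc] y(2) mult_mat_vec[OF V0 yc] by (simp add: eig_def)
        qed
        show "act M g *\<^sub>v u \<in> X P R"
        proof (cases g)
          case Ga then show ?thesis using aV[OF yc] y m WX by simp
        next
          case Gd then show ?thesis using dV[OF yc] y m WX by simp
        next
          case Gb then show ?thesis using bcg VX[OF cP(2)[OF y(1)]] by simp
        next
          case Gc then show ?thesis using bcg VX[OF cP(2)[OF y(1)]] by simp
        qed
      next
        fix g w assume "w \<in> (*\<^sub>v) W ` R"
        then obtain z where z: "z \<in> R" "w = W *\<^sub>v z" by blast
        have zc: "z \<in> carrier_vec s" by (rule cR(4)[OF z(1)])
        have wa: "w \<in> ann M" using rngI[OF Wc zc] rngW z by simp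
        have bcg: "act M g *\<^sub>v w = W *\<^sub>v (?\<sigma> \<cdot>\<^sub>v z)" if "g = Gb \<or> g = Gc"
        proof -
          have "act M g = act M Gb" using that bc by auto
          then show ?thesis using We[OF zc] z(2) mult_mat_vec[OF Wc zc] by (simp add: eig_def)
        qed
        have "0\<^sub>v ?n \<in> X P R" using WX[OF cR(3)] Wc by simp
        then show "act M g *\<^sub>v w \<in> X P R"
          using wa bcg WX[OF cR(2)[OF z(1)]] by (cases g) (auto simp: ann_def)
      qed
    qed
    have X1: "d4_submodule M (X V1 W1)" by (rule Xsub[OF s(1,3) m1])
    have X2: "d4_submodule M (X V2 W2)" by (rule Xsub[OF s(2,4) m2])
    have "X V1 W1 \<inter> X V2 W2 = zero_sub M"
    proof (intro equalityI subsetI)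
      fix v assume vX: "v \<in> X V1 W1 \<inter> X V2 W2"
      then have vX1: "v \<in> X V1 W1" by simp
      from vX obtain y z y' z' where v: "v = V *\<^sub>v y + W *\<^sub>v z" "v = V *\<^sub>v y' + W *\<^sub>v z'" "y \<in> V1" "z \<in> W1" "y' \<in> V2" "z' \<in> W2"
        unfolding X_def by blast
      have c: "y \<in> carrier_vec s" "z \<in> carrier_vec s" "y' \<in> carrier_vec s" "z' \<in> carrier_vec s"
        using v s subsp_closed(4) by metis+
      have "V *\<^sub>v (y - y') + W *\<^sub>v (z - z') = (V *\<^sub>v y - V *\<^sub>v y') + (W *\<^sub>v z - W *\<^sub>v z')"
        using mult_minus_distrib_mat_vec[OF V0 c(1,3)] mult_minus_distrib_mat_vec[OF Wc c(2,4)] by simp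
      also have "\<dots> = (V *\<^sub>v y + W *\<^sub>v z) - (V *\<^sub>v y' + W *\<^sub>v z')"
        using carrier_matD[OF V0] carrier_matD[OF Wc] by (intro eq_vecI) (auto simp del: index_mult_mat_vec)
      also have "\<dots> = v - v" by (simp only: v(1)[symmetric] v(2)[symmetric])
      also have "\<dots> = 0\<^sub>v ?n" using subsp_closed(4)[OF d4_submodule_subsp[OF X1] vX1] by (intro eq_vecI) auto
      finally have "y - y' = 0\<^sub>v s \<and> z - z' = 0\<^sub>v s" by (intro uniq) (use c in auto)
      then have "y = y'" "z = z'" using c by (auto intro: minus_eq_zero_vecD)
      then have "y = 0\<^sub>v s" "z = 0\<^sub>v s" using v i by auto
      then show "v \<in> zero_sub M" using v(1) V0 Wc by simp
    qed (use subsp_closed(3)[OF d4_submodule_subsp[OF X1]] subsp_closed(3)[OF d4_submodule_subsp[OF X2]] in auto)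
    moreover have "sub_sum (X V1 W1) (X V2 W2) = space M"
    proof (intro equalityI subsetI)
      fix v assume "v \<in> space M"
      then obtain y z where yz: "y \<in> carrier_vec s" "z \<in> carrier_vec s" "v = V *\<^sub>v y + W *\<^sub>v z" using split by blast
      obtain y1 y2 where y: "y1 \<in> V1" "y2 \<in> V2" "y = y1 + y2" using yz(1) dV12 by (auto simp: direct_sum_def)
      obtain z1 z2 where z: "z1 \<in> W1" "z2 \<in> W2" "z = z1 + z2" using yz(2) dW12 by (auto simp: direct_sum_def)
      have c: "y1 \<in> carrier_vec s" "y2 \<in> carrier_vec s" "z1 \<in> carrier_vec s" "z2 \<in> carrier_vec s"
        using y z s subsp_closed(4) by metis+
      have "v = (V *\<^sub>v y1 + V *\<^sub>v y2) + (W *\<^sub>v z1 + W *\<^sub>v z2)"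
        unfolding yz(3) y(3) z(3) using mult_add_distrib_mat_vec[OF V0 c(1,2)] mult_add_distrib_mat_vec[OF Wc c(3,4)] by simp
      also have "\<dots> = (V *\<^sub>v y1 + W *\<^sub>v z1) + (V *\<^sub>v y2 + W *\<^sub>v z2)"
        using carrier_matD[OF V0] carrier_matD[OF Wc] by (intro eq_vecI) (auto simp del: index_mult_mat_vec)
      finally show "v \<in> sub_sum (X V1 W1) (X V2 W2)"
        using y z unfolding sub_sum_def X_def by blast
    next
      fix v assume "v \<in> sub_sum (X V1 W1) (X V2 W2)"
      then show "v \<in> space M"
        using subsp_closed(4)[OF subsp_sub_sum[OF d4_submodule_subsp[OF X1] d4_submodule_subsp[OF X2]]] by blast
    qed
    ultimately have alt: "X V1 W1 = zero_sub M \<or> X V2 W2 = zero_sub M"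
      using ind X1 X2 unfolding indecomposable_def by blast
    have "P = {0\<^sub>v s} \<and> R = {0\<^sub>v s}" if z: "X P R = zero_sub M" and P: "subsp s P" and R: "subsp s R" for P R
    proof -
      have "y = 0\<^sub>v s" "z = 0\<^sub>v s" if "y \<in> P" "z \<in> R" for y z
      proof -
        have "V *\<^sub>v y + W *\<^sub>v z \<in> X P R" unfolding X_def using that by blast
        then have "V *\<^sub>v y + W *\<^sub>v z = 0\<^sub>v ?n" using z by blast
        then show "y = 0\<^sub>v s" "z = 0\<^sub>v s"
          using uniq[OF subsp_closed(4)[OF P that(1)] subsp_closed(4)[OF R that(2)]] by auto
      qed
      then show ?thesis using subsp_closed(3)[OF P] subsp_closed(3)[OF R] by blast
    qed
    then show "V1 = {0\<^sub>v s} \<and> W1 = {0\<^sub>v s} \<or> V2 = {0\<^sub>v s} \<and> W2 = {0\<^sub>v s}" using alt s by blast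
  qed
  have "x \<in> rng V" using xe rngV by simp
  then obtain v where v: "v \<in> carrier_vec s" "x = V *\<^sub>v v" using V0 by (rule rngE)
  have "v \<noteq> 0\<^sub>v s" using v(2) x(2) V0 by auto
  moreover have "coord_d \<eta> \<cdot>\<^sub>v (D *\<^sub>v v) + coord_a \<eta> \<cdot>\<^sub>v (A *\<^sub>v v) = 0\<^sub>v s"
  proof (rule inj_matD[OF injW Wc])
    have Av: "A *\<^sub>v v \<in> carrier_vec s" and Dv: "D *\<^sub>v v \<in> carrier_vec s"
      by (rule mult_mat_vec_carrier[OF A(1) v(1)], rule mult_mat_vec_carrier[OF D(1) v(1)])
    then show "coord_d \<eta> \<cdot>\<^sub>v (D *\<^sub>v v) + coord_a \<eta> \<cdot>\<^sub>v (A *\<^sub>v v) \<in> carrier_vec s" by simp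
    show "W *\<^sub>v (coord_d \<eta> \<cdot>\<^sub>v (D *\<^sub>v v) + coord_a \<eta> \<cdot>\<^sub>v (A *\<^sub>v v)) = 0\<^sub>v ?n"
      using rel aV[OF v(1)] dV[OF v(1)] v(2) Av Dv
      by (simp add: mult_add_distrib_mat_vec[OF Wc] mult_mat_vec[OF Wc])
  qed
  ultimately show ?thesis
    using that[OF M n2 V0 Wc A(1) D(1) injW eV eV eW eW A(2) D(2) nW nW pencil v(1)] by simp
qed

subsection \<open>The tensor product\<close>

text \<open>The coefficient matrix is invertible, so \<open>A\<close> and \<open>D\<close> are in
  turn combinations of the new members, and every splitting compatible with the new pair is
  compatible with the old one.\<close>

lemma indecomposable_pencil_change:
  fixes A D :: "'a::field mat"
  assumes ind: "indecomposable_pencil n A D" and A: "A \<in> carrier_mat n n" and D: "D \<in> carrier_mat n n"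
    and \<delta>: "p * q' - q * p' \<noteq> 0"
  shows "indecomposable_pencil n (p \<cdot>\<^sub>m D + q \<cdot>\<^sub>m A) (p' \<cdot>\<^sub>m D + q' \<cdot>\<^sub>m A)"
  unfolding indecomposable_pencil_def
proof (intro allI impI, elim conjE)
  let ?E = "p \<cdot>\<^sub>m D + q \<cdot>\<^sub>m A" and ?F = "p' \<cdot>\<^sub>m D + q' \<cdot>\<^sub>m A"
  fix V V' W W'
  assume V: "direct_sum n V V'" and W: "direct_sum n W W'"
    and 1: "\<forall>x\<in>V. ?E *\<^sub>v x \<in> W \<and> ?F *\<^sub>v x \<in> W" and 2: "\<forall>x\<in>V'. ?E *\<^sub>v x \<in> W' \<and> ?F *\<^sub>v x \<in> W'"
  define \<delta> where "\<delta> = p * q' - q * p'"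
  have d0: "\<delta> \<noteq> 0" using \<delta> by (simp add: \<delta>_def)
  have lin: "(x \<cdot>\<^sub>m D + y \<cdot>\<^sub>m A) *\<^sub>v v = x \<cdot>\<^sub>v (D *\<^sub>v v) + y \<cdot>\<^sub>v (A *\<^sub>v v)" if "v \<in> carrier_vec n" for x y v
    using add_mult_distrib_mat_vec[of "x \<cdot>\<^sub>m D" n n "y \<cdot>\<^sub>m A" v] A D that
    by (simp add: smult_mat_mult_vec[OF A that] smult_mat_mult_vec[OF D that])
  have key: "A *\<^sub>v v \<in> S \<and> D *\<^sub>v v \<in> S" if S: "subsp n S" and v: "v \<in> carrier_vec n" and e: "?E *\<^sub>v v \<in> S" "?F *\<^sub>v v \<in> S" for S v
  proof -
    have Av: "A *\<^sub>v v \<in> carrier_vec n" and Dv: "D *\<^sub>v v \<in> carrier_vec n"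
      using mult_mat_vec_carrier[OF A v] mult_mat_vec_carrier[OF D v] by auto
    have "A *\<^sub>v v = (inverse \<delta> * p) \<cdot>\<^sub>v (?F *\<^sub>v v) - (inverse \<delta> * p') \<cdot>\<^sub>v (?E *\<^sub>v v)"
    proof (rule eq_vecI)
      fix i assume "i < dim_vec ((inverse \<delta> * p) \<cdot>\<^sub>v (?F *\<^sub>v v) - (inverse \<delta> * p') \<cdot>\<^sub>v (?E *\<^sub>v v))"
      then have i: "i < n" using A by simp
      have "((inverse \<delta> * p) \<cdot>\<^sub>v (?F *\<^sub>v v) - (inverse \<delta> * p') \<cdot>\<^sub>v (?E *\<^sub>v v)) $ i = inverse \<delta> * \<delta> * (A *\<^sub>v v) $ i"
        unfolding lin[OF v] using i carrier_matD[OF A] carrier_matD[OF D]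
        by (simp add: \<delta>_def algebra_simps del: index_mult_mat_vec)
      then show "(A *\<^sub>v v) $ i = ((inverse \<delta> * p) \<cdot>\<^sub>v (?F *\<^sub>v v) - (inverse \<delta> * p') \<cdot>\<^sub>v (?E *\<^sub>v v)) $ i"
        using d0 by simp
    qed (use A D in simp)
    moreover have "D *\<^sub>v v = (inverse \<delta> * q') \<cdot>\<^sub>v (?E *\<^sub>v v) - (inverse \<delta> * q) \<cdot>\<^sub>v (?F *\<^sub>v v)"
    proof (rule eq_vecI)
      fix i assume "i < dim_vec ((inverse \<delta> * q') \<cdot>\<^sub>v (?E *\<^sub>v v) - (inverse \<delta> * q) \<cdot>\<^sub>v (?F *\<^sub>v v))"
      then have i: "i < n" using A by simp
      have "((inverse \<delta> * q') \<cdot>\<^sub>v (?E *\<^sub>v v) - (inverse \<delta> * q) \<cdot>\<^sub>v (?F *\<^sub>v v)) $ i = inverse \<delta> * \<delta> * (D *\<^sub>v v) $ i"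
        unfolding lin[OF v] using i carrier_matD[OF A] carrier_matD[OF D]
        by (simp add: \<delta>_def algebra_simps del: index_mult_mat_vec)
      then show "(D *\<^sub>v v) $ i = ((inverse \<delta> * q') \<cdot>\<^sub>v (?E *\<^sub>v v) - (inverse \<delta> * q) \<cdot>\<^sub>v (?F *\<^sub>v v)) $ i"
        using d0 by simp
    qed (use A D in simp)
    ultimately show ?thesis using subsp_closed(2,5)[OF S] e by metis
  qed
  have "\<forall>x\<in>V. A *\<^sub>v x \<in> W \<and> D *\<^sub>v x \<in> W" "\<forall>x\<in>V'. A *\<^sub>v x \<in> W' \<and> D *\<^sub>v x \<in> W'"
    using 1 2 V W key subsp_closed(4) unfolding direct_sum_def by blast+
  then show "V = {0\<^sub>v n} \<and> W = {0\<^sub>v n} \<or> V' = {0\<^sub>v n} \<and> W' = {0\<^sub>v n}"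
    using ind V W unfolding indecomposable_pencil_def by blast
qed

section \<open>Nilpotent operators and Kronecker products of pencils\<close>

lemma pow_mat_fixed_vec:
  fixes B :: "'a::field mat"
  assumes B: "B \<in> carrier_mat n n" and y: "y \<in> carrier_vec n" "B *\<^sub>v y = y"
  shows "(B ^\<^sub>m k) *\<^sub>v y = y"
proof (induction k)
  case (Suc k)
  have "B ^\<^sub>m k \<in> carrier_mat n n" using B by simp
  then show ?case using assoc_mult_mat_vec[of "B ^\<^sub>m k" n n B n y] B y Suc by simp
qed (use B y in simp)

lemma kron_pow:
  fixes A B :: "'a::field mat"
  assumes "A \<in> carrier_mat m m" "B \<in> carrier_mat n n"
  shows "kron A B ^\<^sub>m k = kron (A ^\<^sub>m k) (B ^\<^sub>m k)"
proof (induction k)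
  case 0
  then show ?case using assms by (simp add: kron_one)
next
  case (Suc k)
  have "A ^\<^sub>m k \<in> carrier_mat m m" "B ^\<^sub>m k \<in> carrier_mat n n" using assms by auto
  then show ?case using Suc assms by (simp add: kron_mult)
qed

text \<open>A fixed vector of \<open>T\<close> is fixed by every power of \<open>T\<close>, one of
  which is zero; so the unipotent operator \<open>1 - T\<close> is injective.\<close>

lemma unipotent_inj:
  fixes T :: "'a::field mat"
  assumes T: "T \<in> carrier_mat n n" and nil: "T ^\<^sub>m p = 0\<^sub>m n n" and y: "y \<in> carrier_vec n" "T *\<^sub>v y = y"
  shows "y = 0\<^sub>v n"
  using pow_mat_fixed_vec[OF T y, of p] zero_mat_mult_vec[OF y(1), of n] nil by simp

text \<open>With \<open>E\<close> nilpotent relative to \<open>F\<close> and \<open>F'\<close> nilpotent relative to \<open>E'\<close>, the operator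
  \<open>E \<otimes> F' - F \<otimes> E'\<close> is an invertible operator times a unipotent one.\<close>

lemma kron_pencils_inj:
  fixes E F :: "'a::field mat"
  assumes inf: "infinite (UNIV :: 'a set)"
    and ind: "indecomposable_pencil m E F" and E: "E \<in> carrier_mat m m" and F: "F \<in> carrier_mat m m"
    and v: "v \<in> carrier_vec m" "v \<noteq> 0\<^sub>v m" "E *\<^sub>v v = 0\<^sub>v m"
    and ind': "indecomposable_pencil n F' E'" and E': "E' \<in> carrier_mat n n" and F': "F' \<in> carrier_mat n n"
    and v': "v' \<in> carrier_vec n" "v' \<noteq> 0\<^sub>v n" "F' *\<^sub>v v' = 0\<^sub>v n"
  shows "inj_mat (kron E F' + (- 1) \<cdot>\<^sub>m kron F E')"
proof -
  obtain X Y T c p where X: "X \<in> carrier_mat m m" "Y \<in> carrier_mat m m" and T: "T \<in> carrier_mat m m"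
    and YX: "Y * X = 1\<^sub>m m" and EX: "E = X * T" and FX: "F = c \<cdot>\<^sub>m (X * (1\<^sub>m m - T))" and c: "c \<noteq> 0" and Tp: "T ^\<^sub>m p = 0\<^sub>m m m"
    using indecomposable_pencil_normal_form[OF inf ind E F v] by metis
  obtain X' Y' T' c' p' where X': "X' \<in> carrier_mat n n" "Y' \<in> carrier_mat n n" and T': "T' \<in> carrier_mat n n"
    and YX': "Y' * X' = 1\<^sub>m n" and EX': "E' = c' \<cdot>\<^sub>m (X' * (1\<^sub>m n - T'))" and c': "c' \<noteq> 0" and Tp': "T' ^\<^sub>m p' = 0\<^sub>m n n"
    using indecomposable_pencil_normal_form[OF inf ind' F' E' v'] by metis
  \<comment> \<open>\<open>E'\<close> is a nonzero multiple of an invertible matrix times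
    \<open>1 - T'\<close>, and \<open>T'\<close> is nilpotent.\<close>
  have "inj_mat E'"
  proof (rule inj_matI[OF E'])
    fix y assume y: "y \<in> carrier_vec n" "E' *\<^sub>v y = 0\<^sub>v n"
    have d: "1\<^sub>m n - T' \<in> carrier_mat n n" by (rule minus_carrier_mat[OF T'])
    have "(X' * (1\<^sub>m n - T')) *\<^sub>v y = inverse c' \<cdot>\<^sub>v (E' *\<^sub>v y)"
      unfolding EX' smult_mat_mult_vec[OF mult_carrier_mat[OF X'(1) d] y(1)] using c' by (simp add: smult_smult_assoc)
    then have "(X' * (1\<^sub>m n - T')) *\<^sub>v y = 0\<^sub>v n" using y(2) by simp
    then have "X' *\<^sub>v ((1\<^sub>m n - T') *\<^sub>v y) = 0\<^sub>v n" using assoc_mult_mat_vec[OF X'(1) d y(1)] by simp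
    then have "(1\<^sub>m n - T') *\<^sub>v y = 0\<^sub>v n"
      using inj_matD[OF left_inverse_imp_inj_mat[OF X' YX'] X'(1)] mult_mat_vec_carrier[OF d y(1)] by blast
    then have "y - T' *\<^sub>v y = 0\<^sub>v n" using minus_mult_distrib_mat_vec[OF one_carrier_mat T' y(1)] y(1) by simp
    then have "y = T' *\<^sub>v y" by (rule minus_eq_zero_vecD[OF y(1) mult_mat_vec_carrier[OF T' y(1)]])
    then show "y = 0\<^sub>v n" using unipotent_inj[OF T' Tp' y(1)] by simp
  qed
  then obtain G where G: "G \<in> carrier_mat n n" "G * E' = 1\<^sub>m n" using inj_mat_square[OF E'] by metis
  \<comment> \<open>Multiplying the operator by \<open>kron Y G\<close> gives \<open>T\<close>
    tensored with \<open>G * F'\<close>, minus \<open>c (1 - T)\<close> tensored with the identity.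
    The terms containing \<open>T\<close> combine to \<open>c\<close> times \<open>kron T R\<close>,
    which leaves \<open>c (B - 1)\<close>.\<close>
  define R where "R = inverse c \<cdot>\<^sub>m (G * F') + 1\<^sub>m n"
  have R: "R \<in> carrier_mat n n" using G F' by (simp add: R_def)
  define B where "B = kron T R"
  have B: "B \<in> carrier_mat (m * n) (m * n)" using T R by (simp add: B_def)
  note d = carrier_matD[OF X(1)] carrier_matD[OF X(2)] carrier_matD[OF T] carrier_matD[OF G(1)] carrier_matD[OF E'] carrier_matD[OF F']
    carrier_matD[OF E] carrier_matD[OF F]
  let ?J = "kron E F' + (- 1) \<cdot>\<^sub>m kron F E'"
  have J: "?J \<in> carrier_mat (m * n) (m * n)" using E F E' F' by simp
  have YE: "Y * E = T" using assoc_mult_mat[OF X(2) X(1) T] YX T by (simp add: EX)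
  have YF: "Y * F = c \<cdot>\<^sub>m (1\<^sub>m m + (- 1) \<cdot>\<^sub>m T)"
  proof -
    have "Y * F = c \<cdot>\<^sub>m (Y * (X * (1\<^sub>m m - T)))" unfolding FX by (simp add: dim_mult_smult d)
    also have "Y * (X * (1\<^sub>m m - T)) = (Y * X) * (1\<^sub>m m - T)" by (simp add: dim_mult_assoc d)
    finally show ?thesis unfolding YX by (simp add: minus_mat_smult d dim_mult_one_zero)
  qed
  have YJ: "kron Y G * ?J = c \<cdot>\<^sub>m (B + (- 1) \<cdot>\<^sub>m 1\<^sub>m (m * n))"
  proof -
    have "kron Y G * ?J = kron T (G * F') + (- 1) \<cdot>\<^sub>m kron (c \<cdot>\<^sub>m (1\<^sub>m m + (- 1) \<cdot>\<^sub>m T)) (1\<^sub>m n)"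
      by (simp add: dim_mult_distrib dim_mult_smult kron_mult d YE YF G(2))
    also have "\<dots> = c \<cdot>\<^sub>m (B + (- 1) \<cdot>\<^sub>m 1\<^sub>m (m * n))"
      unfolding B_def R_def using c
      by (intro eq_matI) (auto simp: mat_simps kron_one d algebra_simps simp del: index_mult_mat(1))
    finally show ?thesis .
  qed
  show ?thesis
  proof (rule inj_matI[OF J])
    fix y assume y: "y \<in> carrier_vec (m * n)" "?J *\<^sub>v y = 0\<^sub>v (m * n)"
    have K: "kron Y G \<in> carrier_mat (m * n) (m * n)" using X G by simp
    have D: "B + (- 1) \<cdot>\<^sub>m 1\<^sub>m (m * n) \<in> carrier_mat (m * n) (m * n)" using B by simp
    have By: "B *\<^sub>v y \<in> carrier_vec (m * n)" by (rule mult_mat_vec_carrier[OF B y(1)])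
    have "c \<cdot>\<^sub>v ((B + (- 1) \<cdot>\<^sub>m 1\<^sub>m (m * n)) *\<^sub>v y) = (kron Y G * ?J) *\<^sub>v y"
      unfolding YJ smult_mat_mult_vec[OF D y(1)] ..
    also have "\<dots> = 0\<^sub>v (m * n)" using assoc_mult_mat_vec[OF K J y(1)] y(2) mult_zero_vec[OF K] by simp
    finally have z: "c \<cdot>\<^sub>v ((B + (- 1) \<cdot>\<^sub>m 1\<^sub>m (m * n)) *\<^sub>v y) = 0\<^sub>v (m * n)" .
    have "(B + (- 1) \<cdot>\<^sub>m 1\<^sub>m (m * n)) *\<^sub>v y = inverse c \<cdot>\<^sub>v (c \<cdot>\<^sub>v ((B + (- 1) \<cdot>\<^sub>m 1\<^sub>m (m * n)) *\<^sub>v y))"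
      using c by (simp add: smult_smult_assoc)
    then have "(B + (- 1) \<cdot>\<^sub>m 1\<^sub>m (m * n)) *\<^sub>v y = 0\<^sub>v (m * n)" unfolding z by simp
    moreover have "(B + (- 1) \<cdot>\<^sub>m 1\<^sub>m (m * n)) *\<^sub>v y = B *\<^sub>v y + (- 1) \<cdot>\<^sub>v y"
      using add_mult_distrib_mat_vec[OF B _ y(1), of "(- 1) \<cdot>\<^sub>m 1\<^sub>m (m * n)"] smult_mat_mult_vec[OF one_carrier_mat y(1), of "- 1"] y(1) by simp
    moreover have "B *\<^sub>v y + (- 1) \<cdot>\<^sub>v y = B *\<^sub>v y - y" using y(1) by (intro eq_vecI) auto
    ultimately have "B *\<^sub>v y = y" by (intro minus_eq_zero_vecD[OF By y(1)]) simp
    \<comment> \<open>One nilpotent tensor factor makes the product nilpotent, whatever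
      \<open>R\<close> is.\<close>
    moreover have "B ^\<^sub>m p = 0\<^sub>m (m * n) (m * n)"
    proof -
      have "R ^\<^sub>m p \<in> carrier_mat n n" using R by simp
      then show ?thesis unfolding B_def kron_pow[OF T R] Tp using R by (simp add: kron_zero)
    qed
    ultimately show "y = 0\<^sub>v (m * n)" using unipotent_inj[OF B _ y(1)] by simp
  qed
qed

section \<open>Signs, homogeneous coordinates, and the freeness of the tensor product\<close>

lemma parity_sign_add: "parity_sign (r + r') = parity_sign r * (parity_sign r' :: 'k::field)"
  by (cases r; cases r') (simp_all add: parity_sign_def)

text \<open>\<open>coord_d\<close> and \<open>coord_a\<close> are homogeneous coordinates on the
  projective line, and distinct points have linearly independent coordinates.\<close>

lemma coord_det: "\<alpha> \<noteq> \<eta> \<Longrightarrow> coord_d \<alpha> * coord_a \<eta> - coord_a \<alpha> * coord_d \<eta> \<noteq> (0 :: 'k::field)"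
  by (cases \<alpha>; cases \<eta>) (auto simp: coord_a_def coord_d_def)

lemma two_neq_zero:
  assumes "CHAR('k::field) \<noteq> 2"
  shows "(2 :: 'k) \<noteq> 0"
proof
  assume "(2 :: 'k) = 0"
  then have "of_nat 2 = (0 :: 'k)" by simp
  then have "CHAR('k) dvd 2" by (simp only: of_nat_eq_0_iff_char_dvd)
  moreover from this have "CHAR('k) \<le> 2" by (rule dvd_imp_le) simp
  moreover have "CHAR('k) \<noteq> 0" using \<open>CHAR('k) dvd 2\<close> by (intro notI) simp
  moreover have "CHAR('k) \<noteq> 1" by simp
  ultimately show False using assms by linarith
qed

theorem proposition2p25:
  fixes r r' :: bit
    and \<alpha> \<eta> :: "'k::alg_closed_field proj_line"
    and s t :: nat
    and M N P :: "'k d4mod"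
  assumes "CHAR('k) \<noteq> 2"
    and "\<alpha> \<noteq> \<eta>"
    and "s \<ge> 1" and "t \<ge> 1"
    and "is_Ms s r \<alpha> M"
    and "is_Ms t r' \<eta> N"
    and "projective_cover P (V_mod (r + r'))"
  shows "tensor M N \<simeq> copies (s * t) P"
proof -
  have two: "(2 :: 'k) \<noteq> 0" by (rule two_neq_zero[OF assms(1)])
  define q where "q = r + r'"
  let ?\<sigma> = "parity_sign r :: 'k" and ?\<sigma>' = "parity_sign r' :: 'k"
  obtain V W A D v where M: "d4_module M" "mdim M = 2 * s"
    and V: "V \<in> carrier_mat (mdim M) s" and W: "W \<in> carrier_mat (mdim M) s"
    and A: "A \<in> carrier_mat s s" and D: "D \<in> carrier_mat s s" and injW: "inj_mat W"
    and bV: "act M Gb * V = (- ?\<sigma>) \<cdot>\<^sub>m V" "act M Gc * V = (- ?\<sigma>) \<cdot>\<^sub>m V"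
    and bW: "act M Gb * W = ?\<sigma> \<cdot>\<^sub>m W" "act M Gc * W = ?\<sigma> \<cdot>\<^sub>m W"
    and aV: "act M Ga * V = W * A" "act M Gd * V = W * D"
    and aW: "act M Ga * W = 0\<^sub>m (mdim M) s" "act M Gd * W = 0\<^sub>m (mdim M) s"
    and ind: "indecomposable_pencil s A D" and v: "v \<in> carrier_vec s" "v \<noteq> 0\<^sub>v s"
      "coord_d \<alpha> \<cdot>\<^sub>v (D *\<^sub>v v) + coord_a \<alpha> \<cdot>\<^sub>v (A *\<^sub>v v) = 0\<^sub>v s"
    by (rule Ms_structure[OF two assms(5)])
  obtain V' W' A' D' v' where N: "d4_module N" "mdim N = 2 * t"
    and V': "V' \<in> carrier_mat (mdim N) t" and W': "W' \<in> carrier_mat (mdim N) t"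
    and A': "A' \<in> carrier_mat t t" and D': "D' \<in> carrier_mat t t" and injW': "inj_mat W'"
    and bV': "act N Gb * V' = (- ?\<sigma>') \<cdot>\<^sub>m V'" "act N Gc * V' = (- ?\<sigma>') \<cdot>\<^sub>m V'"
    and bW': "act N Gb * W' = ?\<sigma>' \<cdot>\<^sub>m W'" "act N Gc * W' = ?\<sigma>' \<cdot>\<^sub>m W'"
    and aV': "act N Ga * V' = W' * A'" "act N Gd * V' = W' * D'"
    and aW': "act N Ga * W' = 0\<^sub>m (mdim N) t" "act N Gd * W' = 0\<^sub>m (mdim N) t"
    and ind': "indecomposable_pencil t A' D'" and v': "v' \<in> carrier_vec t" "v' \<noteq> 0\<^sub>v t"
      "coord_d \<eta> \<cdot>\<^sub>v (D' *\<^sub>v v') + coord_a \<eta> \<cdot>\<^sub>v (A' *\<^sub>v v') = 0\<^sub>v t"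
    by (rule Ms_structure[OF two assms(6)])
  define X where "X = tensor M N"
  have X: "d4_module X" unfolding X_def by (rule d4_module_tensor[OF M(1) N(1)])
  have dX: "mdim X = mdim M * mdim N" by (simp add: X_def act_tensor)
  note d = d4_moduleD(2,3)[OF M(1)] d4_moduleD(2,3)[OF N(1)] carrier_matD[OF V] carrier_matD[OF W] carrier_matD[OF A] carrier_matD[OF D]
    carrier_matD[OF V'] carrier_matD[OF W'] carrier_matD[OF A'] carrier_matD[OF D']
  \<comment> \<open>The tensors of the two tops serve as generators; the weights
    \<open>- ?\<sigma>\<close> and \<open>- ?\<sigma>'\<close> multiply to that of
    \<open>V(r + r')\<close>.\<close>
  define z where "z = kron V V'"
  have z: "z \<in> carrier_mat (mdim X) (s * t)" using V V' by (simp add: z_def dX)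
  have bz: "act X Gb * z = parity_sign q \<cdot>\<^sub>m z"
    unfolding X_def act_tensor(3) z_def q_def parity_sign_add
    by (simp add: kron_mult d bV bV' kron_smult smult_smult_mat mult.commute)
  have cz: "act X Gc * z = parity_sign q \<cdot>\<^sub>m z"
    unfolding X_def act_tensor(4) z_def q_def parity_sign_add
    by (simp add: kron_mult d bV bV' kron_smult smult_smult_mat mult.commute)
  \<comment> \<open>In a single factor every product of \<open>a\<close> and \<open>d\<close>
    vanishes on the top, so \<open>ad\<close> contributes only terms in which one of them acts on
    each factor. The relative sign comes from the weights of \<open>b\<close> and \<open>c\<close>
    on the top and the socle of the second factor.\<close>
  define J where "J = kron A D' + (- 1) \<cdot>\<^sub>m kron D A'"
  have J: "J \<in> carrier_mat (s * t) (s * t)" using A D A' D' by (simp add: J_def)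
  have adz: "act X Ga * (act X Gd * z) = ?\<sigma>' \<cdot>\<^sub>m (kron W W' * J)"
  proof -
    have assoc: "act M g * (W * Y) = (act M g * W) * Y" if "dim_row Y = s" for g Y
      using that by (simp add: dim_mult_assoc d)
    have assoc': "act N g * (W' * Y) = (act N g * W') * Y" if "dim_row Y = t" for g Y
      using that by (simp add: dim_mult_assoc d)
    have dz: "act X Gd * z = (- ?\<sigma>') \<cdot>\<^sub>m kron (W * D) V' + kron V (W' * D')"
      unfolding X_def act_tensor(5) z_def
      by (simp add: dim_mult_distrib kron_mult d aV aV' bV' kron_smult dim_mult_one_zero)
    have "act X Ga * ((- ?\<sigma>') \<cdot>\<^sub>m kron (W * D) V' + kron V (W' * D')) =
       (- ?\<sigma>') \<cdot>\<^sub>m kron (W * D) (W' * A') + ?\<sigma>' \<cdot>\<^sub>m kron (W * A) (W' * D')"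
      unfolding X_def act_tensor(2)
      by (simp add: dim_mult_distrib dim_mult_smult kron_mult d assoc assoc' aV aV' aW aW' bV' bW' kron_smult kron_zero dim_mult_one_zero)
        (auto intro!: eq_matI simp: d simp del: index_mult_mat(1))
    also have "\<dots> = ?\<sigma>' \<cdot>\<^sub>m (kron W W' * J)"
      unfolding J_def
      by (simp add: dim_mult_distrib dim_mult_smult kron_mult d)
        (auto intro!: eq_matI simp: d algebra_simps simp del: index_mult_mat(1))
    finally show ?thesis unfolding dz .
  qed
  \<comment> \<open>The coordinates of \<alpha> and of \<eta> are used in both factors:
    \<open>E\<close> kills \<open>v\<close> because of \<alpha>, and \<open>F'\<close> kills
    \<open>v'\<close> because of \<eta>.\<close>
  define E where "E = coord_d \<alpha> \<cdot>\<^sub>m D + coord_a \<alpha> \<cdot>\<^sub>m A"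
  define F where "F = coord_d \<eta> \<cdot>\<^sub>m D + coord_a \<eta> \<cdot>\<^sub>m A"
  define E' where "E' = coord_d \<alpha> \<cdot>\<^sub>m D' + coord_a \<alpha> \<cdot>\<^sub>m A'"
  define F' where "F' = coord_d \<eta> \<cdot>\<^sub>m D' + coord_a \<eta> \<cdot>\<^sub>m A'"
  have EF: "E \<in> carrier_mat s s" "F \<in> carrier_mat s s" "E' \<in> carrier_mat t t" "F' \<in> carrier_mat t t"
    using A D A' D' by (simp_all add: E_def F_def E'_def F'_def)
  define \<delta> where "\<delta> = coord_d \<alpha> * coord_a \<eta> - coord_a \<alpha> * coord_d \<eta>"
  have \<delta>: "\<delta> \<noteq> 0" unfolding \<delta>_def by (rule coord_det[OF assms(2)])
  have indE: "indecomposable_pencil s E F"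
    unfolding E_def F_def by (rule indecomposable_pencil_change[OF ind A D coord_det[OF assms(2)]])
  have indF: "indecomposable_pencil t F' E'"
    unfolding E'_def F'_def
    by (rule indecomposable_pencil_change[OF ind' A' D' coord_det[OF assms(2)[symmetric]]])
  have Ev: "E *\<^sub>v v = 0\<^sub>v s"
    using v add_mult_distrib_mat_vec[of "coord_d \<alpha> \<cdot>\<^sub>m D" s s "coord_a \<alpha> \<cdot>\<^sub>m A" v] A D
    by (simp add: E_def smult_mat_mult_vec[OF A v(1)] smult_mat_mult_vec[OF D v(1)])
  have Fv: "F' *\<^sub>v v' = 0\<^sub>v t"
    using v' add_mult_distrib_mat_vec[of "coord_d \<eta> \<cdot>\<^sub>m D'" t t "coord_a \<eta> \<cdot>\<^sub>m A'" v'] A' D'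
    by (simp add: F'_def smult_mat_mult_vec[OF A' v'(1)] smult_mat_mult_vec[OF D' v'(1)])
  \<comment> \<open>The expression alternates in the two members of the pencil, so the change of
    basis multiplies it by a determinant: the terms with \<open>D\<close> and \<open>D'\<close> or
    with \<open>A\<close> and \<open>A'\<close> cancel.\<close>
  have JEF: "kron E F' + (- 1) \<cdot>\<^sub>m kron F E' = (- \<delta>) \<cdot>\<^sub>m J"
    unfolding E_def F_def E'_def F'_def J_def \<delta>_def
    by (intro eq_matI) (auto simp: mat_simps d algebra_simps simp del: index_mult_mat(1))
  have injEF: "inj_mat (kron E F' + (- 1) \<cdot>\<^sub>m kron F E')"
    by (rule kron_pencils_inj[OF infinite_UNIV_alg_closed indE EF(1,2) v(1,2) Ev indF EF(3,4) v'(1,2) Fv])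
  obtain L where L: "L \<in> carrier_mat s (mdim M)" "L * W = 1\<^sub>m s" by (rule left_inverse_exists[OF W injW])
  obtain L' where L': "L' \<in> carrier_mat t (mdim N)" "L' * W' = 1\<^sub>m t" by (rule left_inverse_exists[OF W' injW'])
  have WW: "kron W W' \<in> carrier_mat (mdim X) (s * t)" using W W' by (simp add: dX)
  have LL: "kron L L' \<in> carrier_mat (s * t) (mdim X)" using L L' by (simp add: dX)
  have LW: "kron L L' * kron W W' = 1\<^sub>m (s * t)"
    using L(1) L'(1) W W' by (simp add: kron_mult L(2) L'(2) kron_one)
  have WJ: "kron W W' * J \<in> carrier_mat (mdim X) (s * t)" by (rule mult_carrier_mat[OF WW J])
  have "inj_mat (act X Ga * (act X Gd * z))"
    unfolding adz
  proof (rule inj_matI)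
    show "?\<sigma>' \<cdot>\<^sub>m (kron W W' * J) \<in> carrier_mat (mdim X) (s * t)" using WJ by simp
    fix y assume y: "y \<in> carrier_vec (s * t)" "(?\<sigma>' \<cdot>\<^sub>m (kron W W' * J)) *\<^sub>v y = 0\<^sub>v (mdim X)"
    have Jy: "J *\<^sub>v y \<in> carrier_vec (s * t)" by (rule mult_mat_vec_carrier[OF J y(1)])
    have "(kron W W' * J) *\<^sub>v y = ?\<sigma>' \<cdot>\<^sub>v (?\<sigma>' \<cdot>\<^sub>v ((kron W W' * J) *\<^sub>v y))" by (simp add: smult_smult_assoc)
    also have "\<dots> = 0\<^sub>v (mdim X)" using y(2) unfolding smult_mat_mult_vec[OF WJ y(1)] by simp
    finally have "kron W W' *\<^sub>v (J *\<^sub>v y) = 0\<^sub>v (mdim X)" using assoc_mult_mat_vec[OF WW J y(1)] by simp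
    then have "J *\<^sub>v y = 0\<^sub>v (s * t)" by (rule inj_matD[OF left_inverse_imp_inj_mat[OF WW LL LW] WW Jy])
    then have "(kron E F' + (- 1) \<cdot>\<^sub>m kron F E') *\<^sub>v y = 0\<^sub>v (s * t)"
      unfolding JEF smult_mat_mult_vec[OF J y(1)] by simp
    moreover have "kron E F' + (- 1) \<cdot>\<^sub>m kron F E' \<in> carrier_mat (s * t) (s * t)" using EF by simp
    ultimately show "y = 0\<^sub>v (s * t)" using inj_matD[OF injEF] y(1) by blast
  qed
  then have inj: "inj_mat (free_map X z)" by (rule free_map_inj[OF X z bz cz])
  let ?n = "s * t"
  let ?P4 = "proj4 q :: 'k d4mod"
  \<comment> \<open>\<open>2 * s\<close> times \<open>2 * t\<close> is the dimension of
    \<open>s * t\<close> copies of the four-dimensional model, so the injective map from the free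
    module is invertible.\<close>
  have dim: "mdim X = ?n * 4" by (simp add: dX M N)
  define T where "T = free_map X z"
  have Th: "T \<in> d4_hom (copies ?n ?P4) X" unfolding T_def by (rule free_map_hom[OF X z bz cz])
  have Tc: "T \<in> carrier_mat (?n * 4) (?n * 4)" using free_map_carrier[OF X z] dim by (simp add: T_def)
  obtain R where R: "R \<in> carrier_mat (?n * 4) (?n * 4)" "R * T = 1\<^sub>m (?n * 4)" "T * R = 1\<^sub>m (?n * 4)"
    using inj_mat_square[OF Tc inj[folded T_def]] .
  note P4 = d4_module_proj4[of q, where 'k = 'k]
  have [simp]: "mdim ?P4 = 4" by (simp add: proj4_def)
  have dc: "mdim (copies ?n ?P4) = ?n * 4" by (simp add: act_copies[OF P4])
  have Rh: "R \<in> d4_hom X (copies ?n ?P4)"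
    by (rule d4_hom_inverse[OF Th _ _ _ d4_module_copies[OF P4] X]) (use R dim dc in simp_all)
  obtain G S where G: "G \<in> d4_hom ?P4 P" and S: "S \<in> carrier_mat 4 (mdim P)"
    and GS: "G * S = 1\<^sub>m (mdim P)" "S * G = 1\<^sub>m 4" and P: "d4_module P"
    by (rule projective_cover_proj4[OF two assms(7)[folded q_def]])
  have Gc: "G \<in> carrier_mat (mdim P) 4" using d4_homD(1)[OF G] by simp
  define G' S' where "G' = kron (1\<^sub>m ?n) G" and "S' = kron (1\<^sub>m ?n) S"
  have G'c: "G' \<in> carrier_mat (?n * mdim P) (?n * 4)" and S'c: "S' \<in> carrier_mat (?n * 4) (?n * mdim P)"
    using Gc S by (simp_all add: G'_def S'_def)
  have GS': "G' * S' = 1\<^sub>m (?n * mdim P)" "S' * G' = 1\<^sub>m (?n * 4)"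
    using carrier_matD[OF Gc] carrier_matD[OF S] by (simp_all add: G'_def S'_def kron_mult GS kron_one)
  have G'h: "G' \<in> d4_hom (copies ?n ?P4) (copies ?n P)" unfolding G'_def by (rule copies_hom[OF P4 P G])
  have "X \<simeq> copies ?n P"
  proof (rule isomorphicI)
    show "G' * R \<in> d4_hom X (copies ?n P)"
      by (rule d4_hom_comp[OF Rh G'h X d4_module_copies[OF P4] d4_module_copies[OF P]])
    show "T * S' \<in> carrier_mat (mdim X) (mdim (copies ?n P))"
      using mult_carrier_mat[OF Tc S'c] dim by (simp add: act_copies[OF P])
    have "G' * R * (T * S') = G' * ((R * T) * S')"
      using carrier_matD[OF G'c] carrier_matD[OF S'c] carrier_matD[OF Tc] carrier_matD[OF R(1)] by (simp add: dim_mult_assoc)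
    also have "\<dots> = 1\<^sub>m (mdim (copies ?n P))"
      unfolding R(2) using S'c GS'(1) by (simp add: act_copies[OF P])
    finally show "G' * R * (T * S') = 1\<^sub>m (mdim (copies ?n P))" .
    have "T * S' * (G' * R) = T * ((S' * G') * R)"
      using carrier_matD[OF G'c] carrier_matD[OF S'c] carrier_matD[OF Tc] carrier_matD[OF R(1)] by (simp add: dim_mult_assoc)
    also have "\<dots> = 1\<^sub>m (mdim X)" unfolding GS'(2) using R(1,3) dim by simp
    finally show "T * S' * (G' * R) = 1\<^sub>m (mdim X)" .
  qed
  then show ?thesis by (simp add: X_def)
qed

end
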